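(* Let $p>2$ and $1<q\le p$, and let $\mathscr{D}$ be an admissible operator of spectral growth order $p$. Assume that the measurement locations $U_{ij}$, $i=1,\dots,n$, $j=1,\dots,r_i$, are independent copies of $U\sim\mathrm{Unif}(\mathbb{S}^2)$. Let $\mu_\eta$ be the mean estimator $$\mu_\eta=\operatorname*{arg\,min}_{g\in\mathcal{H}_p}\ \frac{4\pi}{n}\sum_{i=1}^n\frac1{r_i}\sum_{j=1}^{r_i}(W_{ij}-g(U_{ij}))^2+\eta\,\|\mathscr{D}g\|^2_{L^2(\mathbb{S}^2)}.$$ If $\eta\asymp(nr)^{-p/(p+1)}$, then $$\lim_{D\to\infty}\limsup_{n\to\infty}\sup_{\mathbb{P}_X\in\Pi_1(p,q)}\mathbb{P}\Big(\|\mu_\eta-\mu\|^2_{L^2(\mathbb{S}^2)}>D\big((nr)^{-p/(p+1)}+n^{-1}\big)\Big)=0.$$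
   Context: $\mathbb{S}^2$ is the unit sphere of $\mathbb{R}^3$ with surface measure (total mass $4\pi$), and $\{Y_{\ell,m}\}_{\ell\in\mathbb{N},-\ell\le m\le\ell}$ is a standard real orthonormal basis of spherical harmonics of $L^2(\mathbb{S}^2)$. For $s\ge0$, $\mathcal{H}_s=\{f\in L^2(\mathbb{S}^2):\|f\|_{\mathcal{H}_s}^2=\sum_{\ell\ge0}(1+\ell(\ell+1))^s\sum_{m=-\ell}^{\ell}\langle f,Y_{\ell,m}\rangle_{L^2(\mathbb S^2)}^2<\infty\}$; for $s>1$ its elements are identified with their continuous representatives. An admissible operator $\mathscr{D}$ of spectral growth order $p$ is a linear operator $\mathscr{D}f=\sum_{\ell}D_\ell\sum_{m}\langle f,Y_{\ell,m}\rangle_{L^2(\mathbb S^2)}Y_{\ell,m}$ with non-zero real $D_\ell$ satisfying $C_1(1+\ell)^p\le|D_\ell|\le C_2(1+\ell)^p$ for all $\ell\in\mathbb{N}$ and some constants $C_1,C_2>0$, viewed as an operator $\mathcal{H}_p\to L^2(\mathbb{S}^2)$. Model: $X=\{X(u),u\in\mathbb{S}^2\}$ is a second-order process that is a random element of $\mathcal{H}_q$, with mean $\mu(u)=\mathbb{E}[X(u)]$ and law $\mathbb{P}_X$. $X_1,\dots,X_n$ are i.i.d. copies of $X$, and one observes $$W_{ij}=X_i(U_{ij})+\epsilon_{ij},\qquad i=1,\dots,n,\ j=1,\dots,r_i,$$ with $\epsilon_{ij}$ i.i.d. of mean $0$ and variance $0<\sigma^2<\infty$; the $X_i$'s, the locations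 $U_{ij}$ and the errors $\epsilon_{ij}$ are mutually independent. The integers $r_i\ge1$ may depend on $n$, and $r=\big(\frac1n\sum_{i=1}^n\frac1{r_i}\big)^{-1}$ is their harmonic mean. $\Pi_1(p,q)$ (for fixed constants $M,K>0$) is the collection of laws $\mathbb{P}_X$ of $\mathcal{H}_q$-valued processes $X$ with $\mathbb{E}\|X\|^2_{\mathcal{H}_q}\le M$ and $\|\mu\|^2_{\mathcal{H}_p}\le K$. The notation $\eta\asymp a_n$ means that $\eta=\eta_n$ satisfies $c\,a_n\le\eta_n\le c'a_n$ for constants $0<c\le c'<\infty$. *)

theory Defs
  imports "HOL-Probability.Probability"
begin

abbreviation S2 :: "(real^3) set" where
  "S2 \<equiv> sphere 0 1"

text \<open>Surface measure: the area of \<open>A \<subseteq> S2\<close> is three times the volume of the cone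
  \<open>{t x | 0 < t < 1, x \<in> A}\<close>. Functions on the sphere are represented by functions
  \<open>real^3 \<Rightarrow> real\<close> whose values outside \<open>S2\<close> are irrelevant.\<close>

definition surf :: "(real^3) measure" where
  "surf = scale_measure 3
     (distr (restrict_space lborel (ball 0 1 - {0})) (restrict_space borel S2) sgn)"

lemma space_surf [simp]: "space surf = S2"
  by (simp add: surf_def space_scale_measure space_restrict_space)

lemma sets_surf [measurable_cong]: "sets surf = sets (restrict_space borel S2)"
  by (simp add: surf_def)

lemma emeasure_surf_S2: "emeasure surf S2 = ennreal (4 * pi)"
proof -
  let ?B = "ball 0 1 - {0} :: (real^3) set"
  have "sgn \<in> borel_measurable (borel :: (real^3) measure)"
    unfolding sgn_div_norm by measurable
  hence meas: "sgn \<in> restrict_space lborel ?B \<rightarrow>\<^sub>M restrict_space borel S2"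
    by (intro measurable_restrict_space2 measurable_restrict_space1)
       (auto simp: space_restrict_space norm_sgn)
  have vol: "emeasure lborel (ball (0::real^3) 1) = ennreal (4 / 3 * pi)"
  proof -
    have "unit_ball_vol (real 3) = 4 / 3 * pi"
      using unit_ball_vol_3 by simp
    thus ?thesis
      using emeasure_ball[of 1 "0::real^3"] by simp
  qed
  have "emeasure surf S2 = 3 * emeasure (restrict_space lborel ?B) (sgn -` S2 \<inter> ?B)"
    using meas sets.top[of "restrict_space borel S2"]
    by (simp add: surf_def emeasure_distr space_restrict_space)
  also have "sgn -` S2 \<inter> ?B = ?B"
    by (auto simp: norm_sgn)
  also have "emeasure (restrict_space lborel ?B) ?B = emeasure lborel ?B"
    by (subst emeasure_restrict_space) auto
  also have "\<dots> = emeasure lborel (ball (0::real^3) 1)"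
    by (rule emeasure_Diff_null_set) (auto simp: null_sets_def)
  also have "3 * \<dots> = ennreal (4 * pi)"
    unfolding vol by (simp flip: ennreal_numeral ennreal_mult'')
  finally show ?thesis .
qed

definition unif_S2 :: "(real^3) measure" where
  "unif_S2 = uniform_measure surf S2"

definition L2_S2 :: "(real^3 \<Rightarrow> real) set" where
  "L2_S2 = {f \<in> borel_measurable surf. integrable surf (\<lambda>x. (f x)\<^sup>2)}"

definition inner_S2 :: "(real^3 \<Rightarrow> real) \<Rightarrow> (real^3 \<Rightarrow> real) \<Rightarrow> real" where
  "inner_S2 f g = (LINT x|surf. f x * g x)"

definition norm_S2 :: "(real^3 \<Rightarrow> real) \<Rightarrow> real" where
  "norm_S2 f = sqrt (inner_S2 f f)"

definition laplacian :: "(real^3 \<Rightarrow> real) \<Rightarrow> real^3 \<Rightarrow> real" where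
  "laplacian h x = (\<Sum>b\<in>Basis. (deriv ^^ 2) (\<lambda>t. h (x + t *\<^sub>R b)) 0)"

definition spherical_harmonic :: "nat \<Rightarrow> (real^3 \<Rightarrow> real) \<Rightarrow> bool" where
  "spherical_harmonic l f \<longleftrightarrow>
     (\<exists>h. real_polynomial_function h \<and> (\<forall>t x. h (t *\<^sub>R x) = t ^ l * h x)
        \<and> (\<forall>x. laplacian h x = 0) \<and> (\<forall>x\<in>S2. f x = h x))"

text \<open>\<open>degree_part Y f l\<close> is the projection of \<open>f\<close> onto the spherical harmonics of degree \<open>l\<close>.\<close>

definition degree_part :: "(nat \<Rightarrow> int \<Rightarrow> real^3 \<Rightarrow> real) \<Rightarrow> (real^3 \<Rightarrow> real) \<Rightarrow> nat \<Rightarrow> real^3 \<Rightarrow> real" where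
  "degree_part Y f l x = (\<Sum>m\<in>{- int l..int l}. inner_S2 f (Y l m) * Y l m x)"

definition spherical_harmonic_basis :: "(nat \<Rightarrow> int \<Rightarrow> real^3 \<Rightarrow> real) \<Rightarrow> bool" where
  "spherical_harmonic_basis Y \<longleftrightarrow>
     (\<forall>l. \<forall>m\<in>{- int l..int l}. spherical_harmonic l (Y l m)) \<and>
     (\<forall>l l'. \<forall>m\<in>{- int l..int l}. \<forall>m'\<in>{- int l'..int l'}.
        inner_S2 (Y l m) (Y l' m') = (if l = l' \<and> m = m' then 1 else 0)) \<and>
     (\<forall>f\<in>L2_S2. (\<lambda>N. norm_S2 (\<lambda>x. f x - (\<Sum>l<N. degree_part Y f l x))) \<longlonglongrightarrow> 0)"

definition sobolev_term :: "(nat \<Rightarrow> int \<Rightarrow> real^3 \<Rightarrow> real) \<Rightarrow> real \<Rightarrow> (real^3 \<Rightarrow> real) \<Rightarrow> nat \<Rightarrow> real" where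
  "sobolev_term Y s f l =
     (1 + real l * (real l + 1)) powr s * (\<Sum>m\<in>{- int l..int l}. (inner_S2 f (Y l m))\<^sup>2)"

text \<open>For \<open>s > 1\<close> every class contains exactly one function continuous on the sphere, and only
  this representative is kept.\<close>

definition sobolev :: "(nat \<Rightarrow> int \<Rightarrow> real^3 \<Rightarrow> real) \<Rightarrow> real \<Rightarrow> (real^3 \<Rightarrow> real) set" where
  "sobolev Y s = {f \<in> L2_S2. summable (sobolev_term Y s f) \<and> (s > 1 \<longrightarrow> continuous_on S2 f)}"

definition sobolev_norm :: "(nat \<Rightarrow> int \<Rightarrow> real^3 \<Rightarrow> real) \<Rightarrow> real \<Rightarrow> (real^3 \<Rightarrow> real) \<Rightarrow> real" where
  "sobolev_norm Y s f = sqrt (\<Sum>l. sobolev_term Y s f l)"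

text \<open>The Borel sigma-algebra of the normed space \<open>sobolev Y s\<close>.\<close>

definition sobolev_borel :: "(nat \<Rightarrow> int \<Rightarrow> real^3 \<Rightarrow> real) \<Rightarrow> real \<Rightarrow> (real^3 \<Rightarrow> real) measure" where
  "sobolev_borel Y s = sigma (sobolev Y s)
     {V. V \<subseteq> sobolev Y s \<and>
        (\<forall>f\<in>V. \<exists>e>0. \<forall>g\<in>sobolev Y s. sobolev_norm Y s (\<lambda>x. g x - f x) < e \<longrightarrow> g \<in> V)}"

text \<open>The operator acts on representatives; its value at \<open>f\<close> is determined only almost everywhere,
  by convergence of its defining series in \<open>L2_S2\<close>.\<close>

definition admissible_operator ::
  "(nat \<Rightarrow> int \<Rightarrow> real^3 \<Rightarrow> real) \<Rightarrow> real \<Rightarrow> ((real^3 \<Rightarrow> real) \<Rightarrow> (real^3 \<Rightarrow> real)) \<Rightarrow> bool" where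
  "admissible_operator Y p \<D> \<longleftrightarrow>
     (\<exists>d :: nat \<Rightarrow> real.
        (\<forall>l. d l \<noteq> 0) \<and>
        (\<exists>C\<^sub>1>0. \<exists>C\<^sub>2>0. \<forall>l. C\<^sub>1 * (1 + real l) powr p \<le> \<bar>d l\<bar> \<and> \<bar>d l\<bar> \<le> C\<^sub>2 * (1 + real l) powr p) \<and>
        (\<forall>f\<in>sobolev Y p. \<D> f \<in> L2_S2 \<and>
           (\<lambda>N. norm_S2 (\<lambda>x. \<D> f x - (\<Sum>l<N. d l * degree_part Y f l x))) \<longlonglongrightarrow> 0))"

definition mean_fun :: "(real^3 \<Rightarrow> real) measure \<Rightarrow> real^3 \<Rightarrow> real" where
  "mean_fun P u = (LINT f|P. f u)"

definition Pi1 ::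
  "(nat \<Rightarrow> int \<Rightarrow> real^3 \<Rightarrow> real) \<Rightarrow> real \<Rightarrow> real \<Rightarrow> real \<Rightarrow> real \<Rightarrow> (real^3 \<Rightarrow> real) measure set" where
  "Pi1 Y M K p q =
     {P. prob_space P \<and> sets P = sets (sobolev_borel Y q) \<and>
         (\<integral>\<^sup>+ f. ennreal ((sobolev_norm Y q f)\<^sup>2) \<partial>P) \<le> ennreal M \<and>
         mean_fun P \<in> sobolev Y p \<and> (sobolev_norm Y p (mean_fun P))\<^sup>2 \<le> K}"

definition harmonic_mean :: "nat \<Rightarrow> (nat \<Rightarrow> nat) \<Rightarrow> real" where
  "harmonic_mean n r = inverse ((1 / real n) * (\<Sum>i=1..n. 1 / real (r i)))"

definition obs_index :: "nat \<Rightarrow> (nat \<Rightarrow> nat) \<Rightarrow> (nat \<times> nat) set" where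
  "obs_index n r = (SIGMA i:{1..n}. {1..r i})"

text \<open>Joint law of the curves, the locations and the errors, for curve law \<open>P\<close> and
  error law \<open>E\<close>: the product measure encodes the i.i.d. and mutual independence assumptions.\<close>

type_synonym sample = "(nat \<Rightarrow> real^3 \<Rightarrow> real) \<times> (nat \<times> nat \<Rightarrow> real^3) \<times> (nat \<times> nat \<Rightarrow> real)"

definition sample_law ::
  "(real^3 \<Rightarrow> real) measure \<Rightarrow> real measure \<Rightarrow> nat \<Rightarrow> (nat \<Rightarrow> nat) \<Rightarrow> sample measure" where
  "sample_law P E n r =
     (\<Pi>\<^sub>M i\<in>{1..n}. P) \<Otimes>\<^sub>M ((\<Pi>\<^sub>M k\<in>obs_index n r. unif_S2) \<Otimes>\<^sub>M (\<Pi>\<^sub>M k\<in>obs_index n r. E))"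

definition response :: "sample \<Rightarrow> nat \<Rightarrow> nat \<Rightarrow> real" where
  "response \<omega> i j = (case \<omega> of (X, U, e) \<Rightarrow> X i (U (i, j)) + e (i, j))"

definition location :: "sample \<Rightarrow> nat \<Rightarrow> nat \<Rightarrow> real^3" where
  "location \<omega> i j = (case \<omega> of (X, U, e) \<Rightarrow> U (i, j))"

definition mean_objective ::
  "((real^3 \<Rightarrow> real) \<Rightarrow> (real^3 \<Rightarrow> real)) \<Rightarrow> nat \<Rightarrow> (nat \<Rightarrow> nat) \<Rightarrow> real
     \<Rightarrow> (nat \<Rightarrow> nat \<Rightarrow> real) \<Rightarrow> (nat \<Rightarrow> nat \<Rightarrow> real^3) \<Rightarrow> (real^3 \<Rightarrow> real) \<Rightarrow> real" where
  "mean_objective \<D> n r \<eta> W U g =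
     4 * pi / real n * (\<Sum>i=1..n. 1 / real (r i) * (\<Sum>j=1..r i. (W i j - g (U i j))\<^sup>2))
       + \<eta> * (norm_S2 (\<D> g))\<^sup>2"

definition mean_estimator ::
  "(nat \<Rightarrow> int \<Rightarrow> real^3 \<Rightarrow> real) \<Rightarrow> real \<Rightarrow> ((real^3 \<Rightarrow> real) \<Rightarrow> (real^3 \<Rightarrow> real))
     \<Rightarrow> nat \<Rightarrow> (nat \<Rightarrow> nat) \<Rightarrow> real \<Rightarrow> sample \<Rightarrow> real^3 \<Rightarrow> real" where
  "mean_estimator Y p \<D> n r \<eta> \<omega> =
     arg_min_on (mean_objective \<D> n r \<eta> (response \<omega>) (location \<omega>)) (sobolev Y p)"

end

theory Submission
  imports Defs
begin

text \<open>
  The estimator minimises a convex quadratic functional, so its error \<open>h = \<mu>\<^sub>\<eta> - \<mu>\<close> can be controlled by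
  comparing the objective at \<open>\<mu>\<^sub>\<eta>\<close> with the objective at \<open>\<mu>\<close>. With weights \<open>w\<^sub>k = 4\<pi> / (n r\<^sub>i)\<close>, which sum
  to \<open>4\<pi>\<close>, and residuals \<open>Z\<^sub>k = W\<^sub>k - \<mu>(U\<^sub>k)\<close>, this comparison reads
  \<open>\<Sum> w\<^sub>k h(U\<^sub>k)\<^sup>2 + \<eta> |D \<mu>\<^sub>\<eta>|\<^sup>2 \<le> 2 \<Sum> w\<^sub>k Z\<^sub>k h(U\<^sub>k) + \<eta> |D \<mu>|\<^sup>2\<close>.
  The natural norm of the problem is \<open>|h|\<^sub>\<eta>\<^sup>2 = |h|\<^sup>2 + \<eta> |D h|\<^sup>2\<close>; in the basis of spherical harmonics it is
  diagonal with entries \<open>\<lambda>\<^sub>l = 1 + \<eta> d\<^sub>l\<^sup>2\<close>.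

  Two random quantities decide everything. Cauchy--Schwarz in coefficients bounds the linear term by
  \<open>|h|\<^sub>\<eta> S\<close>, where \<open>S\<^sup>2\<close> is the sum of the squared scores \<open>N\<^sub>a = \<Sum> w\<^sub>k Z\<^sub>k Y\<^sub>a(U\<^sub>k)\<close> divided by \<open>\<lambda>\<^sub>a\<close>. In the
  same way the empirical quadratic form differs from \<open>|h|\<^sup>2\<close> by at most \<open>G |h|\<^sub>\<eta>\<^sup>2\<close>, where \<open>G\<close> is a
  weighted Hilbert--Schmidt norm of the error of the empirical Gram matrix. On the event \<open>G \<le> 1/4\<close> the
  quadratic form is coercive and \<open>|h|\<^sup>2 \<le> |h|\<^sub>\<eta>\<^sup>2 \<le> 64 S\<^sup>2 + 16 \<eta> |D \<mu>|\<^sup>2\<close> (\<open>penalized_fit_error\<close>). Both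
  comparisons hold for all \<open>h\<close> at once, so that they apply to the data-dependent error.

  Both quantities are sums of squares of centred sums, so their expectations are
  bounded by integrating out the errors, the locations and the curves one after the other
  (\<open>nn_integral_PiM_sum_square\<close>, \<open>score_moment\<close>, \<open>gram_error_moment\<close>). Pairs of observations on the same
  curve remain correlated, which produces the parametric term \<open>1/n\<close>; all other contributions carry the
  factor \<open>\<Sum> w\<^sub>k\<^sup>2 = 16 \<pi>\<^sup>2 / (n r)\<close>. What multiplies this factor is the kernel diagonal
  \<open>\<kappa>(u) = \<Sum> Y\<^sub>a(u)\<^sup>2 / \<lambda>\<^sub>a\<close>. By the addition theorem \<open>\<Sum>\<^sub>m Y\<^sub>l\<^sub>m(u)\<^sup>2 = (2l+1) / 4\<pi>\<close> it does not depend
  on \<open>u\<close>, and it is at most a constant times \<open>\<eta> powr (-1/p)\<close> (\<open>effective_dimension_bound\<close>). Hence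
  \<open>E S\<^sup>2\<close> is at most a constant times \<open>\<eta> powr (-1/p) / (nr) + 1/n\<close>, which is the claimed rate
  for the prescribed \<open>\<eta>\<close>, while \<open>E G\<^sup>2\<close> tends to zero because \<open>p > 1\<close>. Markov's inequality finishes the proof.

  Three analytic facts stand behind this argument. The addition theorem (\<open>addition_theorem\<close>) follows
  from the rotation invariance of the surface measure and of harmonicity, once it is known that the
  harmonics of degree \<open>l\<close> form a space of dimension at most \<open>2l+1\<close> (\<open>solid_harmonics_dependent\<close>).
  Functions of Sobolev order above one are pointwise sums of their expansion (\<open>sobolev_sums\<close>), which
  makes evaluation of a random curve at a random point measurable. Finally, the minimum is attained
  (\<open>reproducing_kernel_minimizer\<close>), so that the estimator really is a minimiser.
\<close>

section \<open>Directional derivatives of polynomials\<close>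

text \<open>Only the derivative along a line is used, in the form in which the Laplacian is defined. Composition
  with a linear map then costs no chain rule, see \<open>dirderiv_comp_linear\<close>.\<close>

definition dirderiv :: "'a::euclidean_space \<Rightarrow> ('a \<Rightarrow> real) \<Rightarrow> 'a \<Rightarrow> real" where
  "dirderiv v h x = deriv (\<lambda>t. h (x + t *\<^sub>R v)) 0"

lemma dirderivI:
  assumes "\<And>x. ((\<lambda>t. h (x + t *\<^sub>R v)) has_field_derivative h' x) (at 0)"
  shows "dirderiv v h = h'"
  using assms by (auto simp: dirderiv_def fun_eq_iff intro: DERIV_imp_deriv)

text \<open>Structural induction yields the derivative together with the fact that it is again a polynomial. The
  calculus rules below are consequences of uniqueness of derivatives.\<close>

lemma polynomial_dirderiv_exists:
  assumes "real_polynomial_function (h :: 'a::euclidean_space \<Rightarrow> real)"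
  shows "\<exists>h'. real_polynomial_function h' \<and> (\<forall>x. ((\<lambda>t. h (x + t *\<^sub>R v)) has_field_derivative h' x) (at 0))"
  using assms
proof induction
  case (linear f)
  interpret bounded_linear f by fact
  show ?case
    by (intro exI[of _ "\<lambda>_. f v"]) (auto simp: add scaleR intro!: derivative_eq_intros)
next
  case (const c)
  then show ?case by (intro exI[of _ "\<lambda>_. 0"]) auto
next
  case (add f g)
  then obtain f' g' where "real_polynomial_function f'" "real_polynomial_function g'"
    "\<And>x. ((\<lambda>t. f (x + t *\<^sub>R v)) has_field_derivative f' x) (at 0)"
    "\<And>x. ((\<lambda>t. g (x + t *\<^sub>R v)) has_field_derivative g' x) (at 0)" by blast
  then show ?case
    by (intro exI[of _ "\<lambda>x. f' x + g' x"]) (auto intro!: derivative_eq_intros)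
next
  case (mult f g)
  then obtain f' g' where *: "real_polynomial_function f'" "real_polynomial_function g'"
    "\<And>x. ((\<lambda>t. f (x + t *\<^sub>R v)) has_field_derivative f' x) (at 0)"
    "\<And>x. ((\<lambda>t. g (x + t *\<^sub>R v)) has_field_derivative g' x) (at 0)" by blast
  have "((\<lambda>t. f (x + t *\<^sub>R v) * g (x + t *\<^sub>R v)) has_field_derivative (f' x * g x + f x * g' x)) (at 0)" for x
    using DERIV_mult[OF *(3)[of x] *(4)[of x]] by (simp add: algebra_simps)
  then show ?case using * mult.hyps
    by (intro exI[of _ "\<lambda>x. f' x * g x + f x * g' x"]) auto
qed

lemma
  assumes "real_polynomial_function h"
  shows polynomial_dirderiv [intro]: "real_polynomial_function (dirderiv v h)"
    and has_dirderiv: "((\<lambda>t. h (x + t *\<^sub>R v)) has_field_derivative dirderiv v h (x + s *\<^sub>R v)) (at s)"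
proof -
  obtain h' where h': "real_polynomial_function h'"
    "\<And>x. ((\<lambda>t. h (x + t *\<^sub>R v)) has_field_derivative h' x) (at 0)"
    using polynomial_dirderiv_exists[OF assms] by blast
  have eq: "dirderiv v h = h'" using h'(2) by (rule dirderivI)
  show "real_polynomial_function (dirderiv v h)" using h' eq by simp
  have "((\<lambda>t. h ((x + s *\<^sub>R v) + t *\<^sub>R v)) has_field_derivative dirderiv v h (x + s *\<^sub>R v)) (at 0)"
    using h'(2) eq by auto
  then show "((\<lambda>t. h (x + t *\<^sub>R v)) has_field_derivative dirderiv v h (x + s *\<^sub>R v)) (at s)"
    using DERIV_shift[of "\<lambda>t. h ((x + s *\<^sub>R v) + t *\<^sub>R v)" "dirderiv v h (x + s *\<^sub>R v)" s "- s"]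
    by (simp add: algebra_simps)
qed

lemma has_dirderiv0:
  assumes "real_polynomial_function h"
  shows "((\<lambda>t. h (x + t *\<^sub>R v)) has_field_derivative dirderiv v h x) (at 0)"
  using has_dirderiv[OF assms, of x v 0] by simp

lemma dirderiv_add:
  assumes "real_polynomial_function f" "real_polynomial_function g"
  shows "dirderiv v (\<lambda>x. f x + g x) = (\<lambda>x. dirderiv v f x + dirderiv v g x)"
  using assms by (intro dirderivI) (auto intro!: derivative_eq_intros has_dirderiv0)

lemma dirderiv_mult:
  assumes "real_polynomial_function f" "real_polynomial_function g"
  shows "dirderiv v (\<lambda>x. f x * g x) = (\<lambda>x. dirderiv v f x * g x + f x * dirderiv v g x)"
proof (rule dirderivI)
  fix x show "((\<lambda>t. f (x + t *\<^sub>R v) * g (x + t *\<^sub>R v)) has_field_derivative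
      dirderiv v f x * g x + f x * dirderiv v g x) (at 0)"
    using DERIV_mult[OF has_dirderiv0[OF assms(1), of x v] has_dirderiv0[OF assms(2), of x v]]
    by (simp add: algebra_simps)
qed

lemma dirderiv_const [simp]: "dirderiv v (\<lambda>_. c) = (\<lambda>_. 0)"
  by (rule dirderivI) auto

lemma dirderiv_cmult:
  assumes "real_polynomial_function f"
  shows "dirderiv v (\<lambda>x. c * f x) = (\<lambda>x. c * dirderiv v f x)"
  using dirderiv_mult[OF real_polynomial_function.intros(2) assms, of v c] by simp

lemma dirderiv_linear:
  assumes "bounded_linear f"
  shows "dirderiv v f = (\<lambda>_. f v)"
proof -
  interpret bounded_linear f by fact
  show ?thesis by (rule dirderivI) (auto simp: add scaleR intro!: derivative_eq_intros)
qed

lemma dirderiv_sum: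
  assumes "finite A" "\<And>a. a \<in> A \<Longrightarrow> real_polynomial_function (f a)"
  shows "dirderiv v (\<lambda>x. \<Sum>a\<in>A. f a x) = (\<lambda>x. \<Sum>a\<in>A. dirderiv v (f a) x)"
  using assms by (intro dirderivI) (auto intro!: derivative_eq_intros has_dirderiv0)

lemma dirderiv_commute:
  assumes "real_polynomial_function h"
  shows "dirderiv v (dirderiv w h) = dirderiv w (dirderiv v h)"
  using assms
proof induction
  case (linear f)
  then show ?case by (simp add: dirderiv_linear)
next
  case (const c)
  then show ?case by simp
next
  case (add f g)
  then show ?case by (simp add: dirderiv_add polynomial_dirderiv)
next
  case (mult f g)
  then show ?case
    by (simp add: dirderiv_add dirderiv_mult polynomial_dirderiv real_polynomial_function.intros(4))
       (simp add: algebra_simps)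
qed

lemma linear_dirderiv:
  assumes "real_polynomial_function h"
  shows "linear (\<lambda>v. dirderiv v h x)"
proof -
  have "(\<forall>v w x. dirderiv (v + w) h x = dirderiv v h x + dirderiv w h x) \<and>
        (\<forall>c v x. dirderiv (c *\<^sub>R v) h x = c * dirderiv v h x)"
    using assms
  proof induction
    case (linear f)
    note f = linear
    interpret bounded_linear f by fact
    show ?case using f by (simp add: dirderiv_linear add scaleR)
  qed (simp_all add: dirderiv_add dirderiv_mult algebra_simps)
  then show ?thesis by (intro linearI) auto
qed

lemma dirderiv_expand:
  assumes "real_polynomial_function h"
  shows "dirderiv v h = (\<lambda>x. \<Sum>b\<in>Basis. (v \<bullet> b) * dirderiv b h x)"
proof
  fix x
  have "dirderiv v h x = dirderiv (\<Sum>b\<in>Basis. (v \<bullet> b) *\<^sub>R b) h x" by (simp add: euclidean_representation)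
  also have "\<dots> = (\<Sum>b\<in>Basis. (v \<bullet> b) * dirderiv b h x)"
    by (simp add: linear_sum[OF linear_dirderiv[OF assms]] linear_cmul[OF linear_dirderiv[OF assms]])
  finally show "dirderiv v h x = (\<Sum>b\<in>Basis. (v \<bullet> b) * dirderiv b h x)" .
qed

lemma laplacian_dirderiv:
  assumes "real_polynomial_function h"
  shows "laplacian h x = (\<Sum>b\<in>Basis. dirderiv b (dirderiv b h) x)"
proof -
  have "(deriv ^^ 2) (\<lambda>t. h (x + t *\<^sub>R b)) 0 = dirderiv b (dirderiv b h) x" for b
  proof -
    have "deriv (\<lambda>t. h (x + t *\<^sub>R b)) = (\<lambda>t. dirderiv b h (x + t *\<^sub>R b))"
      using has_dirderiv[OF assms] by (auto simp: fun_eq_iff intro!: DERIV_imp_deriv)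
    then show ?thesis
      by (simp add: numeral_2_eq_2 dirderiv_def[of b "dirderiv b h"])
  qed
  then show ?thesis by (simp add: laplacian_def)
qed

lemma dirderiv_comp_linear:
  assumes "linear R"
  shows "dirderiv v (\<lambda>x. h (R x)) = (\<lambda>x. dirderiv (R v) h (R x))"
  by (simp add: dirderiv_def fun_eq_iff linear_add[OF assms] linear_cmul[OF assms])

lemma polynomial_comp_linear:
  assumes "real_polynomial_function h" "linear (R :: 'a::euclidean_space \<Rightarrow> 'b::euclidean_space)"
  shows "real_polynomial_function (\<lambda>x. h (R x))"
proof -
  have "polynomial_function R"
    using assms(2) linear_conv_bounded_linear polynomial_function_bounded_linear by blast
  from real_polynomial_function_compose[OF this assms(1)] show ?thesis
    by (simp add: o_def)
qed

text \<open>The Laplacian is the trace of the Hessian form \<open>(v, w) \<mapsto> \<partial>\<^sub>v \<partial>\<^sub>w h\<close>, and a trace can be computed in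
  the orthonormal basis formed by the images of the standard basis vectors under \<open>R\<close>.\<close>

lemma laplacian_rotation:
  assumes h: "real_polynomial_function h" and R: "orthogonal_transformation R"
  shows "laplacian (\<lambda>x. h (R x)) x = laplacian h (R x)"
proof -
  have lin: "linear R" using R by (simp add: orthogonal_transformation_linear)
  have 1: "(\<Sum>b\<in>Basis. (R b \<bullet> c) * (R b \<bullet> d)) = c \<bullet> d" for c d
  proof -
    have "(\<Sum>b\<in>Basis. (R b \<bullet> c) * (R b \<bullet> d)) = adjoint R c \<bullet> adjoint R d"
      by (subst euclidean_inner) (simp add: adjoint_clauses[OF lin] inner_commute)
    also have "\<dots> = c \<bullet> d"
    proof -
      obtain R' where R': "\<And>x. R (R' x) = x"
        using orthogonal_transformation_surj[OF R] by (metis surjD)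
      have "adjoint R y = R' y" for y
        by (rule vector_eq_rdot[THEN iffD1])
          (metis R R' adjoint_works lin inner_commute orthogonal_transformation_def)
      then show ?thesis by (metis R R' orthogonal_transformation_def)
    qed
    finally show ?thesis .
  qed
  have 2: "dirderiv v (dirderiv v h) y = (\<Sum>c\<in>Basis. \<Sum>d\<in>Basis. (v \<bullet> c) * (v \<bullet> d) * dirderiv c (dirderiv d h) y)" for v y
  proof -
    have "dirderiv v (dirderiv v h) y = (\<Sum>c\<in>Basis. (v \<bullet> c) * dirderiv c (dirderiv v h) y)"
      by (simp add: dirderiv_expand[of "dirderiv v h" v] h polynomial_dirderiv)
    also have "\<dots> = (\<Sum>c\<in>Basis. (v \<bullet> c) * (\<Sum>d\<in>Basis. (v \<bullet> d) * dirderiv c (dirderiv d h) y))"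
      by (simp add: dirderiv_commute[OF h, of _ v] dirderiv_expand[of "dirderiv _ h" v] polynomial_dirderiv h)
        (simp add: dirderiv_commute[OF h])
    finally show ?thesis by (simp add: sum_distrib_left mult.assoc)
  qed
  have "laplacian (\<lambda>x. h (R x)) x = (\<Sum>b\<in>Basis. dirderiv (R b) (dirderiv (R b) h) (R x))"
    by (simp add: laplacian_dirderiv polynomial_comp_linear h lin dirderiv_comp_linear)
  also have "\<dots> = (\<Sum>b\<in>Basis. \<Sum>c\<in>Basis. \<Sum>d\<in>Basis. (R b \<bullet> c) * (R b \<bullet> d) * dirderiv c (dirderiv d h) (R x))"
    by (simp add: 2)
  also have "\<dots> = (\<Sum>c\<in>Basis. \<Sum>d\<in>Basis. (\<Sum>b\<in>Basis. (R b \<bullet> c) * (R b \<bullet> d)) * dirderiv c (dirderiv d h) (R x))"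
    by (subst sum.swap, rule sum.cong[OF refl], subst sum.swap) (simp add: sum_distrib_right)
  also have "\<dots> = (\<Sum>c\<in>Basis. \<Sum>d\<in>Basis. (if c = d then dirderiv c (dirderiv d h) (R x) else 0))"
    by (intro sum.cong refl) (auto simp: 1 inner_Basis)
  also have "\<dots> = laplacian h (R x)"
    by (simp add: laplacian_dirderiv h)
  finally show ?thesis .
qed

section \<open>Solid harmonics of a given degree\<close>

lemma funpow_dirderiv_polynomial [intro]:
  "real_polynomial_function h \<Longrightarrow> real_polynomial_function ((dirderiv v ^^ n) h)"
  by (induction n) (auto intro: polynomial_dirderiv)

lemma funpow_dirderiv_commute:
  "real_polynomial_function h \<Longrightarrow> (dirderiv v ^^ n) (dirderiv w h) = dirderiv w ((dirderiv v ^^ n) h)"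
  by (induction n) (auto simp: dirderiv_commute[of _ v w] funpow_dirderiv_polynomial)

lemma funpow_dirderiv_sum:
  assumes "finite A" "\<And>a. a \<in> A \<Longrightarrow> real_polynomial_function (f a)"
  shows "(dirderiv v ^^ n) (\<lambda>x. \<Sum>a\<in>A. c a * f a x) = (\<lambda>x. \<Sum>a\<in>A. c a * (dirderiv v ^^ n) (f a) x)"
  by (induction n)
    (use assms in \<open>auto simp: dirderiv_sum dirderiv_cmult funpow_dirderiv_polynomial real_polynomial_function.intros\<close>)

text \<open>Differentiation at a fixed positive factor preserves the identity; the factor zero would require a
  limit.\<close>

definition homogeneous :: "nat \<Rightarrow> ('a::real_vector \<Rightarrow> real) \<Rightarrow> bool" where
  "homogeneous l h \<longleftrightarrow> (\<forall>t>0. \<forall>x. h (t *\<^sub>R x) = t ^ l * h x)"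

lemma homogeneous_dirderiv:
  assumes h: "real_polynomial_function h" and hom: "homogeneous (Suc l) h"
  shows "homogeneous l (dirderiv v h)"
  unfolding homogeneous_def
proof (intro allI impI)
  fix t :: real and x assume t: "t > 0"
  have "((\<lambda>s. t ^ Suc l * h (x + (s / t) *\<^sub>R v)) has_field_derivative t ^ Suc l * (dirderiv v h x * (1 / t))) (at 0)"
    using t has_dirderiv0[OF h, of x v]
    by (intro DERIV_cmult DERIV_chain'[where f = "\<lambda>s. s / t" and g = "\<lambda>s. h (x + s *\<^sub>R v)"]) (auto intro!: derivative_eq_intros)
  moreover have "t ^ Suc l * h (x + (s / t) *\<^sub>R v) = h (t *\<^sub>R x + s *\<^sub>R v)" for s
    using hom t unfolding homogeneous_def by (metis (no_types, opaque_lifting) nonzero_divide_eq_eq order_less_irrefl scaleR_add_right scaleR_scaleR mult.commute)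
  ultimately have "((\<lambda>s. h (t *\<^sub>R x + s *\<^sub>R v)) has_field_derivative t ^ Suc l * (dirderiv v h x * (1 / t))) (at 0)"
    by simp
  from DERIV_unique[OF this has_dirderiv0[OF h]]
  show "dirderiv v h (t *\<^sub>R x) = t ^ l * dirderiv v h x"
    using t by (simp add: field_simps)
qed

lemma euler_homogeneous:
  assumes h: "real_polynomial_function h" and hom: "homogeneous l h"
  shows "(\<Sum>b\<in>Basis. (x \<bullet> b) * dirderiv b h x) = real l * h x"
proof -
  have "((\<lambda>t. (1 + t) ^ l * h x) has_field_derivative real l * h x) (at 0)"
    by (auto intro!: derivative_eq_intros)
  moreover have "\<forall>\<^sub>F t in nhds 0. h (x + t *\<^sub>R x) = (1 + t) ^ l * h x"
  proof -
    have "\<forall>\<^sub>F t in nhds (0::real). t \<in> {-1<..}" by (rule eventually_nhds_in_open) auto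
    then show ?thesis
    proof eventually_elim
      case (elim t)
      then have "1 + t > 0" by simp
      then show ?case using hom unfolding homogeneous_def by (metis scaleR_add_left scaleR_one)
    qed
  qed
  ultimately have "((\<lambda>t. h (x + t *\<^sub>R x)) has_field_derivative real l * h x) (at 0)"
    by (subst DERIV_cong_ev[OF refl _ refl]) auto
  from DERIV_unique[OF this has_dirderiv0[OF h]] dirderiv_expand[OF h, of x]
  show ?thesis by simp
qed

text \<open>The value at \<open>x\<close> equals the values at all \<open>t x\<close> with \<open>t > 0\<close>, which tend to the value at the origin.\<close>

lemma homogeneous_0_const:
  assumes h: "real_polynomial_function h" and hom: "homogeneous 0 h"
  shows "h x = h (0::'a::euclidean_space)"
proof -
  have "isCont h (0::'a)"
    using h continuous_polymonial_function real_polynomial_function_eq by blast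
  moreover have "((\<lambda>t::real. t *\<^sub>R x) \<longlongrightarrow> 0) (at_right 0)"
    by (rule tendsto_eq_intros | simp)+
  ultimately have "((\<lambda>t::real. h (t *\<^sub>R x)) \<longlongrightarrow> h 0) (at_right 0)"
    by (rule isCont_tendsto_compose)
  moreover have "((\<lambda>t::real. h (t *\<^sub>R x)) \<longlongrightarrow> h x) (at_right 0)"
    by (rule tendsto_eventually) (use hom in \<open>auto simp: homogeneous_def eventually_at_filter\<close>)
  ultimately show ?thesis using tendsto_unique trivial_limit_at_right_real by blast
qed

definition solid_harmonic :: "nat \<Rightarrow> (real^3 \<Rightarrow> real) \<Rightarrow> bool" where
  "solid_harmonic l h \<longleftrightarrow> real_polynomial_function h \<and> homogeneous l h \<and> (\<forall>x. laplacian h x = 0)"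

abbreviation D1 :: "(real^3 \<Rightarrow> real) \<Rightarrow> real^3 \<Rightarrow> real" where "D1 \<equiv> dirderiv (axis 1 1)"
abbreviation D2 :: "(real^3 \<Rightarrow> real) \<Rightarrow> real^3 \<Rightarrow> real" where "D2 \<equiv> dirderiv (axis 2 1)"
abbreviation D3 :: "(real^3 \<Rightarrow> real) \<Rightarrow> real^3 \<Rightarrow> real" where "D3 \<equiv> dirderiv (axis 3 1)"

lemma sum_Basis_3: "(\<Sum>b\<in>(Basis :: (real^3) set). f b) = f (axis 1 1) + f (axis 2 1) + f (axis 3 1)"
proof -
  have B: "(Basis :: (real^3) set) = (\<lambda>i. axis i 1) ` UNIV" by (auto simp: Basis_vec_def)
  show ?thesis unfolding B
    by (subst sum.reindex) (auto simp: inj_on_def axis_eq_axis sum_3)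
qed

lemma solid_harmonic_dirderiv:
  assumes "solid_harmonic (Suc l) h"
  shows "solid_harmonic l (dirderiv v h)"
proof -
  have h: "real_polynomial_function h" and lap: "\<And>x. laplacian h x = 0"
    using assms by (auto simp: solid_harmonic_def)
  have "laplacian h = (\<lambda>x. \<Sum>b\<in>Basis. dirderiv b (dirderiv b h) x)"
    by (simp add: fun_eq_iff laplacian_dirderiv h)
  then have "dirderiv v (laplacian h) = (\<lambda>x. \<Sum>b\<in>Basis. dirderiv v (dirderiv b (dirderiv b h)) x)"
    by (simp add: dirderiv_sum h polynomial_dirderiv)
  then have "laplacian (dirderiv v h) = dirderiv v (laplacian h)"
    by (simp add: fun_eq_iff laplacian_dirderiv h polynomial_dirderiv dirderiv_commute[of _ _ v])
  moreover have "laplacian h = (\<lambda>_. 0)" using lap by auto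
  ultimately show ?thesis
    using assms homogeneous_dirderiv by (auto simp: solid_harmonic_def)
qed

text \<open>A homogeneous polynomial is determined by its derivatives of top order, by Euler's identity. If it is
  harmonic, two derivatives in the third direction can be exchanged for derivatives in the first two,
  so that only derivatives with at most one third direction matter. There are \<open>(l + 1) + l\<close> of them.
  The induction applies this to the three partial derivatives of \<open>h\<close>.\<close>

lemma solid_harmonic_eq_0:
  assumes "solid_harmonic l h"
    and "\<And>i. i \<le> l \<Longrightarrow> (D1 ^^ i) ((D2 ^^ (l - i)) h) 0 = 0"
    and "\<And>i. i < l \<Longrightarrow> (D1 ^^ i) ((D2 ^^ (l - 1 - i)) (D3 h)) 0 = 0"
  shows "h x = 0"
  using assms
proof (induction l arbitrary: h x)
  case 0
  then show ?case using homogeneous_0_const[of h x] by (auto simp: solid_harmonic_def)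
next
  case (Suc l)
  have h [intro, simp]: "real_polynomial_function h" and hom: "homogeneous (Suc l) h"
    and lap: "\<And>x. laplacian h x = 0" using Suc.prems(1) by (auto simp: solid_harmonic_def)
  note [intro, simp] = polynomial_dirderiv funpow_dirderiv_polynomial
  have d1: "D1 h y = 0" for y
  proof (rule Suc.IH)
    show "solid_harmonic l (D1 h)" using Suc.prems(1) by (rule solid_harmonic_dirderiv)
    fix i
    have *: "(D1 ^^ i) (D1 g) = (D1 ^^ Suc i) g" for g by (simp add: funpow_swap1)
    { assume "i \<le> l"
      then show "(D1 ^^ i) ((D2 ^^ (l - i)) (D1 h)) 0 = 0"
        using Suc.prems(2)[of "Suc i"] by (simp add: funpow_dirderiv_commute[where v = "axis 2 1" and w = "axis 1 1"] * del: funpow.simps) }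
    { assume "i < l"
      then show "(D1 ^^ i) ((D2 ^^ (l - 1 - i)) (D3 (D1 h))) 0 = 0"
        using Suc.prems(3)[of "Suc i"]
        by (simp add: dirderiv_commute[of _ "axis 3 1" "axis 1 1"] funpow_dirderiv_commute[where v = "axis 2 1" and w = "axis 1 1"] * del: funpow.simps) }
  qed
  have d2: "D2 h y = 0" for y
  proof (rule Suc.IH)
    show "solid_harmonic l (D2 h)" using Suc.prems(1) by (rule solid_harmonic_dirderiv)
    fix i
    have *: "(D2 ^^ i) (D2 g) = (D2 ^^ Suc i) g" for g i by (simp add: funpow_swap1)
    { assume "i \<le> l"
      then show "(D1 ^^ i) ((D2 ^^ (l - i)) (D2 h)) 0 = 0"
        using Suc.prems(2)[of i] by (simp add: * Suc_diff_le del: funpow.simps) }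
    { assume "i < l"
      then show "(D1 ^^ i) ((D2 ^^ (l - 1 - i)) (D3 (D2 h))) 0 = 0"
        using Suc.prems(3)[of i]
        by (simp add: dirderiv_commute[of _ "axis 3 1" "axis 2 1"] * Suc_diff_Suc del: funpow.simps) }
  qed
  have d3: "D3 h y = 0" for y
  proof (rule Suc.IH)
    show "solid_harmonic l (D3 h)" using Suc.prems(1) by (rule solid_harmonic_dirderiv)
    fix i
    { assume "i \<le> l"
      then show "(D1 ^^ i) ((D2 ^^ (l - i)) (D3 h)) 0 = 0"
        using Suc.prems(3)[of i] by simp }
    { assume "i < l"
      \<comment> \<open>Harmonicity and the two vanishing partial derivatives leave nothing for the third direction.\<close>
      have "D3 (D3 h) = (\<lambda>_. 0)"
      proof
        fix x
        have "D1 h = (\<lambda>_. 0)" "D2 h = (\<lambda>_. 0)" using d1 d2 by auto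
        then show "D3 (D3 h) x = 0" using lap[of x] by (simp add: laplacian_dirderiv sum_Basis_3)
      qed
      moreover have "(dirderiv v ^^ n) (\<lambda>_. 0) = (\<lambda>_. 0)" for v :: "real^3" and n by (induction n) auto
      ultimately show "(D1 ^^ i) ((D2 ^^ (l - 1 - i)) (D3 (D3 h))) 0 = 0" by simp }
  qed
  show ?case using euler_homogeneous[OF h hom, of x] d1 d2 d3 by (simp add: sum_Basis_3)
qed

text \<open>Gaussian elimination: either the equation \<open>e\<close> is trivial, or it is used to eliminate one unknown \<open>w\<close>
  from the others.\<close>

lemma underdetermined_system:
  fixes A :: "'e \<Rightarrow> 'v \<Rightarrow> real"
  assumes "finite E" "finite V" "card E < card V"
  shows "\<exists>c. (\<exists>v\<in>V. c v \<noteq> 0) \<and> (\<forall>e\<in>E. (\<Sum>v\<in>V. c v * A e v) = 0)"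
  using assms
proof (induction E arbitrary: V A rule: finite_induct)
  case empty
  then show ?case by (intro exI[of _ "\<lambda>_. 1"]) (auto simp: card_gt_0_iff)
next
  case (insert e E)
  show ?case
  proof (cases "\<forall>v\<in>V. A e v = 0")
    case True
    obtain c where "\<exists>v\<in>V. c v \<noteq> 0" "\<forall>e\<in>E. (\<Sum>v\<in>V. c v * A e v) = 0"
      using insert.IH[of V A] insert.prems insert.hyps by auto
    with True show ?thesis by (intro exI[of _ c]) auto
  next
    case False
    then obtain w where w: "w \<in> V" "A e w \<noteq> 0" by auto
    define B where "B e' v = A e' v - A e v * A e' w / A e w" for e' v
    obtain c where c: "\<exists>v\<in>V - {w}. c v \<noteq> 0" "\<forall>e\<in>E. (\<Sum>v\<in>V - {w}. c v * B e v) = 0"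
      using insert.IH[of "V - {w}" B] insert.prems insert.hyps w
      by (auto simp: card_Diff_singleton less_diff_conv)
    define s where "s = (\<Sum>v\<in>V - {w}. c v * A e v)"
    let ?c = "c(w := - s / A e w)"
    have sum: "(\<Sum>v\<in>V. ?c v * A e' v) = - s / A e w * A e' w + (\<Sum>v\<in>V - {w}. c v * A e' v)" for e'
      using insert.prems w by (subst sum.remove[of _ w]) (auto intro!: sum.cong)
    have "(\<Sum>v\<in>V. ?c v * A e v) = 0" using w by (subst sum) (simp add: s_def[symmetric])
    moreover have "(\<Sum>v\<in>V. ?c v * A e' v) = 0" if "e' \<in> E" for e'
    proof -
      have "0 = (\<Sum>v\<in>V - {w}. c v * B e' v)" using c that by auto
      also have "\<dots> = (\<Sum>v\<in>V - {w}. c v * A e' v) - (\<Sum>v\<in>V - {w}. c v * A e v) * (A e' w / A e w)"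
        unfolding B_def sum_distrib_right sum_subtractf[symmetric] by (intro sum.cong) (auto simp: algebra_simps)
      finally show ?thesis by (subst sum) (simp add: s_def)
    qed
    ultimately show ?thesis using c(1) by (intro exI[of _ ?c]) auto
  qed
qed

text \<open>Solid harmonics of degree \<open>l\<close> form a space of dimension at most \<open>2 l + 1\<close>, because the linear
  functionals of \<open>solid_harmonic_eq_0\<close> separate them.\<close>

lemma solid_harmonics_dependent:
  assumes V: "finite V" "card V > 2 * l + 1" and h: "\<And>v. v \<in> V \<Longrightarrow> solid_harmonic l (h v)"
  obtains c where "\<exists>v\<in>V. c v \<noteq> 0" "\<And>x. (\<Sum>v\<in>V. c v * h v x) = 0"
proof -
  define A where "A e v = (case e of
      Inl i \<Rightarrow> (D1 ^^ i) ((D2 ^^ (l - i)) (h v)) 0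
    | Inr i \<Rightarrow> (D1 ^^ i) ((D2 ^^ (l - 1 - i)) (D3 (h v))) 0)" for e :: "nat + nat" and v
  have pol: "real_polynomial_function (h v)" if "v \<in> V" for v using h[OF that] by (simp add: solid_harmonic_def)
  note [intro] = pol polynomial_dirderiv funpow_dirderiv_polynomial
  have "card ({..l} <+> {..<l}) < card V" using V by (simp add: card_Plus)
  from underdetermined_system[OF _ V(1) this, of A] obtain c where
    c: "\<exists>v\<in>V. c v \<noteq> 0" "\<And>e. e \<in> {..l} <+> {..<l} \<Longrightarrow> (\<Sum>v\<in>V. c v * A e v) = 0" by auto
  have "(\<Sum>v\<in>V. c v * h v x) = 0" for x
  proof (rule solid_harmonic_eq_0[of l "\<lambda>x. \<Sum>v\<in>V. c v * h v x"])
    show "solid_harmonic l (\<lambda>x. \<Sum>v\<in>V. c v * h v x)"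
      unfolding solid_harmonic_def
    proof (intro conjI allI)
      show pol': "real_polynomial_function (\<lambda>x. \<Sum>v\<in>V. c v * h v x)"
        using V pol by (auto intro!: real_polynomial_function_sum)
      show "homogeneous l (\<lambda>x. \<Sum>v\<in>V. c v * h v x)"
        using h by (auto simp: homogeneous_def solid_harmonic_def sum_distrib_left algebra_simps intro!: sum.cong)
      fix x
      have "laplacian (\<lambda>x. \<Sum>v\<in>V. c v * h v x) x = (\<Sum>b\<in>Basis. \<Sum>v\<in>V. c v * dirderiv b (dirderiv b (h v)) x)"
        using V by (simp add: laplacian_dirderiv pol' dirderiv_sum dirderiv_cmult pol polynomial_dirderiv real_polynomial_function.intros)
      also have "\<dots> = (\<Sum>v\<in>V. c v * laplacian (h v) x)"
        by (subst sum.swap) (auto simp: laplacian_dirderiv pol sum_distrib_left intro!: sum.cong)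
      also have "\<dots> = 0" using h by (simp add: solid_harmonic_def)
      finally show "laplacian (\<lambda>x. \<Sum>v\<in>V. c v * h v x) x = 0" .
    qed
  next
    fix i assume "i \<le> l"
    then show "(D1 ^^ i) ((D2 ^^ (l - i)) (\<lambda>x. \<Sum>v\<in>V. c v * h v x)) 0 = 0"
      using c(2)[OF InlI, of i] V by (simp add: funpow_dirderiv_sum pol funpow_dirderiv_polynomial A_def)
  next
    fix i assume "i < l"
    then show "(D1 ^^ i) ((D2 ^^ (l - 1 - i)) (D3 (\<lambda>x. \<Sum>v\<in>V. c v * h v x))) 0 = 0"
      using c(2)[OF InrI, of i] V
      by (simp add: dirderiv_sum dirderiv_cmult real_polynomial_function.intros polynomial_dirderiv funpow_dirderiv_sum pol funpow_dirderiv_polynomial A_def)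
  qed
  with c(1) show ?thesis using that by blast
qed

section \<open>Surface measure and square integrable functions on the sphere\<close>

lemma finite_measure_surf: "finite_measure surf"
  by (rule finite_measureI) (simp add: emeasure_surf_S2)

interpretation surf: finite_measure surf by (rule finite_measure_surf)

lemma measure_surf_S2: "measure surf S2 = 4 * pi"
  by (simp add: measure_def emeasure_surf_S2)

lemma sgn_measurable_sphere:
  "sgn \<in> restrict_space lborel (ball 0 1 - {0}) \<rightarrow>\<^sub>M restrict_space borel (S2)"
proof -
  have "sgn \<in> borel_measurable (borel :: (real^3) measure)"
    unfolding sgn_div_norm by measurable
  then show ?thesis
    by (intro measurable_restrict_space2 measurable_restrict_space1)
       (auto simp: space_restrict_space norm_sgn)
qed

text \<open>Three times the volume of this set is the surface area of \<open>A\<close>.\<close>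

definition cone_over :: "(real^3) set \<Rightarrow> (real^3) set" where
  "cone_over A = {x \<in> ball 0 1 - {0}. sgn x \<in> A}"

lemma
  assumes "A \<in> sets surf"
  shows emeasure_surf: "emeasure surf A = 3 * emeasure lborel (cone_over A)"
    and sets_cone_over: "cone_over A \<in> sets borel"
proof -
  let ?B = "ball 0 1 - {0} :: (real^3) set"
  have A: "A \<in> sets (restrict_space borel S2)" using assms by (simp add: surf_def)
  have eq: "sgn -` A \<inter> space (restrict_space lborel ?B) = cone_over A"
    by (auto simp: cone_over_def space_restrict_space)
  have "cone_over A \<in> sets (restrict_space lborel ?B)"
    using measurable_sets[OF sgn_measurable_sphere A] by (simp only: eq)
  moreover from this show "cone_over A \<in> sets borel"
    by (subst (asm) sets_restrict_space_iff) auto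
  ultimately show "emeasure surf A = 3 * emeasure lborel (cone_over A)"
    using A sgn_measurable_sphere
    by (simp add: surf_def emeasure_distr eq[unfolded space_restrict_space, simplified])
      (subst emeasure_restrict_space, auto simp: cone_over_def)
qed

lemma orthogonal_measurable_surf [measurable]:
  assumes R: "orthogonal_transformation R"
  shows "R \<in> surf \<rightarrow>\<^sub>M surf"
proof -
  have "R \<in> restrict_space borel S2 \<rightarrow>\<^sub>M restrict_space borel S2"
  proof (rule measurable_restrict_space3)
    show "R \<in> borel \<rightarrow>\<^sub>M borel"
      using R by (intro borel_measurable_continuous_onI linear_continuous_on)
        (simp add: linear_conv_bounded_linear[symmetric] orthogonal_transformation_linear)
  qed (use R in \<open>auto simp: orthogonal_transformation_norm\<close>)
  then show ?thesis by (simp add: measurable_cong_sets[OF sets_surf sets_surf])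
qed

text \<open>A rotation maps cones over sets to cones over the rotated sets and preserves Lebesgue measure.\<close>

lemma surf_rotation:
  assumes R: "orthogonal_transformation R"
  shows "distr surf surf R = surf"
proof (rule measure_eqI)
  fix A assume "A \<in> sets (distr surf surf R)"
  then have A: "A \<in> sets surf" by simp
  have RA: "R -` A \<inter> S2 \<in> sets surf"
    using measurable_sets[OF orthogonal_measurable_surf[OF R] A] by simp
  obtain R' where R': "orthogonal_transformation R'" "\<And>x. R (R' x) = x" "\<And>x. R' (R x) = x"
    using R orthogonal_transformation_inv orthogonal_transformation_bij[OF R]
    by (metis bij_inv_eq_iff)
  have sgnR: "sgn (R x) = R (sgn x)" for x
    using R by (simp add: sgn_div_norm orthogonal_transformation_norm orthogonal_transformation_scaleR)
  have "cone_over (R -` A \<inter> S2) = R' ` cone_over A"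
  proof (intro set_eqI iffI)
    fix x assume x: "x \<in> cone_over (R -` A \<inter> S2)"
    then have "R x \<in> cone_over A"
      using R orthogonal_transformation_norm[OF R, of x]
      by (auto simp: cone_over_def sgnR)
    then show "x \<in> R' ` cone_over A" using R'(3) by (metis image_eqI)
  next
    fix x assume "x \<in> R' ` cone_over A"
    then obtain y where y: "y \<in> cone_over A" "x = R' y" by auto
    have "R' y \<noteq> 0" using y orthogonal_transformation_norm[OF R'(1), of y]
      by (auto simp: cone_over_def) 
    then show "x \<in> cone_over (R -` A \<inter> S2)"
      using y orthogonal_transformation_norm[OF R'(1), of y]
      by (auto simp: cone_over_def sgnR[symmetric] R' norm_sgn)
  qed
  moreover have "emeasure lborel (R' ` cone_over A) = emeasure lborel (cone_over A)"
  proof -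
    have meas: "cone_over A \<in> sets borel" "cone_over (R -` A \<inter> S2) \<in> sets borel"
      by (rule sets_cone_over[OF A], rule sets_cone_over[OF RA])
    have "bounded (cone_over A)" by (rule bounded_subset[OF bounded_ball[of 0 1]]) (auto simp: cone_over_def)
    then have lm: "cone_over A \<in> lmeasurable" using meas by (intro bounded_set_imp_lmeasurable) auto
    then have "R' ` cone_over A \<in> lmeasurable"
      "measure lebesgue (R' ` cone_over A) = measure lebesgue (cone_over A)"
      using R' measurable_orthogonal_image measure_orthogonal_image by blast+
    then have "emeasure lebesgue (R' ` cone_over A) = emeasure lebesgue (cone_over A)"
      using lm by (simp add: emeasure_eq_measure2)
    then show ?thesis
      using meas \<open>cone_over (R -` A \<inter> S2) = R' ` cone_over A\<close> by simp
  qed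
  ultimately have "emeasure surf (R -` A \<inter> S2) = emeasure surf A"
    by (simp only: emeasure_surf[OF A] emeasure_surf[OF RA])
  then show "emeasure (distr surf surf R) A = emeasure surf A"
    by (simp only: emeasure_distr[OF orthogonal_measurable_surf[OF R] A] space_surf)
qed simp

text \<open>Surface measure charges every nonempty open subset of the sphere, since the cone over it is a
  nonempty open set in space. A continuous representative is therefore unique.\<close>

lemma AE_surf_continuous_eq:
  assumes f: "continuous_on S2 f" and g: "continuous_on S2 (g :: real^3 \<Rightarrow> real)"
    and ae: "AE x in surf. f x = g x" and x: "x \<in> S2"
  shows "f x = g x"
proof (rule ccontr)
  assume ne: "f x \<noteq> g x"
  have "continuous_on S2 (\<lambda>x. f x - g x)" using f g by (intro continuous_intros)
  then have "openin (top_of_set S2) (S2 \<inter> (\<lambda>x. f x - g x) -` (- {0}))"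
    by (rule continuous_openin_preimage_gen) auto
  then obtain T where T: "open T" "S2 \<inter> (\<lambda>x. f x - g x) -` (- {0}) = S2 \<inter> T"
    by (auto simp: openin_open)
  have ST: "S2 \<inter> T \<in> sets surf"
    using T by (auto simp: sets_surf sets_restrict_space)
  have "AE y in surf. y \<notin> S2 \<inter> T"
    using ae by eventually_elim (use T in auto)
  then have "emeasure surf (S2 \<inter> T) = 0"
    using ST by (simp add: AE_iff_null_sets null_setsD1)
  then have "emeasure lborel (cone_over (S2 \<inter> T)) = 0"
    using emeasure_surf[OF ST] by simp
  then have "cone_over (S2 \<inter> T) \<in> null_sets lborel"
    using sets_cone_over[OF ST] by auto
  then have "negligible (cone_over (S2 \<inter> T))"
    by (simp add: negligible_iff_null_sets null_sets_completionI)
  moreover have "open (cone_over (S2 \<inter> T))"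
  proof -
    have "cone_over (S2 \<inter> T) = (ball 0 1 - {0}) \<inter> sgn -` T"
      by (auto simp: cone_over_def norm_sgn)
    moreover have "open ((ball 0 1 - {0}) \<inter> sgn -` T)"
      using T by (intro continuous_open_preimage continuous_on_sgn continuous_on_id) auto
    ultimately show ?thesis by simp
  qed
  \<comment> \<open>Halving moves the point from the sphere into the open ball.\<close>
  moreover have "x /\<^sub>R 2 \<in> cone_over (S2 \<inter> T)"
  proof -
    have "x \<noteq> 0" "norm x = 1" "sgn (x /\<^sub>R 2) = x" using x by (auto simp: sgn_div_norm)
    moreover have "x \<in> S2 \<inter> (\<lambda>x. f x - g x) -` (- {0})" using x ne by (intro IntI vimageI2) auto
    then have "x \<in> S2 \<inter> T" by (simp only: T(2))
    ultimately show ?thesis unfolding cone_over_def by (intro CollectI conjI DiffI) auto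
  qed
  ultimately show False using open_not_negligible by blast
qed

lemma continuous_L2_S2:
  assumes "continuous_on S2 f"
  shows "f \<in> L2_S2"
proof -
  have [measurable]: "f \<in> borel_measurable surf"
    using borel_measurable_continuous_on_restrict[OF assms]
    by (subst measurable_cong_sets[OF sets_surf refl])
  have "compact (f ` S2)" using assms by (intro compact_continuous_image) auto
  then obtain B where B: "\<forall>x\<in>S2. \<bar>f x\<bar> \<le> B"
    using compact_imp_bounded[of "f ` S2"] by (auto simp: bounded_iff)
  have "integrable surf (\<lambda>x. (f x)\<^sup>2)"
  proof (rule surf.integrable_const_bound)
    have "(f x)\<^sup>2 \<le> B\<^sup>2" if "x \<in> S2" for x
      using power_mono[OF B[rule_format, OF that], of 2] by simp
    then show "AE x in surf. norm ((f x)\<^sup>2) \<le> B\<^sup>2" by (auto intro!: AE_I2)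
  qed measurable
  then show ?thesis by (simp add: L2_S2_def)
qed

lemma L2_S2_measurable: "f \<in> L2_S2 \<Longrightarrow> f \<in> borel_measurable surf"
  by (simp add: L2_S2_def)

lemma abs_mult_le_sum_squares: "\<bar>s * t\<bar> \<le> s\<^sup>2 + t\<^sup>2" for s t :: real
  using sum_squares_bound[of "\<bar>s\<bar>" "\<bar>t\<bar>"] mult_nonneg_nonneg[of "\<bar>s\<bar>" "\<bar>t\<bar>"]
  unfolding abs_mult power2_abs by linarith

lemma integrable_L2_mult:
  assumes "f \<in> L2_S2" "g \<in> L2_S2"
  shows "integrable surf (\<lambda>x. f x * g x)"
proof (rule Bochner_Integration.integrable_bound)
  show "integrable surf (\<lambda>x. (f x)\<^sup>2 + (g x)\<^sup>2)" using assms by (simp add: L2_S2_def)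
  show "(\<lambda>x. f x * g x) \<in> borel_measurable surf"
    using assms[THEN L2_S2_measurable] by measurable
  show "AE x in surf. norm (f x * g x) \<le> norm ((f x)\<^sup>2 + (g x)\<^sup>2)"
    by (rule AE_I2) (use abs_mult_le_sum_squares in auto)
qed

lemma L2_S2_add: "f \<in> L2_S2 \<Longrightarrow> g \<in> L2_S2 \<Longrightarrow> (\<lambda>x. f x + g x) \<in> L2_S2"
  using integrable_L2_mult[of f g] by (auto simp: L2_S2_def power2_sum mult.assoc intro!: Bochner_Integration.integrable_add integrable_mult_right)

lemma L2_S2_cmult: "f \<in> L2_S2 \<Longrightarrow> (\<lambda>x. c * f x) \<in> L2_S2"
  by (auto simp: L2_S2_def power_mult_distrib)

lemma L2_S2_diff: "f \<in> L2_S2 \<Longrightarrow> g \<in> L2_S2 \<Longrightarrow> (\<lambda>x. f x - g x) \<in> L2_S2"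
  using L2_S2_add[of f "\<lambda>x. -1 * g x"] L2_S2_cmult[of g "-1"] by simp

lemma L2_S2_0: "(\<lambda>_. 0) \<in> L2_S2"
  by (simp add: L2_S2_def)

lemma L2_S2_sum: "(\<And>a. a \<in> A \<Longrightarrow> f a \<in> L2_S2) \<Longrightarrow> (\<lambda>x. \<Sum>a\<in>A. f a x) \<in> L2_S2"
  by (induction A rule: infinite_finite_induct) (auto simp: L2_S2_0 L2_S2_add)

lemma inner_S2_commute: "inner_S2 f g = inner_S2 g f"
  by (simp add: inner_S2_def mult.commute)

lemma inner_S2_add:
  "f \<in> L2_S2 \<Longrightarrow> g \<in> L2_S2 \<Longrightarrow> h \<in> L2_S2 \<Longrightarrow> inner_S2 (\<lambda>x. f x + g x) h = inner_S2 f h + inner_S2 g h"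
  by (simp add: inner_S2_def distrib_right integrable_L2_mult)

lemma inner_S2_diff:
  "f \<in> L2_S2 \<Longrightarrow> g \<in> L2_S2 \<Longrightarrow> h \<in> L2_S2 \<Longrightarrow> inner_S2 (\<lambda>x. f x - g x) h = inner_S2 f h - inner_S2 g h"
  by (simp add: inner_S2_def left_diff_distrib integrable_L2_mult)

lemma inner_S2_cmult: "inner_S2 (\<lambda>x. c * f x) h = c * inner_S2 f h"
  by (simp add: inner_S2_def mult.assoc)

lemma inner_S2_sum:
  assumes "\<And>a. a \<in> A \<Longrightarrow> f a \<in> L2_S2" "h \<in> L2_S2"
  shows "inner_S2 (\<lambda>x. \<Sum>a\<in>A. c a * f a x) h = (\<Sum>a\<in>A. c a * inner_S2 (f a) h)"
  using assms
  by (simp add: inner_S2_def sum_distrib_right mult.assoc integrable_L2_mult)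

lemma inner_S2_cong:
  "(\<And>x. x \<in> S2 \<Longrightarrow> f x = f' x) \<Longrightarrow> (\<And>x. x \<in> S2 \<Longrightarrow> g x = g' x) \<Longrightarrow> inner_S2 f g = inner_S2 f' g'"
  unfolding inner_S2_def by (intro Bochner_Integration.integral_cong) auto

lemma inner_S2_ge_0: "0 \<le> inner_S2 f f"
  by (auto simp: inner_S2_def intro!: integral_nonneg)

lemma norm_S2_square: "(norm_S2 f)\<^sup>2 = inner_S2 f f"
  by (simp add: norm_S2_def inner_S2_ge_0)

lemma norm_S2_ge_0 [simp]: "0 \<le> norm_S2 f"
  by (simp add: norm_S2_def inner_S2_ge_0)

text \<open>The usual discriminant argument: \<open>t \<mapsto> |f + t g|\<^sup>2\<close> is a nonnegative quadratic polynomial.\<close>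

lemma inner_S2_square_le:
  assumes f: "f \<in> L2_S2" and g: "g \<in> L2_S2"
  shows "(inner_S2 f g)\<^sup>2 \<le> inner_S2 f f * inner_S2 g g"
proof -
  have q: "0 \<le> inner_S2 f f + 2 * t * inner_S2 f g + t\<^sup>2 * inner_S2 g g" for t
  proof -
    have "0 \<le> inner_S2 (\<lambda>x. f x + t * g x) (\<lambda>x. f x + t * g x)" by (rule inner_S2_ge_0)
    also have "\<dots> = inner_S2 f (\<lambda>x. f x + t * g x) + t * inner_S2 g (\<lambda>x. f x + t * g x)"
      using f g by (simp add: inner_S2_add inner_S2_cmult L2_S2_add L2_S2_cmult)
    also have "inner_S2 f (\<lambda>x. f x + t * g x) = inner_S2 f f + t * inner_S2 f g"
      using f g by (subst inner_S2_commute)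
        (simp add: inner_S2_add inner_S2_cmult L2_S2_cmult inner_S2_commute[of g f])
    also have "inner_S2 g (\<lambda>x. f x + t * g x) = inner_S2 f g + t * inner_S2 g g"
      using f g by (subst inner_S2_commute)
        (simp add: inner_S2_add inner_S2_cmult L2_S2_cmult)
    finally show ?thesis by (simp add: algebra_simps power2_eq_square)
  qed
  show ?thesis
  proof (cases "inner_S2 g g = 0")
    case True
    have "inner_S2 f g = 0"
    proof (rule ccontr)
      assume "inner_S2 f g \<noteq> 0"
      define t where "t = - (inner_S2 f f + 1) / (2 * inner_S2 f g)"
      have "2 * t * inner_S2 f g = - (inner_S2 f f + 1)"
        using \<open>inner_S2 f g \<noteq> 0\<close> by (simp add: t_def)
      with q[of t] True show False by simp
    qed
    then show ?thesis by (simp add: inner_S2_ge_0)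
  next
    case False
    then have "inner_S2 g g > 0" using inner_S2_ge_0[of g] by linarith
    then show ?thesis using q[of "- inner_S2 f g / inner_S2 g g"]
      by (simp add: field_simps power2_eq_square)
  qed
qed

lemma norm_S2_triangle:
  assumes f: "f \<in> L2_S2" and g: "g \<in> L2_S2"
  shows "norm_S2 (\<lambda>x. f x + g x) \<le> norm_S2 f + norm_S2 g"
proof (rule power2_le_imp_le)
  have "\<bar>inner_S2 f g\<bar> \<le> norm_S2 f * norm_S2 g"
    using real_sqrt_le_mono[OF inner_S2_square_le[OF f g]] by (simp add: norm_S2_def real_sqrt_mult)
  moreover have "inner_S2 (\<lambda>x. f x + g x) (\<lambda>x. f x + g x) = inner_S2 f f + 2 * inner_S2 f g + inner_S2 g g"
  proof -
    have "inner_S2 (\<lambda>x. f x + g x) (\<lambda>x. f x + g x)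
      = inner_S2 f (\<lambda>x. f x + g x) + inner_S2 g (\<lambda>x. f x + g x)"
      using f g by (simp add: inner_S2_add L2_S2_add)
    also have "inner_S2 f (\<lambda>x. f x + g x) = inner_S2 f f + inner_S2 f g"
      using f g by (subst inner_S2_commute) (simp add: inner_S2_add inner_S2_commute[of g f])
    also have "inner_S2 g (\<lambda>x. f x + g x) = inner_S2 f g + inner_S2 g g"
      using f g by (subst inner_S2_commute) (simp add: inner_S2_add)
    finally show ?thesis by simp
  qed
  ultimately show "(norm_S2 (\<lambda>x. f x + g x))\<^sup>2 \<le> (norm_S2 f + norm_S2 g)\<^sup>2"
    by (simp add: power2_sum norm_S2_square)
qed simp

lemma norm_S2_triangle_diff:
  assumes f: "f \<in> L2_S2" and g: "g \<in> L2_S2"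
  shows "\<bar>norm_S2 f - norm_S2 g\<bar> \<le> norm_S2 (\<lambda>x. f x - g x)"
proof -
  have "norm_S2 (\<lambda>x. g x - f x) = norm_S2 (\<lambda>x. f x - g x)"
    by (simp add: norm_S2_def inner_S2_def mult.commute) (simp add: algebra_simps)
  then show ?thesis
    using norm_S2_triangle[OF L2_S2_diff[OF f g] g] norm_S2_triangle[OF L2_S2_diff[OF g f] f] by simp
qed

lemma norm_S2_tendsto:
  assumes "f \<in> L2_S2" "\<And>N. g N \<in> L2_S2" "(\<lambda>N. norm_S2 (\<lambda>x. f x - g N x)) \<longlonglongrightarrow> 0"
  shows "(\<lambda>N. norm_S2 (g N)) \<longlonglongrightarrow> norm_S2 f"
proof -
  have "(\<lambda>N. norm_S2 (g N) - norm_S2 f) \<longlonglongrightarrow> 0"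
    by (rule Lim_null_comparison[OF _ assms(3)])
      (use norm_S2_triangle_diff assms(1,2) in \<open>auto simp: abs_minus_commute\<close>)
  then show ?thesis by (simp add: LIM_zero_iff)
qed

section \<open>The addition theorem\<close>

abbreviation orders :: "nat \<Rightarrow> int set" where
  "orders l \<equiv> {- int l..int l}"

lemma spherical_harmonic_solid:
  assumes "spherical_harmonic l f"
  obtains h where "solid_harmonic l h" "\<And>x. x \<in> S2 \<Longrightarrow> f x = h x"
proof -
  obtain h where h: "real_polynomial_function h" "\<forall>t x. h (t *\<^sub>R x) = t ^ l * h x"
    "\<forall>x. laplacian h x = 0" "\<forall>x\<in>S2. f x = h x"
    using assms unfolding spherical_harmonic_def by blast
  then have "solid_harmonic l h" by (simp add: solid_harmonic_def homogeneous_def)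
  then show ?thesis using that h(4) by blast
qed

lemma solid_harmonic_continuous: "solid_harmonic l h \<Longrightarrow> continuous_on S h"
  unfolding solid_harmonic_def real_polynomial_function_eq
  by (meson continuous_at_imp_continuous_on continuous_polymonial_function)

lemma spherical_harmonic_continuous: "spherical_harmonic l f \<Longrightarrow> continuous_on S2 f"
  by (metis (no_types, lifting) continuous_on_cong solid_harmonic_continuous spherical_harmonic_solid)

lemma spherical_harmonic_comp_rotation:
  assumes R: "orthogonal_transformation R" and f: "spherical_harmonic l f"
  shows "spherical_harmonic l (\<lambda>x. f (R x))"
proof -
  obtain h where h: "real_polynomial_function h" "\<And>t x. h (t *\<^sub>R x) = t ^ l * h x"
    "\<And>x. laplacian h x = 0" "\<And>x. x \<in> S2 \<Longrightarrow> f x = h x"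
    using f by (auto simp: spherical_harmonic_def)
  show ?thesis unfolding spherical_harmonic_def
    by (intro exI[of _ "\<lambda>x. h (R x)"])
      (use h R in \<open>auto simp: laplacian_rotation orthogonal_transformation_scaleR polynomial_comp_linear
          orthogonal_transformation_linear orthogonal_transformation_norm\<close>)
qed

lemma inner_S2_rotation:
  assumes R: "orthogonal_transformation R" and "f \<in> L2_S2" "g \<in> L2_S2"
  shows "inner_S2 (\<lambda>x. f (R x)) (\<lambda>x. g (R x)) = inner_S2 f g"
proof -
  have "inner_S2 f g = (LINT x|distr surf surf R. f x * g x)"
    by (simp add: inner_S2_def surf_rotation[OF R])
  also have "\<dots> = (LINT x|surf. f (R x) * g (R x))"
    using assms L2_S2_measurable by (intro integral_distr orthogonal_measurable_surf) auto
  finally show ?thesis by (simp add: inner_S2_def)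
qed

locale harmonic_basis =
  fixes Y :: "nat \<Rightarrow> int \<Rightarrow> real^3 \<Rightarrow> real"
  assumes basis: "spherical_harmonic_basis Y"
begin

lemma harmonic_Y: "m \<in> orders l \<Longrightarrow> spherical_harmonic l (Y l m)"
  using basis by (auto simp: spherical_harmonic_basis_def)

lemma continuous_Y: "m \<in> orders l \<Longrightarrow> continuous_on S2 (Y l m)"
  by (rule spherical_harmonic_continuous[OF harmonic_Y])

lemma L2_Y: "m \<in> orders l \<Longrightarrow> Y l m \<in> L2_S2"
  by (rule continuous_L2_S2[OF continuous_Y])

lemma inner_Y:
  "m \<in> orders l \<Longrightarrow> m' \<in> orders l' \<Longrightarrow> inner_S2 (Y l m) (Y l' m') = (if l = l' \<and> m = m' then 1 else 0)"
  using basis by (auto simp: spherical_harmonic_basis_def)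

lemma inner_sum_Y:
  assumes "m \<in> orders l"
  shows "inner_S2 (\<lambda>x. \<Sum>m\<in>orders l. c m * Y l m x) (Y l m) = c m"
proof -
  have "inner_S2 (\<lambda>x. \<Sum>m\<in>orders l. c m * Y l m x) (Y l m) = (\<Sum>m'\<in>orders l. c m' * inner_S2 (Y l m') (Y l m))"
    using assms by (intro inner_S2_sum L2_Y)
  also have "\<dots> = (\<Sum>m'\<in>orders l. if m = m' then c m' else 0)"
    using assms by (intro sum.cong refl) (auto simp: inner_Y)
  finally show ?thesis using assms by (subst (asm) sum.delta') auto
qed

text \<open>The \<open>2 l + 1\<close> orthonormal functions \<open>Y l m\<close> and \<open>f\<close> are linearly dependent by the dimension bound.
  Orthonormality prevents a relation among the \<open>Y l m\<close> alone, so \<open>f\<close> lies in their span.\<close>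

lemma spherical_harmonic_expansion:
  assumes f: "spherical_harmonic l f" and x: "x \<in> S2"
  shows "f x = degree_part Y f l x"
proof -
  obtain h where h: "solid_harmonic l h" "\<And>x. x \<in> S2 \<Longrightarrow> f x = h x"
    using spherical_harmonic_solid[OF f] by blast
  have "\<forall>m. \<exists>g. m \<in> orders l \<longrightarrow> solid_harmonic l g \<and> (\<forall>x\<in>S2. Y l m x = g x)"
    using spherical_harmonic_solid[OF harmonic_Y] by metis
  then obtain g where g: "\<And>m. m \<in> orders l \<Longrightarrow> solid_harmonic l (g m)"
    "\<And>m x. m \<in> orders l \<Longrightarrow> x \<in> S2 \<Longrightarrow> Y l m x = g m x" by metis
  \<comment> \<open>The family consists of \<open>f\<close>, at index \<open>None\<close>, and the basis functions of degree \<open>l\<close>.\<close>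
  define k where "k v = (case v of None \<Rightarrow> h | Some m \<Rightarrow> g m)" for v
  have "finite (insert None (Some ` orders l))" "card (insert None (Some ` orders l)) > 2 * l + 1"
    by (auto simp: card_insert_if card_image)
  moreover have "solid_harmonic l (k v)" if "v \<in> insert None (Some ` orders l)" for v
    using that g h by (auto simp: k_def)
  ultimately obtain c where c: "\<exists>v\<in>insert None (Some ` orders l). c v \<noteq> 0"
     "\<And>x. (\<Sum>v\<in>insert None (Some ` orders l). c v * k v x) = 0"
    using solid_harmonics_dependent[of "insert None (Some ` orders l)" l k] by blast
  have rel: "c None * f x + (\<Sum>m\<in>orders l. c (Some m) * Y l m x) = 0" if "x \<in> S2" for x
    using c(2)[of x] that g h by (simp add: sum.reindex k_def)
  have "c None \<noteq> 0"
  proof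
    assume 0: "c None = 0"
    have "c (Some m) = 0" if m: "m \<in> orders l" for m
    proof -
      have "c (Some m) = inner_S2 (\<lambda>x. \<Sum>m\<in>orders l. c (Some m) * Y l m x) (Y l m)"
        using m by (simp add: inner_sum_Y)
      also have "\<dots> = inner_S2 (\<lambda>x. 0) (Y l m)"
        using rel 0 by (intro inner_S2_cong) auto
      finally show ?thesis by (simp add: inner_S2_def)
    qed
    with 0 c(1) show False by auto
  qed
  define b where "b m = - c (Some m) / c None" for m
  have eq: "f x = (\<Sum>m\<in>orders l. b m * Y l m x)" if "x \<in> S2" for x
    using rel[OF that] \<open>c None \<noteq> 0\<close>
    by (simp add: b_def sum_divide_distrib[symmetric] sum_negf field_simps eq_neg_iff_add_eq_0)
  have "inner_S2 f (Y l m) = b m" if "m \<in> orders l" for m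
  proof -
    have "inner_S2 f (Y l m) = inner_S2 (\<lambda>x. \<Sum>m\<in>orders l. b m * Y l m x) (Y l m)"
      by (intro inner_S2_cong eq refl)
    then show ?thesis using that by (simp add: inner_sum_Y)
  qed
  then show ?thesis using eq[OF x] by (simp add: degree_part_def)
qed

lemma inner_sum_Y_self:
  "inner_S2 (\<lambda>x. \<Sum>m\<in>orders l. c m * Y l m x) (\<lambda>x. \<Sum>m\<in>orders l. c m * Y l m x) = (\<Sum>m\<in>orders l. (c m)\<^sup>2)"
proof -
  have L2: "(\<lambda>x. \<Sum>m\<in>orders l. c m * Y l m x) \<in> L2_S2"
    by (intro L2_S2_sum L2_S2_cmult L2_Y)
  have "inner_S2 (\<lambda>x. \<Sum>m\<in>orders l. c m * Y l m x) (\<lambda>x. \<Sum>m\<in>orders l. c m * Y l m x)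
     = (\<Sum>m'\<in>orders l. c m' * inner_S2 (\<lambda>x. \<Sum>m\<in>orders l. c m * Y l m x) (Y l m'))"
    by (subst inner_S2_sum) (use L2 in \<open>auto simp: L2_Y inner_S2_commute\<close>)
  then show ?thesis by (simp add: inner_sum_Y power2_eq_square)
qed

text \<open>The sum of the \<open>(Y l m x)\<^sup>2\<close> is the largest value of \<open>f(x)\<^sup>2\<close> among harmonics \<open>f\<close> of degree \<open>l\<close> and norm
  one. Testing this with the rotated reproducing kernel at \<open>R x\<close>, which is again a harmonic of degree
  \<open>l\<close>, compares the values at \<open>x\<close> and \<open>R x\<close>.\<close>

lemma sum_Y_square_rotation_le:
  assumes R: "orthogonal_transformation R" and x: "x \<in> S2"
  shows "(\<Sum>m\<in>orders l. (Y l m (R x))\<^sup>2) \<le> (\<Sum>m\<in>orders l. (Y l m x)\<^sup>2)"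
proof -
  define K where "K = (\<Sum>m\<in>orders l. (Y l m (R x))\<^sup>2)"
  \<comment> \<open>The reproducing kernel of degree \<open>l\<close> at \<open>R x\<close>.\<close>
  define g where "g z = (\<Sum>m\<in>orders l. Y l m (R x) * Y l m z)" for z
  have gL2: "g \<in> L2_S2" unfolding g_def by (intro L2_S2_sum L2_S2_cmult L2_Y)
  define f where "f z = g (R z)" for z
  have exp: "f y = (\<Sum>m\<in>orders l. inner_S2 f (Y l m) * Y l m y)" if y: "y \<in> S2" for y
  proof -
    have Yexp: "Y l m (R z) = degree_part Y (\<lambda>z. Y l m (R z)) l z" if "m \<in> orders l" "z \<in> S2" for m z
      using spherical_harmonic_expansion[OF spherical_harmonic_comp_rotation[OF R harmonic_Y[OF that(1)]] that(2)] .
    have YL2: "(\<lambda>z. Y l m (R z)) \<in> L2_S2" if "m \<in> orders l" for m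
      using spherical_harmonic_continuous[OF spherical_harmonic_comp_rotation[OF R harmonic_Y[OF that]]]
      by (rule continuous_L2_S2)
    have "f y = (\<Sum>m'\<in>orders l. Y l m' (R x) * (\<Sum>m\<in>orders l. inner_S2 (\<lambda>z. Y l m' (R z)) (Y l m) * Y l m y))"
      unfolding f_def g_def
    proof (rule sum.cong[OF refl])
      fix m' assume "m' \<in> orders l"
      from Yexp[OF this y]
      show "Y l m' (R x) * Y l m' (R y) = Y l m' (R x) * (\<Sum>m\<in>orders l. inner_S2 (\<lambda>z. Y l m' (R z)) (Y l m) * Y l m y)"
        unfolding degree_part_def by (rule arg_cong)
    qed
    also have "\<dots> = (\<Sum>m\<in>orders l. (\<Sum>m'\<in>orders l. Y l m' (R x) * inner_S2 (\<lambda>z. Y l m' (R z)) (Y l m)) * Y l m y)"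
      by (simp only: sum_distrib_left sum_distrib_right mult.assoc) (rule sum.swap)
    also have "\<dots> = (\<Sum>m\<in>orders l. inner_S2 f (Y l m) * Y l m y)"
      unfolding f_def[abs_def] g_def[abs_def]
      by (intro sum.cong refl arg_cong2[where f = "(*)"] inner_S2_sum[symmetric] YL2 L2_Y)
    finally show ?thesis .
  qed
  have "(\<Sum>m\<in>orders l. (inner_S2 f (Y l m))\<^sup>2) = inner_S2 f f"
    unfolding inner_sum_Y_self[symmetric] by (intro inner_S2_cong) (simp_all add: exp)
  also have "\<dots> = inner_S2 g g"
    unfolding f_def by (intro inner_S2_rotation R gL2)
  also have "\<dots> = K" unfolding g_def inner_sum_Y_self K_def ..
  finally have K: "(\<Sum>m\<in>orders l. (inner_S2 f (Y l m))\<^sup>2) = K" .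
  have "f x = K" by (simp add: f_def g_def K_def power2_eq_square)
  then have "K\<^sup>2 \<le> K * (\<Sum>m\<in>orders l. (Y l m x)\<^sup>2)"
    using Cauchy_Schwarz_ineq_sum[of "\<lambda>m. inner_S2 f (Y l m)" "\<lambda>m. Y l m x" "orders l"] exp[OF x] K
    by simp
  moreover have "K \<ge> 0" by (simp add: K_def sum_nonneg)
  ultimately have "K \<le> (\<Sum>m\<in>orders l. (Y l m x)\<^sup>2)"
    by (cases "K = 0") (auto intro!: sum_nonneg simp: mult_le_cancel_left power2_eq_square[of K])
  then show ?thesis by (simp only: K_def)
qed

text \<open>Rotations act transitively on the sphere, so the sum is constant; its integral is the number
  \<open>2 l + 1\<close> of its terms.\<close>

lemma addition_theorem:
  assumes x: "x \<in> S2"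
  shows "(\<Sum>m\<in>orders l. (Y l m x)\<^sup>2) = (2 * real l + 1) / (4 * pi)"
proof -
  have eq: "(\<Sum>m\<in>orders l. (Y l m y)\<^sup>2) = (\<Sum>m\<in>orders l. (Y l m x)\<^sup>2)" if "y \<in> S2" for y
  proof (rule antisym)
    have n: "norm x = 1" "norm y = 1" using x that by auto
    from n obtain R where "orthogonal_transformation R" "R x = y"
      by (rule orthogonal_transformation_exists_1)
    then show "(\<Sum>m\<in>orders l. (Y l m y)\<^sup>2) \<le> (\<Sum>m\<in>orders l. (Y l m x)\<^sup>2)"
      using sum_Y_square_rotation_le x by metis
    from n(2,1) obtain R where "orthogonal_transformation R" "R y = x"
      by (rule orthogonal_transformation_exists_1)
    then show "(\<Sum>m\<in>orders l. (Y l m x)\<^sup>2) \<le> (\<Sum>m\<in>orders l. (Y l m y)\<^sup>2)"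
      using sum_Y_square_rotation_le that by metis
  qed
  have "2 * real l + 1 = (\<Sum>m\<in>orders l. inner_S2 (Y l m) (Y l m))"
    by (simp add: inner_Y)
  also have "\<dots> = (LINT y|surf. (\<Sum>m\<in>orders l. (Y l m y)\<^sup>2))"
    using L2_Y by (simp add: inner_S2_def power2_eq_square integrable_L2_mult)
  also have "\<dots> = (LINT y|surf. (\<Sum>m\<in>orders l. (Y l m x)\<^sup>2))"
    by (intro Bochner_Integration.integral_cong refl eq) simp
  also have "\<dots> = 4 * pi * (\<Sum>m\<in>orders l. (Y l m x)\<^sup>2)"
    by (simp add: measure_surf_S2)
  finally show ?thesis by (simp add: field_simps)
qed

end

section \<open>Spherical harmonic expansions and the Sobolev embedding\<close>

definition sobolev_weight :: "real \<Rightarrow> nat \<Rightarrow> real" where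
  "sobolev_weight s l = (1 + real l * (real l + 1)) powr s"

lemma sobolev_weight_pos: "0 < sobolev_weight s l"
  unfolding sobolev_weight_def by (subst powr_gt_zero) (smt (verit) mult_nonneg_nonneg of_nat_0_le_iff)

lemma sobolev_weight_ge_1: "s \<ge> 0 \<Longrightarrow> 1 \<le> sobolev_weight s l"
  unfolding sobolev_weight_def by (rule ge_one_powr_ge_zero) auto

lemma sobolev_weight_le: "s \<ge> 0 \<Longrightarrow> sobolev_weight s l \<le> (1 + real l) powr (2 * s)"
proof -
  assume s: "s \<ge> 0"
  have "1 + real l * (real l + 1) \<le> (1 + real l) powr 2"
    by (simp add: power2_eq_square algebra_simps)
  then have "(1 + real l * (real l + 1)) powr s \<le> ((1 + real l) powr 2) powr s"
    using s by (intro powr_mono2) auto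
  then show ?thesis by (simp only: sobolev_weight_def powr_powr)
qed

lemma le_sobolev_weight: "s \<ge> 0 \<Longrightarrow> (1 + real l) powr (2 * s) \<le> 2 powr s * sobolev_weight s l"
proof -
  assume s: "s \<ge> 0"
  have "(1 + real l) powr 2 \<le> 2 * (1 + real l * (real l + 1))"
    by (simp add: power2_eq_square algebra_simps)
  then have "((1 + real l) powr 2) powr s \<le> (2 * (1 + real l * (real l + 1))) powr s"
    using s by (intro powr_mono2) auto
  also have "\<dots> = 2 powr s * sobolev_weight s l"
    unfolding sobolev_weight_def by (rule powr_mult)
  finally show ?thesis by (simp only: powr_powr)
qed

lemma summable_dim_over_weight:
  assumes s: "s > 1"
  shows "summable (\<lambda>l. (2 * real l + 1) / sobolev_weight s l)"
proof (rule summable_comparison_test')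
  have "summable (\<lambda>n. real n powr (1 - 2 * s))" using s by (simp add: summable_real_powr_iff)
  then have "summable (\<lambda>n. real (Suc n) powr (1 - 2 * s))" by (subst summable_Suc_iff)
  then show "summable (\<lambda>n. 2 * 2 powr s * (1 + real n) powr (1 - 2 * s))" by (intro summable_mult) (simp add: add.commute)
  fix l :: nat
  have "(2 * real l + 1) / sobolev_weight s l \<le> (2 * (1 + real l)) / sobolev_weight s l"
    using sobolev_weight_pos[of s l] by (intro divide_right_mono) auto
  also have "\<dots> \<le> 2 * (1 + real l) / ((1 + real l) powr (2 * s) / 2 powr s)"
  proof (rule divide_left_mono)
    show "(1 + real l) powr (2 * s) / 2 powr s \<le> sobolev_weight s l"
      using le_sobolev_weight[of s l] s by (simp add: field_simps)
  qed (use sobolev_weight_pos[of s l] in auto)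
  also have "\<dots> = 2 * 2 powr s * (1 + real l) powr (1 - 2 * s)"
    by (simp add: powr_diff)
  finally show "norm ((2 * real l + 1) / sobolev_weight s l) \<le> 2 * 2 powr s * (1 + real l) powr (1 - 2 * s)"
    using sobolev_weight_pos[of s l] by simp
qed

context harmonic_basis begin

definition energy :: "(real^3 \<Rightarrow> real) \<Rightarrow> nat \<Rightarrow> real" where
  "energy f l = (\<Sum>m\<in>orders l. (inner_S2 f (Y l m))\<^sup>2)"

lemma energy_ge_0: "0 \<le> energy f l"
  by (simp add: energy_def sum_nonneg)

lemma sobolev_term_energy:
  "sobolev_term Y s f l = (1 + real l * (real l + 1)) powr s * energy f l"
  by (simp add: sobolev_term_def energy_def)

lemma inner_sum_Y':
  assumes "m \<in> orders l"
  shows "inner_S2 (\<lambda>x. \<Sum>m\<in>orders l'. c m * Y l' m x) (Y l m) = (if l = l' then c m else 0)"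
proof (cases "l = l'")
  case False
  then show ?thesis using assms by (subst inner_S2_sum) (auto simp: L2_Y inner_Y)
qed (use assms in \<open>simp add: inner_sum_Y\<close>)

definition synthesis :: "(nat \<Rightarrow> int \<Rightarrow> real) \<Rightarrow> nat \<Rightarrow> real^3 \<Rightarrow> real" where
  "synthesis c N x = (\<Sum>l<N. \<Sum>m\<in>orders l. c l m * Y l m x)"

lemma synthesis_L2: "synthesis c N \<in> L2_S2"
  unfolding synthesis_def[abs_def] by (intro L2_S2_sum L2_S2_cmult L2_Y)

lemma inner_synthesis_Y:
  assumes "m \<in> orders l"
  shows "inner_S2 (synthesis c N) (Y l m) = (if l < N then c l m else 0)"
proof -
  have "inner_S2 (synthesis c N) (Y l m)
      = (\<Sum>l'<N. 1 * inner_S2 (\<lambda>x. \<Sum>m\<in>orders l'. c l' m * Y l' m x) (Y l m))"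
    unfolding synthesis_def[abs_def] using assms
    by (subst inner_S2_sum[symmetric]) (auto intro!: L2_S2_sum L2_S2_cmult L2_Y)
  also have "\<dots> = (\<Sum>l'<N. if l = l' then c l m else 0)"
    using assms by (intro sum.cong refl) (auto simp: inner_sum_Y')
  finally show ?thesis by simp
qed

lemma inner_synthesis:
  assumes f: "f \<in> L2_S2"
  shows "inner_S2 (synthesis c N) f = (\<Sum>l<N. \<Sum>m\<in>orders l. c l m * inner_S2 f (Y l m))"
proof -
  have "inner_S2 (synthesis c N) f
      = (\<Sum>l<N. 1 * inner_S2 (\<lambda>x. \<Sum>m\<in>orders l. c l m * Y l m x) f)"
    unfolding synthesis_def[abs_def] using f
    by (subst inner_S2_sum[symmetric]) (auto intro!: L2_S2_sum L2_S2_cmult L2_Y)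
  also have "\<dots> = (\<Sum>l<N. \<Sum>m\<in>orders l. c l m * inner_S2 f (Y l m))"
    using f by (intro sum.cong refl) (subst inner_S2_sum, auto simp: L2_Y inner_S2_commute[of f])
  finally show ?thesis .
qed

lemma norm_synthesis: "(norm_S2 (synthesis c N))\<^sup>2 = (\<Sum>l<N. \<Sum>m\<in>orders l. (c l m)\<^sup>2)"
  unfolding norm_S2_square inner_synthesis[OF synthesis_L2]
  by (intro sum.cong refl) (simp add: inner_synthesis_Y power2_eq_square)

lemma sum_degree_part: "(\<Sum>l<N. a l * degree_part Y f l x) = synthesis (\<lambda>l m. a l * inner_S2 f (Y l m)) N x"
  by (simp add: synthesis_def degree_part_def sum_distrib_left mult.assoc)

text \<open>Parseval's identity for a function given by an \<open>L\<^sup>2\<close>-convergent multiplier series; it serves both the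
  identity multiplier and the smoothing operator.\<close>

lemma parseval_multiplier:
  assumes g: "g \<in> L2_S2"
    and lim: "(\<lambda>N. norm_S2 (\<lambda>x. g x - (\<Sum>l<N. a l * degree_part Y f l x))) \<longlonglongrightarrow> 0"
  shows "(\<lambda>l. (a l)\<^sup>2 * energy f l) sums (norm_S2 g)\<^sup>2"
proof -
  have "(\<lambda>N. norm_S2 (synthesis (\<lambda>l m. a l * inner_S2 f (Y l m)) N)) \<longlonglongrightarrow> norm_S2 g"
    using g lim by (intro norm_S2_tendsto synthesis_L2) (simp_all add: sum_degree_part)
  then have "(\<lambda>N. (norm_S2 (synthesis (\<lambda>l m. a l * inner_S2 f (Y l m)) N))\<^sup>2) \<longlonglongrightarrow> (norm_S2 g)\<^sup>2"
    by (rule tendsto_power)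
  then show ?thesis
    by (simp add: norm_synthesis sums_def energy_def power_mult_distrib sum_distrib_left)
qed

lemma parseval:
  assumes f: "f \<in> L2_S2"
  shows "energy f sums inner_S2 f f"
  using parseval_multiplier[OF f, of "\<lambda>_. 1" f] basis f
  by (simp add: spherical_harmonic_basis_def norm_S2_square)

text \<open>The uniform bound for the degree \<open>l\<close> part with coefficients \<open>c l\<close> that Cauchy--Schwarz and the
  addition theorem provide.\<close>

definition sup_bound :: "(nat \<Rightarrow> int \<Rightarrow> real) \<Rightarrow> nat \<Rightarrow> real" where
  "sup_bound c l = sqrt (\<Sum>m\<in>orders l. (c l m)\<^sup>2) * sqrt ((2 * real l + 1) / (4 * pi))"

lemma sup_bound_ge_0: "0 \<le> sup_bound c l"
  by (simp add: sup_bound_def sum_nonneg)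

lemma abs_sum_Y_le:
  assumes "x \<in> S2"
  shows "\<bar>\<Sum>m\<in>orders l. c l m * Y l m x\<bar> \<le> sup_bound c l"
proof -
  have "(\<Sum>m\<in>orders l. c l m * Y l m x)\<^sup>2 \<le> (\<Sum>m\<in>orders l. (c l m)\<^sup>2) * ((2 * real l + 1) / (4 * pi))"
    using Cauchy_Schwarz_ineq_sum[of "c l" "\<lambda>m. Y l m x" "orders l"] by (simp only: addition_theorem[OF assms])
  from real_sqrt_le_mono[OF this] show ?thesis by (simp only: real_sqrt_abs real_sqrt_mult sup_bound_def)
qed

text \<open>Under the Weierstrass test the series converges uniformly, so that its sum is continuous and has the
  prescribed coefficients.\<close>

lemma synthesis_limit:
  assumes sm: "summable (sup_bound c)"
  defines "F \<equiv> \<lambda>x. \<Sum>l. \<Sum>m\<in>orders l. c l m * Y l m x"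
  shows "continuous_on S2 F"
    and "x \<in> S2 \<Longrightarrow> (\<lambda>l. \<Sum>m\<in>orders l. c l m * Y l m x) sums F x"
    and "m \<in> orders l \<Longrightarrow> inner_S2 F (Y l m) = c l m"
proof -
  let ?M = "\<Sum>l. sup_bound c l"
  have ul: "uniform_limit S2 (\<lambda>N x. \<Sum>l<N. \<Sum>m\<in>orders l. c l m * Y l m x) F sequentially"
    unfolding F_def using abs_sum_Y_le by (intro Weierstrass_m_test[OF _ sm]) auto
  have cont: "continuous_on S2 (synthesis c N)" for N
    unfolding synthesis_def[abs_def] by (intro continuous_intros continuous_Y)
  show contF: "continuous_on S2 F"
    using cont by (intro uniform_limit_theorem[OF _ ul]) (auto simp: synthesis_def[abs_def])
  show sums: "(\<lambda>l. \<Sum>m\<in>orders l. c l m * Y l m x) sums F x" if "x \<in> S2" for x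
    using tendsto_uniform_limitI[OF ul that] by (simp add: sums_def)
  have bound: "\<bar>synthesis c N x\<bar> \<le> ?M" if x: "x \<in> S2" for N x
  proof -
    have "\<bar>synthesis c N x\<bar> \<le> (\<Sum>l<N. sup_bound c l)"
      unfolding synthesis_def by (rule order_trans[OF sum_abs sum_mono], rule abs_sum_Y_le[OF x])
    also have "\<dots> \<le> ?M" using sm sup_bound_ge_0 by (intro sum_le_suminf) auto
    finally show ?thesis .
  qed
  show "inner_S2 F (Y l m) = c l m" if m: "m \<in> orders l"
  proof -
    have "(\<lambda>N. inner_S2 (synthesis c N) (Y l m)) \<longlonglongrightarrow> inner_S2 F (Y l m)"
      unfolding inner_S2_def
    proof (rule integral_dominated_convergence)
      show "(\<lambda>x. F x * Y l m x) \<in> borel_measurable surf" "(\<lambda>x. synthesis c N x * Y l m x) \<in> borel_measurable surf" for N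
        using L2_S2_measurable[OF continuous_L2_S2[OF contF]] L2_S2_measurable[OF continuous_L2_S2[OF cont]]
          L2_S2_measurable[OF L2_Y[OF m]] by measurable
      show "integrable surf (\<lambda>x. ?M * \<bar>Y l m x\<bar>)"
        using integrable_L2_mult[OF L2_Y[OF m] continuous_L2_S2[of "\<lambda>_. 1"]] by simp
      show "AE x in surf. (\<lambda>N. synthesis c N x * Y l m x) \<longlonglongrightarrow> F x * Y l m x"
        using sums by (intro AE_I2 tendsto_mult tendsto_const) (simp add: sums_def synthesis_def)
      show "AE x in surf. norm (synthesis c N x * Y l m x) \<le> ?M * \<bar>Y l m x\<bar>" for N
        using bound by (intro AE_I2) (simp add: abs_mult mult_right_mono)
    qed
    moreover have "(\<lambda>N. inner_S2 (synthesis c N) (Y l m)) \<longlonglongrightarrow> c l m"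
      by (rule tendsto_eventually) (use m in \<open>auto simp: inner_synthesis_Y eventually_at_top_linorder intro!: exI[of _ "Suc l"]\<close>)
    ultimately show ?thesis by (rule LIMSEQ_unique)
  qed
qed

text \<open>The Sobolev embedding: by the arithmetic-geometric mean inequality the bound for degree \<open>l\<close> is dominated
  by the Sobolev term plus \<open>(2 l + 1) / weight\<close>, which is summable exactly above order one.\<close>

lemma summable_sup_bound:
  assumes s: "s > 1" and sm: "summable (\<lambda>l. sobolev_weight s l * (\<Sum>m\<in>orders l. (c l m)\<^sup>2))"
  shows "summable (sup_bound c)"
proof (rule summable_comparison_test')
  show "summable (\<lambda>l. sobolev_weight s l * (\<Sum>m\<in>orders l. (c l m)\<^sup>2) + (2 * real l + 1) / sobolev_weight s l)"
    by (intro summable_add sm summable_dim_over_weight s)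
  fix l
  let ?e = "\<Sum>m\<in>orders l. (c l m)\<^sup>2" and ?w = "sobolev_weight s l" and ?n = "2 * real l + 1"
  have w: "?w > 0" by (rule sobolev_weight_pos)
  have e: "?e \<ge> 0" by (simp add: sum_nonneg)
  have "sup_bound c l = sqrt ((?w * ?e) * (?n / (4 * pi) / ?w))"
    using w e by (simp add: sup_bound_def real_sqrt_mult[symmetric])
  also have "\<dots> \<le> (?w * ?e + ?n / (4 * pi) / ?w) / 2"
    using w e by (intro arith_geo_mean_sqrt) auto
  also have "\<dots> \<le> ?w * ?e + ?n / ?w"
  proof -
    have "?n / (4 * pi) \<le> ?n / 1" using pi_gt3 by (intro divide_left_mono) auto
    then have "?n / (4 * pi) / ?w \<le> ?n / ?w" using w by (intro divide_right_mono) auto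
    moreover have "?w * ?e \<ge> 0" "?n / ?w \<ge> 0" using w e by auto
    moreover have "(a + b) / 2 \<le> a + c" if "b \<le> c" "0 \<le> a" "0 \<le> c" for a b c :: real
      using that by simp
    ultimately show ?thesis by blast
  qed
  finally show "norm (sup_bound c l) \<le> ?w * ?e + ?n / ?w" using sup_bound_ge_0[of c l] by simp
qed

lemma sobolev_L2: "f \<in> sobolev Y s \<Longrightarrow> f \<in> L2_S2"
  by (simp add: sobolev_def)

lemma sobolev_summable: "f \<in> sobolev Y s \<Longrightarrow> summable (\<lambda>l. sobolev_weight s l * energy f l)"
  by (simp add: sobolev_def sobolev_term_energy[abs_def] sobolev_weight_def)

lemma sobolevI:
  assumes "continuous_on S2 f" "summable (\<lambda>l. sobolev_weight s l * energy f l)"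
  shows "f \<in> sobolev Y s"
  using assms continuous_L2_S2 by (simp add: sobolev_def sobolev_term_energy[abs_def] sobolev_weight_def)

lemma sobolev_norm_square:
  assumes "f \<in> sobolev Y s"
  shows "(sobolev_norm Y s f)\<^sup>2 = (\<Sum>l. sobolev_weight s l * energy f l)"
  using suminf_nonneg[OF sobolev_summable[OF assms]] sobolev_weight_pos energy_ge_0
  by (simp add: sobolev_norm_def sobolev_term_energy[abs_def] sobolev_weight_def less_imp_le)

lemma sobolev_norm_ge_0:
  assumes "f \<in> sobolev Y s"
  shows "0 \<le> sobolev_norm Y s f"
  using suminf_nonneg[OF sobolev_summable[OF assms]] sobolev_weight_pos energy_ge_0
  by (simp add: sobolev_norm_def sobolev_term_energy[abs_def] sobolev_weight_def less_imp_le)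

lemma inner_le_sobolev_norm:
  assumes f: "f \<in> sobolev Y s" and s: "s \<ge> 0"
  shows "inner_S2 f f \<le> (sobolev_norm Y s f)\<^sup>2"
proof -
  have "energy f l \<le> sobolev_weight s l * energy f l" for l
    using mult_right_mono[OF sobolev_weight_ge_1[OF s] energy_ge_0] by simp
  then show ?thesis
    unfolding sobolev_norm_square[OF f] sums_unique[OF parseval[OF sobolev_L2[OF f]]]
    using sobolev_summable[OF f] parseval[OF sobolev_L2[OF f]] by (intro suminf_le) (auto simp: sums_iff)
qed

lemma coefficient_le_sobolev_norm:
  assumes f: "f \<in> sobolev Y s" and s: "s \<ge> 0" and m: "m \<in> orders l"
  shows "\<bar>inner_S2 f (Y l m)\<bar> \<le> sobolev_norm Y s f"
proof -
  have "(inner_S2 f (Y l m))\<^sup>2 \<le> inner_S2 f f * inner_S2 (Y l m) (Y l m)"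
    using f m by (intro inner_S2_square_le sobolev_L2 L2_Y)
  also have "\<dots> \<le> (sobolev_norm Y s f)\<^sup>2"
    using inner_le_sobolev_norm[OF f s] m by (simp add: inner_Y)
  finally have "\<bar>inner_S2 f (Y l m)\<bar> \<le> \<bar>sobolev_norm Y s f\<bar>" by (simp add: abs_le_square_iff)
  then show ?thesis using sobolev_norm_ge_0[OF f] by simp
qed

lemma L2_zero_coeffs:
  assumes "f \<in> L2_S2" "\<And>l m. m \<in> orders l \<Longrightarrow> inner_S2 f (Y l m) = 0"
  shows "AE x in surf. f x = 0"
proof -
  have "energy f = (\<lambda>_. 0)" using assms(2) by (auto simp: energy_def)
  then have "inner_S2 f f = 0" using parseval[OF assms(1)] sums_unique2[OF sums_zero] by metis
  then have "(LINT x|surf. (f x)\<^sup>2) = 0" by (simp add: inner_S2_def power2_eq_square)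
  then have "AE x in surf. (f x)\<^sup>2 = 0"
    using assms(1) by (subst (asm) integral_nonneg_eq_0_iff_AE) (auto simp: L2_S2_def)
  then show ?thesis by simp
qed

text \<open>The uniformly convergent sum of the expansion and \<open>f\<close> have the same coefficients, hence agree almost
  everywhere, hence everywhere by continuity.\<close>

lemma sobolev_sums:
  assumes f: "f \<in> sobolev Y s" and s: "s > 1" and x: "x \<in> S2"
  shows "(\<lambda>l. degree_part Y f l x) sums f x"
proof -
  have sm: "summable (sup_bound (\<lambda>l m. inner_S2 f (Y l m)))"
    using sobolev_summable[OF f] by (intro summable_sup_bound[OF s]) (simp add: energy_def)
  define F where "F x = (\<Sum>l. \<Sum>m\<in>orders l. inner_S2 f (Y l m) * Y l m x)" for x
  note F = synthesis_limit[OF sm, folded F_def]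
  have cf: "continuous_on S2 f" using f s by (simp add: sobolev_def)
  have cF: "continuous_on S2 F" using F(1) by (simp add: F_def[abs_def])
  have "AE x in surf. F x - f x = 0"
  proof (rule L2_zero_coeffs)
    show "(\<lambda>x. F x - f x) \<in> L2_S2" by (intro L2_S2_diff continuous_L2_S2 cF cf)
    fix l m assume "m \<in> orders l"
    then show "inner_S2 (\<lambda>x. F x - f x) (Y l m) = 0"
      using F(3)[of m l] by (subst inner_S2_diff) (auto intro: continuous_L2_S2 cF cf L2_Y)
  qed
  then have "AE x in surf. F x = f x" by simp
  from AE_surf_continuous_eq[OF cF cf this x] F(2)[OF x]
  show ?thesis by (simp add: degree_part_def[abs_def])
qed

end

section \<open>Regularised least squares and effective dimension\<close>

text \<open>Each observation changes the form \<open>B\<close> by a rank one term, and the reproducing kernel can be updated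
  explicitly by the Sherman--Morrison formula. After all updates the kernels of the full quadratic form
  represent the linear functional built from the data; the representing function \<open>g\<close> minimises the
  objective, by completing the square.\<close>

lemma reproducing_kernel_minimizer:
  fixes H :: "('a \<Rightarrow> real) set" and B :: "('a \<Rightarrow> real) \<Rightarrow> ('a \<Rightarrow> real) \<Rightarrow> real"
    and I :: "'i set" and w y :: "'i \<Rightarrow> real" and u :: "'i \<Rightarrow> 'a"
  assumes zero: "(\<lambda>_. 0) \<in> H"
    and lin: "\<And>f g a b. f \<in> H \<Longrightarrow> g \<in> H \<Longrightarrow> (\<lambda>x. a * f x + b * g x) \<in> H"
    and B_lin: "\<And>f g h a b. f \<in> H \<Longrightarrow> g \<in> H \<Longrightarrow> h \<in> H \<Longrightarrow>
        B (\<lambda>x. a * f x + b * g x) h = a * B f h + b * B g h"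
    and B_sym: "\<And>f g. B f g = B g f"
    and B_pos: "\<And>f. f \<in> H \<Longrightarrow> 0 \<le> B f f"
    and kernel: "\<And>v. v \<in> V \<Longrightarrow> \<exists>k\<in>H. \<forall>h\<in>H. B k h = h v"
    and I: "finite I" and w: "\<And>i. i \<in> I \<Longrightarrow> 0 \<le> w i" and u: "\<And>i. i \<in> I \<Longrightarrow> u i \<in> V"
  shows "\<exists>g\<in>H. \<forall>h\<in>H. (\<Sum>i\<in>I. w i * (y i - g (u i))\<^sup>2) + B g g \<le> (\<Sum>i\<in>I. w i * (y i - h (u i))\<^sup>2) + B h h"
proof -
  have kernel_I: "\<forall>v\<in>V. \<exists>k\<in>H. \<forall>h\<in>H. B k h + (\<Sum>i\<in>I. w i * k (u i) * h (u i)) = h v"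
    using I w u
  proof (induction I rule: finite_induct)
    case empty
    then show ?case using kernel by simp
  next
    case (insert j I)
    let ?B = "\<lambda>f g. B f g + (\<Sum>i\<in>I. w i * f (u i) * g (u i))"
    show ?case
    proof
      fix v assume v: "v \<in> V"
      obtain kv where kv: "kv \<in> H" "\<And>h. h \<in> H \<Longrightarrow> ?B kv h = h v"
        using insert v by (metis insertCI)
      obtain kj where kj: "kj \<in> H" "\<And>h. h \<in> H \<Longrightarrow> ?B kj h = h (u j)"
        using insert by (metis insertCI)
      define s where "s = w j * kj (u j)"
      have "0 \<le> kj (u j)"
        unfolding kj(2)[OF kj(1), symmetric] using B_pos[OF kj(1)] insert.prems
        by (intro add_nonneg_nonneg sum_nonneg) (auto simp: mult.assoc)
      then have s: "s \<ge> 0" using insert.prems by (simp add: s_def)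
      \<comment> \<open>Sherman--Morrison coefficient; \<open>s \<ge> 0\<close> keeps the denominator away from zero.\<close>
      define b where "b = - (w j * kv (u j) / (1 + s))"
      define k where "k x = 1 * kv x + b * kj x" for x
      have kH: "k \<in> H" unfolding k_def[abs_def] by (intro lin kv kj)
      have "B k h + (\<Sum>i\<in>insert j I. w i * k (u i) * h (u i)) = h v" if h: "h \<in> H" for h
      proof -
        have "B k h + (\<Sum>i\<in>insert j I. w i * k (u i) * h (u i)) = ?B k h + w j * k (u j) * h (u j)"
          using insert.hyps by simp
        also have "?B k h = ?B kv h + b * ?B kj h"
          using B_lin[OF kv(1) kj(1) h, of 1 b]
          by (simp add: k_def[abs_def] algebra_simps sum.distrib sum_distrib_left)
        also have "\<dots> = h v + b * h (u j)" using kv kj h by simp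
        also have "h v + b * h (u j) + w j * k (u j) * h (u j) = h v + (b * (1 + s) + w j * kv (u j)) * h (u j)"
          by (simp add: k_def s_def algebra_simps)
        also have "b * (1 + s) + w j * kv (u j) = 0" using s by (simp add: b_def)
        finally show ?thesis by simp
      qed
      then show "\<exists>k\<in>H. \<forall>h\<in>H. B k h + (\<Sum>i\<in>insert j I. w i * k (u i) * h (u i)) = h v" using kH by blast
    qed
  qed
  let ?B = "\<lambda>f g. B f g + (\<Sum>i\<in>I. w i * f (u i) * g (u i))"
  have "\<exists>g\<in>H. \<forall>h\<in>H. ?B g h = (\<Sum>i\<in>J. w i * y i * h (u i))" if "finite J" "J \<subseteq> I" for J
    using that
  proof (induction J rule: finite_induct)
    case empty
    have "B (\<lambda>_. 0) h = 0" if "h \<in> H" for h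
      using B_lin[OF zero zero that, of 0 0] by simp
    then show ?case by (intro bexI[OF _ zero]) simp
  next
    case (insert j J)
    obtain g where g: "g \<in> H" "\<And>h. h \<in> H \<Longrightarrow> ?B g h = (\<Sum>i\<in>J. w i * y i * h (u i))"
      using insert by auto
    obtain k where k: "k \<in> H" "\<And>h. h \<in> H \<Longrightarrow> ?B k h = h (u j)"
      using kernel_I u insert.prems by (metis insert_subset)
    let ?g = "\<lambda>x. 1 * g x + (w j * y j) * k x"
    have "?B ?g h = (\<Sum>i\<in>insert j J. w i * y i * h (u i))" if h: "h \<in> H" for h
    proof -
      have "?B ?g h = ?B g h + w j * y j * ?B k h"
        using B_lin[OF g(1) k(1) h, of 1 "w j * y j"]
        by (simp add: algebra_simps sum.distrib sum_distrib_left)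
      then show ?thesis using g k h insert.hyps by simp
    qed
    moreover have "?g \<in> H" by (intro lin g k)
    ultimately show ?case by blast
  qed
  from this[OF I order_refl] obtain g where g: "g \<in> H"
    "\<And>h. h \<in> H \<Longrightarrow> ?B g h = (\<Sum>i\<in>I. w i * y i * h (u i))" by blast
  have "(\<Sum>i\<in>I. w i * (y i - g (u i))\<^sup>2) + B g g \<le> (\<Sum>i\<in>I. w i * (y i - h (u i))\<^sup>2) + B h h" if h: "h \<in> H" for h
  proof -
    define \<delta> where "\<delta> x = 1 * h x + (-1) * g x" for x
    have \<delta>: "\<delta> \<in> H" unfolding \<delta>_def[abs_def] by (intro lin g h)
    have h_eq: "h = (\<lambda>x. 1 * g x + 1 * \<delta> x)" by (auto simp: \<delta>_def)
    have B_h: "B h f = B g f + B \<delta> f" if "f \<in> H" for f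
      using B_lin[OF g(1) \<delta> that, of 1 1] unfolding h_eq[symmetric] by simp
    have "B h h = B g h + B \<delta> h" by (rule B_h[OF h])
    also have "B g h = B g g + B g \<delta>"
      using B_h[OF g(1)] B_sym[of g h] B_sym[of g \<delta>] by simp
    also have "B \<delta> h = B g \<delta> + B \<delta> \<delta>"
      using B_h[OF \<delta>] B_sym[of \<delta> h] by simp
    finally have Bh: "B h h = B g g + 2 * B g \<delta> + B \<delta> \<delta>" by simp
    have "(\<Sum>i\<in>I. w i * (y i - h (u i))\<^sup>2) = (\<Sum>i\<in>I. w i * (y i - g (u i))\<^sup>2 - 2 * (w i * y i * \<delta> (u i))
        + 2 * (w i * g (u i) * \<delta> (u i)) + w i * (\<delta> (u i))\<^sup>2)"
      by (intro sum.cong refl) (simp add: \<delta>_def power2_eq_square algebra_simps)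
    also have "\<dots> = (\<Sum>i\<in>I. w i * (y i - g (u i))\<^sup>2) - 2 * (\<Sum>i\<in>I. w i * y i * \<delta> (u i))
        + 2 * (\<Sum>i\<in>I. w i * g (u i) * \<delta> (u i)) + (\<Sum>i\<in>I. w i * (\<delta> (u i))\<^sup>2)"
      by (simp add: sum.distrib sum_subtractf sum_distrib_left)
    finally have "(\<Sum>i\<in>I. w i * (y i - h (u i))\<^sup>2) + B h h = (\<Sum>i\<in>I. w i * (y i - g (u i))\<^sup>2) + B g g
      + (\<Sum>i\<in>I. w i * (\<delta> (u i))\<^sup>2) + B \<delta> \<delta>"
      using g(2)[OF \<delta>] Bh by simp
    moreover have "0 \<le> (\<Sum>i\<in>I. w i * (\<delta> (u i))\<^sup>2)" using w by (intro sum_nonneg) auto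
    ultimately show ?thesis using B_pos[OF \<delta>] by linarith
  qed
  with g(1) show ?thesis by blast
qed

text \<open>With \<open>t = l + 1\<close> the summand is at most \<open>1 / (\<theta> + t\<^sup>2 - t) - 1 / (\<theta> + t\<^sup>2 + t)\<close>, and
  \<open>t\<^sup>2 - t = l (l + 1)\<close> makes these differences telescope.\<close>

lemma telescoping_sum_bound:
  fixes \<theta> :: real
  assumes \<theta>: "\<theta> > 0"
  shows "(\<Sum>l<N. 2 * (real l + 1) / (\<theta> + (real l + 1)\<^sup>2)\<^sup>2) \<le> 1 / \<theta>"
proof -
  have "2 * (real l + 1) / (\<theta> + (real l + 1)\<^sup>2)\<^sup>2
      \<le> 1 / (\<theta> + real l * (real l + 1)) - 1 / (\<theta> + real (Suc l) * (real (Suc l) + 1))" for l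
  proof -
    let ?t = "real l + 1"
    have pos: "\<theta> + (?t\<^sup>2 - ?t) > 0" "\<theta> + (?t\<^sup>2 + ?t) > 0"
    proof -
      have "?t\<^sup>2 - ?t = real l * (real l + 1)" by (simp add: power2_eq_square algebra_simps)
      then show "\<theta> + (?t\<^sup>2 - ?t) > 0" using \<theta> by (simp add: add_pos_nonneg)
      show "\<theta> + (?t\<^sup>2 + ?t) > 0" using \<theta> by (simp add: add_pos_nonneg)
    qed
    have "1 / (\<theta> + (?t\<^sup>2 - ?t)) - 1 / (\<theta> + (?t\<^sup>2 + ?t)) = 2 * ?t / ((\<theta> + (?t\<^sup>2 - ?t)) * (\<theta> + (?t\<^sup>2 + ?t)))"
      using pos by (simp add: field_simps)
    also have "(\<theta> + (?t\<^sup>2 - ?t)) * (\<theta> + (?t\<^sup>2 + ?t)) = (\<theta> + ?t\<^sup>2)\<^sup>2 - ?t\<^sup>2"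
      by (simp add: power2_eq_square algebra_simps)
    finally have eq: "1 / (\<theta> + (?t\<^sup>2 - ?t)) - 1 / (\<theta> + (?t\<^sup>2 + ?t)) = 2 * ?t / ((\<theta> + ?t\<^sup>2)\<^sup>2 - ?t\<^sup>2)" .
    have "0 < (\<theta> + ?t\<^sup>2)\<^sup>2 - ?t\<^sup>2"
      using mult_pos_pos[OF pos] by (simp add: power2_eq_square algebra_simps)
    then have "2 * ?t / (\<theta> + ?t\<^sup>2)\<^sup>2 \<le> 2 * ?t / ((\<theta> + ?t\<^sup>2)\<^sup>2 - ?t\<^sup>2)"
      by (intro divide_left_mono) (auto intro!: mult_pos_pos simp: \<theta> add_pos_nonneg zero_less_power)
    also note eq[symmetric]
    also have "?t\<^sup>2 - ?t = real l * (real l + 1)" by (simp add: power2_eq_square algebra_simps)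
    also have "?t\<^sup>2 + ?t = real (Suc l) * (real (Suc l) + 1)" by (simp add: power2_eq_square algebra_simps)
    finally show ?thesis .
  qed
  then have "(\<Sum>l<N. 2 * (real l + 1) / (\<theta> + (real l + 1)\<^sup>2)\<^sup>2)
     \<le> (\<Sum>l<N. 1 / (\<theta> + real l * (real l + 1)) - 1 / (\<theta> + real (Suc l) * (real (Suc l) + 1)))"
    by (rule sum_mono)
  also have "\<dots> = 1 / \<theta> - 1 / (\<theta> + real N * (real N + 1))"
    by (subst sum_lessThan_telescope') simp
  also have "\<dots> \<le> 1 / \<theta>" using \<theta> by simp
  finally show ?thesis .
qed

text \<open>With
  \<open>\<theta> = \<eta> powr (- 1 / p)\<close> the product \<open>\<eta> d\<^sub>l\<^sup>2\<close> is at least a constant times the \<open>p\<close>-th power of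
  \<open>(l + 1)\<^sup>2 / \<theta>\<close>. Lowering this exponent to two reduces the sum to the telescoping one.\<close>

lemma effective_dimension_bound:
  fixes d :: "nat \<Rightarrow> real"
  assumes p: "p \<ge> 2" and \<eta>: "\<eta> > 0" and C1: "C1 > 0" and d: "\<And>l. C1 * (1 + real l) powr p \<le> \<bar>d l\<bar>"
  shows "(\<Sum>l<N. (2 * real l + 1) / (1 + \<eta> * (d l)\<^sup>2)) \<le> 4 / min 1 (C1\<^sup>2) * \<eta> powr (- 1 / p)"
proof -
  define \<theta> where "\<theta> = \<eta> powr (- 1 / p)"
  have \<theta>: "\<theta> > 0" using \<eta> by (simp add: \<theta>_def)
  define c where "c = min 1 (C1\<^sup>2)"
  have c: "0 < c" "c \<le> 1" "c \<le> C1\<^sup>2" using C1 by (auto simp: c_def)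
  have "(2 * real l + 1) / (1 + \<eta> * (d l)\<^sup>2) \<le> (4 * \<theta>\<^sup>2 / c) * (2 * (real l + 1) / (\<theta> + (real l + 1)\<^sup>2)\<^sup>2)" for l
  proof -
    let ?t = "real l + 1"
    let ?x = "?t\<^sup>2 / \<theta>"
    have x: "?x > 0" using \<theta> by simp
    have d2: "C1\<^sup>2 * (\<theta> * ?x) powr p \<le> (d l)\<^sup>2"
    proof -
      have "(C1 * (1 + real l) powr p)\<^sup>2 \<le> \<bar>d l\<bar>\<^sup>2" using d[of l] C1 by (intro power_mono) auto
      moreover have "((1 + real l) powr p)\<^sup>2 = ((1 + real l)\<^sup>2) powr p"
        by (simp add: power2_eq_square powr_mult)
      moreover have "\<theta> * ?x = (1 + real l)\<^sup>2" using \<theta> by (simp add: add.commute)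
      ultimately show ?thesis by (simp only: power_mult_distrib power2_abs)
    qed
    have "\<theta> powr p = \<eta> powr (- 1 / p * p)" by (simp only: \<theta>_def powr_powr)
    also have "\<dots> = 1 / \<eta>" using p \<eta> by (simp add: powr_minus_divide)
    finally have "\<theta> powr p = 1 / \<eta>" .
    then have eq: "\<eta> * (C1\<^sup>2 * (\<theta> * ?x) powr p) = C1\<^sup>2 * ?x powr p"
      using \<eta> by (subst powr_mult) simp
    have "C1\<^sup>2 * ?x powr p \<le> \<eta> * (d l)\<^sup>2"
      by (rule ord_eq_le_trans[OF eq[symmetric] mult_left_mono[OF d2 less_imp_le[OF \<eta>]]])
    moreover have "c * ?x powr p \<le> C1\<^sup>2 * ?x powr p" using c by (intro mult_right_mono) auto
    ultimately have lower: "c * (1 + ?x powr p) \<le> 1 + \<eta> * (d l)\<^sup>2" using c by (simp add: distrib_left)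
    \<comment> \<open>This is where \<open>p \<ge> 2\<close> enters.\<close>
    have "(1 + y)\<^sup>2 \<le> 4 * (1 + y powr p)" if y: "y > 0" for y :: real
    proof (cases "y \<le> 1")
      case True
      then have "(1 + y)\<^sup>2 \<le> 2\<^sup>2" using y by (intro power_mono) auto
      then show ?thesis by (rule order_trans) simp
    next
      case False
      then have "y powr 2 \<le> y powr p" using p by (intro powr_mono) auto
      moreover have "(1 + y)\<^sup>2 \<le> (2 * y)\<^sup>2" using False by (intro power_mono) auto
      ultimately show ?thesis using y by (simp add: power_mult_distrib)
    qed
    from this[OF x] have "c * (1 + ?x)\<^sup>2 / 4 \<le> c * (1 + ?x powr p)" using c by simp
    with lower have low: "c * (1 + ?x)\<^sup>2 / 4 \<le> 1 + \<eta> * (d l)\<^sup>2" by linarith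
    have "(2 * real l + 1) / (1 + \<eta> * (d l)\<^sup>2) \<le> (2 * ?t) / (c * (1 + ?x)\<^sup>2 / 4)"
      using low c x by (intro frac_le) auto
    also have "1 + ?x = (\<theta> + ?t\<^sup>2) / \<theta>" using \<theta> by (simp add: add_divide_distrib)
    also have "(2 * ?t) / (c * ((\<theta> + ?t\<^sup>2) / \<theta>)\<^sup>2 / 4) = (4 * \<theta>\<^sup>2 / c) * (2 * ?t / (\<theta> + ?t\<^sup>2)\<^sup>2)"
      using \<theta> c by (simp add: power_divide)
    finally show ?thesis .
  qed
  then have "(\<Sum>l<N. (2 * real l + 1) / (1 + \<eta> * (d l)\<^sup>2)) \<le> (4 * \<theta>\<^sup>2 / c) * (\<Sum>l<N. 2 * (real l + 1) / (\<theta> + (real l + 1)\<^sup>2)\<^sup>2)"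
    unfolding sum_distrib_left by (rule sum_mono)
  also have "\<dots> \<le> (4 * \<theta>\<^sup>2 / c) * (1 / \<theta>)"
    using \<theta> c by (intro mult_left_mono telescoping_sum_bound) auto
  also have "\<dots> = 4 / c * \<theta>" using \<theta> by (simp add: power2_eq_square)
  finally show ?thesis by (simp only: c_def \<theta>_def)
qed

section \<open>Deterministic error bound for the penalised fit\<close>

lemma (in harmonic_basis) energy_combination_le:
  assumes "f \<in> L2_S2" "g \<in> L2_S2"
  shows "energy (\<lambda>x. a * f x + b * g x) l \<le> 2 * a\<^sup>2 * energy f l + 2 * b\<^sup>2 * energy g l"
proof -
  have "energy (\<lambda>x. a * f x + b * g x) l = (\<Sum>m\<in>orders l. (a * inner_S2 f (Y l m) + b * inner_S2 g (Y l m))\<^sup>2)"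
    unfolding energy_def using assms
    by (intro sum.cong refl) (subst inner_S2_add, auto intro: L2_S2_cmult L2_Y simp: inner_S2_cmult)
  also have "\<dots> \<le> (\<Sum>m\<in>orders l. 2 * a\<^sup>2 * (inner_S2 f (Y l m))\<^sup>2 + 2 * b\<^sup>2 * (inner_S2 g (Y l m))\<^sup>2)"
  proof (rule sum_mono)
    fix m
    have "(s + t)\<^sup>2 \<le> 2 * s\<^sup>2 + 2 * t\<^sup>2" for s t :: real
      using sum_squares_bound[of s t] by (simp add: power2_sum)
    from this[of "a * inner_S2 f (Y l m)" "b * inner_S2 g (Y l m)"]
    show "(a * inner_S2 f (Y l m) + b * inner_S2 g (Y l m))\<^sup>2
      \<le> 2 * a\<^sup>2 * (inner_S2 f (Y l m))\<^sup>2 + 2 * b\<^sup>2 * (inner_S2 g (Y l m))\<^sup>2"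
      by (simp add: power_mult_distrib mult.assoc)
  qed
  finally show ?thesis by (simp add: energy_def sum.distrib sum_distrib_left)
qed

lemma (in harmonic_basis) sobolev_combination:
  assumes f: "f \<in> sobolev Y s" and g: "g \<in> sobolev Y s" and s: "s > 1"
  shows "(\<lambda>x. a * f x + b * g x) \<in> sobolev Y s"
proof (rule sobolevI)
  show "continuous_on S2 (\<lambda>x. a * f x + b * g x)"
    using f g s by (intro continuous_intros) (auto simp: sobolev_def)
  show "summable (\<lambda>l. sobolev_weight s l * energy (\<lambda>x. a * f x + b * g x) l)"
  proof (rule summable_comparison_test')
    show "summable (\<lambda>l. 2 * a\<^sup>2 * (sobolev_weight s l * energy f l) + 2 * b\<^sup>2 * (sobolev_weight s l * energy g l))"
      using f g by (intro summable_add summable_mult sobolev_summable)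
    fix l
    have "sobolev_weight s l * energy (\<lambda>x. a * f x + b * g x) l
      \<le> sobolev_weight s l * (2 * a\<^sup>2 * energy f l + 2 * b\<^sup>2 * energy g l)"
      using f g sobolev_weight_pos[of s l] by (intro mult_left_mono energy_combination_le) (auto intro: sobolev_L2)
    then show "norm (sobolev_weight s l * energy (\<lambda>x. a * f x + b * g x) l)
      \<le> 2 * a\<^sup>2 * (sobolev_weight s l * energy f l) + 2 * b\<^sup>2 * (sobolev_weight s l * energy g l)"
      using sobolev_weight_pos[of s l] energy_ge_0 by (simp add: algebra_simps abs_mult)
  qed
qed

lemma (in harmonic_basis) sobolev_zero: "(\<lambda>_. 0) \<in> sobolev Y s"
  by (rule sobolevI) (auto simp: energy_def inner_S2_def)

text \<open>The pairs of degree and order below the truncation level \<open>L\<close>. All estimates are made for finite sums over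
  these sets, uniformly in \<open>L\<close>.\<close>

definition indices :: "nat \<Rightarrow> (nat \<times> int) set" where
  "indices L = (SIGMA l:{..<L}. orders l)"

lemma finite_indices: "finite (indices L)"
  by (simp add: indices_def)

lemma sum_indices: "(\<Sum>a\<in>indices L. F (fst a) (snd a)) = (\<Sum>l<L. \<Sum>m\<in>orders l. F l m)"
  unfolding indices_def by (subst sum.Sigma) (auto simp: split_def)

text \<open>The factor of the squared residual of observation \<open>k = (i, j)\<close> in the objective.\<close>

definition obs_weight :: "nat \<Rightarrow> (nat \<Rightarrow> nat) \<Rightarrow> nat \<times> nat \<Rightarrow> real" where
  "obs_weight n r k = 4 * pi / (real n * real (r (fst k)))"

lemma obs_weight_ge_0: "0 \<le> obs_weight n r k"
  by (simp add: obs_weight_def)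

lemma finite_obs_index: "finite (obs_index n r)"
  by (simp add: obs_index_def)

lemma sum_obs_index:
  "(\<Sum>k\<in>obs_index n r. obs_weight n r k * F (fst k) (snd k))
     = 4 * pi / real n * (\<Sum>i=1..n. 1 / real (r i) * (\<Sum>j=1..r i. F i j))"
proof -
  have "(\<Sum>k\<in>obs_index n r. obs_weight n r k * F (fst k) (snd k))
      = (\<Sum>i=1..n. \<Sum>j=1..r i. obs_weight n r (i, j) * F i j)"
    unfolding obs_index_def by (subst sum.Sigma) (auto simp: split_def)
  then show ?thesis
    by (simp add: obs_weight_def sum_distrib_left field_simps)
qed

locale smoothing_operator = harmonic_basis +
  fixes p C1 C2 :: real and d :: "nat \<Rightarrow> real" and \<D> :: "(real^3 \<Rightarrow> real) \<Rightarrow> real^3 \<Rightarrow> real"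
  assumes p: "p > 2" and C1: "C1 > 0" and C2: "C2 > 0"
    and d_lower: "\<And>l. C1 * (1 + real l) powr p \<le> \<bar>d l\<bar>"
    and d_upper: "\<And>l. \<bar>d l\<bar> \<le> C2 * (1 + real l) powr p"
    and \<D>_L2: "\<And>f. f \<in> sobolev Y p \<Longrightarrow> \<D> f \<in> L2_S2"
    and \<D>_lim: "\<And>f. f \<in> sobolev Y p \<Longrightarrow>
        (\<lambda>N. norm_S2 (\<lambda>x. \<D> f x - (\<Sum>l<N. d l * degree_part Y f l x))) \<longlonglongrightarrow> 0"
begin

lemma d_square_upper: "(d l)\<^sup>2 \<le> C2\<^sup>2 * 2 powr p * sobolev_weight p l"
proof -
  have "\<bar>d l\<bar>\<^sup>2 \<le> (C2 * (1 + real l) powr p)\<^sup>2" using d_upper[of l] by (intro power_mono) auto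
  also have "\<dots> = C2\<^sup>2 * (1 + real l) powr (2 * p)"
    by (simp add: power_mult_distrib) (simp add: power2_eq_square powr_add[symmetric])
  also have "\<dots> \<le> C2\<^sup>2 * (2 powr p * sobolev_weight p l)"
    using le_sobolev_weight[of p l] p by (intro mult_left_mono) auto
  finally show ?thesis by (simp add: mult.assoc)
qed

lemma d_square_lower: "C1\<^sup>2 * sobolev_weight p l \<le> (d l)\<^sup>2"
proof -
  have "C1\<^sup>2 * sobolev_weight p l \<le> C1\<^sup>2 * (1 + real l) powr (2 * p)"
    using sobolev_weight_le[of p l] p by (intro mult_left_mono) auto
  also have "\<dots> = (C1 * (1 + real l) powr p)\<^sup>2"
    by (simp add: power_mult_distrib) (simp add: power2_eq_square powr_add[symmetric])
  also have "\<dots> \<le> \<bar>d l\<bar>\<^sup>2" using d_lower[of l] C1 by (intro power_mono) auto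
  finally show ?thesis by simp
qed

lemma d_square_pos: "(d l)\<^sup>2 > 0"
  using d_square_lower[of l] C1 sobolev_weight_pos[of p l]
  by (intro less_le_trans[OF _ d_square_lower]) auto

lemma norm_\<D>_sums: "f \<in> sobolev Y p \<Longrightarrow> (\<lambda>l. (d l)\<^sup>2 * energy f l) sums (norm_S2 (\<D> f))\<^sup>2"
  by (intro parseval_multiplier \<D>_L2 \<D>_lim)

lemma norm_\<D>_le:
  assumes f: "f \<in> sobolev Y p"
  shows "(norm_S2 (\<D> f))\<^sup>2 \<le> C2\<^sup>2 * 2 powr p * (sobolev_norm Y p f)\<^sup>2"
proof -
  have "(norm_S2 (\<D> f))\<^sup>2 = (\<Sum>l. (d l)\<^sup>2 * energy f l)" using norm_\<D>_sums[OF f] by (rule sums_unique)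
  also have "\<dots> \<le> (\<Sum>l. C2\<^sup>2 * 2 powr p * (sobolev_weight p l * energy f l))"
  proof (intro suminf_le summable_mult sobolev_summable[OF f] sums_summable[OF norm_\<D>_sums[OF f]])
    show "(d l)\<^sup>2 * energy f l \<le> C2\<^sup>2 * 2 powr p * (sobolev_weight p l * energy f l)" for l
      using mult_right_mono[OF d_square_upper energy_ge_0] by (simp add: mult.assoc)
  qed
  also have "\<dots> = C2\<^sup>2 * 2 powr p * (\<Sum>l. sobolev_weight p l * energy f l)"
    by (rule suminf_mult[OF sobolev_summable[OF f]])
  finally show ?thesis by (simp only: sobolev_norm_square[OF f])
qed

definition penalty_form :: "(real^3 \<Rightarrow> real) \<Rightarrow> (real^3 \<Rightarrow> real) \<Rightarrow> real" where
  "penalty_form f g = (\<Sum>l. (d l)\<^sup>2 * (\<Sum>m\<in>orders l. inner_S2 f (Y l m) * inner_S2 g (Y l m)))"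

lemma penalty_form_summable:
  assumes f: "f \<in> sobolev Y p" and g: "g \<in> sobolev Y p"
  shows "summable (\<lambda>l. (d l)\<^sup>2 * (\<Sum>m\<in>orders l. inner_S2 f (Y l m) * inner_S2 g (Y l m)))"
proof (rule summable_comparison_test')
  show "summable (\<lambda>l. (d l)\<^sup>2 * energy f l + (d l)\<^sup>2 * energy g l)"
    using f g norm_\<D>_sums by (intro summable_add sums_summable)
  fix l
  have "\<bar>\<Sum>m\<in>orders l. inner_S2 f (Y l m) * inner_S2 g (Y l m)\<bar> \<le> (\<Sum>m\<in>orders l. (inner_S2 f (Y l m))\<^sup>2 + (inner_S2 g (Y l m))\<^sup>2)"
    by (rule order_trans[OF sum_abs sum_mono], rule abs_mult_le_sum_squares)
  then have "(d l)\<^sup>2 * \<bar>\<Sum>m\<in>orders l. inner_S2 f (Y l m) * inner_S2 g (Y l m)\<bar> \<le> (d l)\<^sup>2 * (energy f l + energy g l)"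
    unfolding energy_def sum.distrib by (rule mult_left_mono) simp
  then show "norm ((d l)\<^sup>2 * (\<Sum>m\<in>orders l. inner_S2 f (Y l m) * inner_S2 g (Y l m))) \<le> (d l)\<^sup>2 * energy f l + (d l)\<^sup>2 * energy g l"
    by (simp add: abs_mult distrib_left)
qed

lemma penalty_form_commute: "penalty_form f g = penalty_form g f"
  by (simp add: penalty_form_def mult.commute)

lemma penalty_form_self: "f \<in> sobolev Y p \<Longrightarrow> penalty_form f f = (norm_S2 (\<D> f))\<^sup>2"
  using norm_\<D>_sums[THEN sums_unique] by (simp add: penalty_form_def energy_def power2_eq_square)

lemma penalty_form_combination:
  assumes f: "f \<in> sobolev Y p" and g: "g \<in> sobolev Y p" and h: "h \<in> sobolev Y p"
  shows "penalty_form (\<lambda>x. a * f x + b * g x) h = a * penalty_form f h + b * penalty_form g h"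
proof -
  have "(\<Sum>m\<in>orders l. inner_S2 (\<lambda>x. a * f x + b * g x) (Y l m) * inner_S2 h (Y l m))
      = a * (\<Sum>m\<in>orders l. inner_S2 f (Y l m) * inner_S2 h (Y l m)) + b * (\<Sum>m\<in>orders l. inner_S2 g (Y l m) * inner_S2 h (Y l m))" for l
    unfolding sum_distrib_left sum.distrib[symmetric]
  proof (rule sum.cong[OF refl])
    fix m assume "m \<in> orders l"
    then have "inner_S2 (\<lambda>x. a * f x + b * g x) (Y l m) = a * inner_S2 f (Y l m) + b * inner_S2 g (Y l m)"
      using f g by (subst inner_S2_add) (auto intro: L2_S2_cmult L2_Y sobolev_L2 simp: inner_S2_cmult)
    then show "inner_S2 (\<lambda>x. a * f x + b * g x) (Y l m) * inner_S2 h (Y l m)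
      = a * (inner_S2 f (Y l m) * inner_S2 h (Y l m)) + b * (inner_S2 g (Y l m) * inner_S2 h (Y l m))"
      by (simp add: algebra_simps)
  qed
  then have "penalty_form (\<lambda>x. a * f x + b * g x) h =
     (\<Sum>l. a * ((d l)\<^sup>2 * (\<Sum>m\<in>orders l. inner_S2 f (Y l m) * inner_S2 h (Y l m)))
         + b * ((d l)\<^sup>2 * (\<Sum>m\<in>orders l. inner_S2 g (Y l m) * inner_S2 h (Y l m))))"
    by (simp add: penalty_form_def algebra_simps)
  also have "\<dots> = a * penalty_form f h + b * penalty_form g h"
    unfolding penalty_form_def using penalty_form_summable[OF f h] penalty_form_summable[OF g h]
    by (simp add: suminf_add[symmetric] suminf_mult summable_mult)
  finally show ?thesis .
qed

text \<open>The reproducing kernel of the penalty has coefficients \<open>Y l m v / (\<eta> d\<^sub>l\<^sup>2)\<close>; they decay fast enough for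
  the kernel to lie in the Sobolev space itself.\<close>

lemma penalty_kernel:
  assumes \<eta>: "\<eta> > 0" and v: "v \<in> S2"
  shows "\<exists>k\<in>sobolev Y p. \<forall>h\<in>sobolev Y p. \<eta> * penalty_form k h = h v"
proof -
  define c where "c l m = Y l m v / (\<eta> * (d l)\<^sup>2)" for l m
  have c2: "(\<Sum>m\<in>orders l. (c l m)\<^sup>2) = (2 * real l + 1) / (4 * pi) / (\<eta> * (d l)\<^sup>2)\<^sup>2" for l
    by (simp add: c_def power_divide sum_divide_distrib[symmetric] addition_theorem[OF v])
  have sm: "summable (\<lambda>l. sobolev_weight p l * (\<Sum>m\<in>orders l. (c l m)\<^sup>2))"
  proof (rule summable_comparison_test')
    show "summable (\<lambda>l. (1 / (4 * pi * \<eta>\<^sup>2 * (C1\<^sup>2)\<^sup>2)) * ((2 * real l + 1) / sobolev_weight p l))"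
      using p by (intro summable_mult summable_dim_over_weight) auto
    fix l
    let ?w = "sobolev_weight p l"
    have w: "?w > 0" by (rule sobolev_weight_pos)
    have "(C1\<^sup>2 * ?w)\<^sup>2 \<le> ((d l)\<^sup>2)\<^sup>2" using d_square_lower[of l] w by (intro power_mono) auto
    then have "?w * ((2 * real l + 1) / (4 * pi) / (\<eta>\<^sup>2 * ((d l)\<^sup>2)\<^sup>2)) \<le> ?w * ((2 * real l + 1) / (4 * pi) / (\<eta>\<^sup>2 * (C1\<^sup>2 * ?w)\<^sup>2))"
      using w C1 \<eta> d_square_pos[of l]
      by (intro mult_left_mono divide_left_mono mult_pos_pos) (auto intro!: divide_nonneg_pos)
    also have "\<dots> = (1 / (4 * pi * \<eta>\<^sup>2 * (C1\<^sup>2)\<^sup>2)) * ((2 * real l + 1) / ?w)"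
      using w by (simp add: power_mult_distrib power2_eq_square[of ?w])
    finally show "norm (?w * (\<Sum>m\<in>orders l. (c l m)\<^sup>2)) \<le> (1 / (4 * pi * \<eta>\<^sup>2 * (C1\<^sup>2)\<^sup>2)) * ((2 * real l + 1) / ?w)"
      using w by (simp only: c2 power_mult_distrib real_norm_def abs_of_nonneg) simp
  qed
  have smb: "summable (sup_bound c)" using p sm by (intro summable_sup_bound[of p]) auto
  define k where "k x = (\<Sum>l. \<Sum>m\<in>orders l. c l m * Y l m x)" for x
  note k = synthesis_limit[OF smb, folded k_def]
  have ck: "continuous_on S2 k" using k(1) by (simp add: k_def[abs_def])
  have ik: "inner_S2 k (Y l m) = c l m" if "m \<in> orders l" for l m
    using k(3)[OF that] by (simp add: k_def[abs_def])
  have "energy k l = (\<Sum>m\<in>orders l. (c l m)\<^sup>2)" for l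
    unfolding energy_def by (intro sum.cong refl) (simp add: ik)
  then have kH: "k \<in> sobolev Y p" using sm by (intro sobolevI ck) simp
  have "\<eta> * penalty_form k h = h v" if h: "h \<in> sobolev Y p" for h
  proof -
    have "(d l)\<^sup>2 * (\<Sum>m\<in>orders l. inner_S2 k (Y l m) * inner_S2 h (Y l m)) = (1 / \<eta>) * degree_part Y h l v" for l
      unfolding degree_part_def sum_distrib_left
      by (intro sum.cong refl) (use d_square_pos[of l] in \<open>simp add: ik c_def\<close>)
    then have "penalty_form k h = (\<Sum>l. (1 / \<eta>) * degree_part Y h l v)" by (simp add: penalty_form_def)
    also have "\<dots> = (1 / \<eta>) * h v"
      using sobolev_sums[OF h _ v] p by (intro sums_unique[symmetric] sums_mult) auto
    finally show ?thesis using \<eta> by simp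
  qed
  with kH show ?thesis by blast
qed

lemma mean_objective_obs:
  "mean_objective \<D> n r \<eta> W U g =
     (\<Sum>k\<in>obs_index n r. obs_weight n r k * (W (fst k) (snd k) - g (U (fst k) (snd k)))\<^sup>2) + \<eta> * (norm_S2 (\<D> g))\<^sup>2"
  by (simp add: mean_objective_def sum_obs_index[where F = "\<lambda>i j. (W i j - g (U i j))\<^sup>2"])

text \<open>The estimator is defined as some minimiser, a phrase that has content only if one exists.\<close>

lemma mean_objective_minimizer:
  assumes \<eta>: "\<eta> > 0" and U: "\<And>k. k \<in> obs_index n r \<Longrightarrow> U (fst k) (snd k) \<in> S2"
  shows "is_arg_min (mean_objective \<D> n r \<eta> W U) (\<lambda>g. g \<in> sobolev Y p)
    (arg_min_on (mean_objective \<D> n r \<eta> W U) (sobolev Y p))"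
proof -
  have "\<exists>g\<in>sobolev Y p. \<forall>h\<in>sobolev Y p.
    (\<Sum>k\<in>obs_index n r. obs_weight n r k * (W (fst k) (snd k) - g (U (fst k) (snd k)))\<^sup>2) + \<eta> * penalty_form g g
    \<le> (\<Sum>k\<in>obs_index n r. obs_weight n r k * (W (fst k) (snd k) - h (U (fst k) (snd k)))\<^sup>2) + \<eta> * penalty_form h h"
  proof (rule reproducing_kernel_minimizer[where B = "\<lambda>f g. \<eta> * penalty_form f g" and V = S2
        and w = "obs_weight n r" and y = "\<lambda>k. W (fst k) (snd k)" and u = "\<lambda>k. U (fst k) (snd k)"])
    show "0 \<le> \<eta> * penalty_form f f" if "f \<in> sobolev Y p" for f
      using that \<eta> by (simp add: penalty_form_self)
    show "\<eta> * penalty_form f g = \<eta> * penalty_form g f" for f g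
      by (simp add: penalty_form_commute)
  qed (use p \<eta> U in \<open>auto simp: sobolev_zero sobolev_combination penalty_form_combination distrib_left
        penalty_kernel finite_obs_index obs_weight_ge_0\<close>)
  then have "\<exists>g. is_arg_min (mean_objective \<D> n r \<eta> W U) (\<lambda>g. g \<in> sobolev Y p) g"
    by (auto simp: is_arg_min_def mean_objective_obs penalty_form_self not_less)
  then show ?thesis unfolding arg_min_on_def arg_min_def by (rule someI_ex)
qed

abbreviation basis_fun :: "nat \<times> int \<Rightarrow> real^3 \<Rightarrow> real" where
  "basis_fun a \<equiv> Y (fst a) (snd a)"

text \<open>The entry of the diagonal norm \<open>|\<cdot>|\<^sub>\<eta>\<close> at the basis function \<open>a\<close>.\<close>

definition shrinkage :: "real \<Rightarrow> nat \<times> int \<Rightarrow> real" where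
  "shrinkage \<eta> a = 1 + \<eta> * (d (fst a))\<^sup>2"

lemma shrinkage_ge_1: "\<eta> \<ge> 0 \<Longrightarrow> 1 \<le> shrinkage \<eta> a"
  by (simp add: shrinkage_def)

definition score :: "'k set \<Rightarrow> ('k \<Rightarrow> real) \<Rightarrow> ('k \<Rightarrow> real) \<Rightarrow> ('k \<Rightarrow> real^3) \<Rightarrow> nat \<times> int \<Rightarrow> real" where
  "score I w Z U a = (\<Sum>k\<in>I. w k * Z k * basis_fun a (U k))"

definition score_energy where
  "score_energy \<eta> I w Z U L = (\<Sum>a\<in>indices L. (score I w Z U a)\<^sup>2 / shrinkage \<eta> a)"

definition gram_error :: "'k set \<Rightarrow> ('k \<Rightarrow> real) \<Rightarrow> ('k \<Rightarrow> real^3) \<Rightarrow> nat \<times> int \<Rightarrow> nat \<times> int \<Rightarrow> real" where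
  "gram_error I w U a b = (\<Sum>k\<in>I. w k * basis_fun a (U k) * basis_fun b (U k)) - (if a = b then 1 else 0)"

definition gram_energy where
  "gram_energy \<eta> I w U L = (\<Sum>a\<in>indices L. \<Sum>b\<in>indices L.
      (gram_error I w U a b)\<^sup>2 / (shrinkage \<eta> a * shrinkage \<eta> b))"

text \<open>The square of the norm \<open>|\<cdot>|\<^sub>\<eta>\<close>.\<close>

definition smooth_norm2 :: "real \<Rightarrow> (real^3 \<Rightarrow> real) \<Rightarrow> real" where
  "smooth_norm2 \<eta> f = inner_S2 f f + \<eta> * (norm_S2 (\<D> f))\<^sup>2"

lemma smooth_norm2_sums:
  assumes f: "f \<in> sobolev Y p"
  shows "(\<lambda>l. (1 + \<eta> * (d l)\<^sup>2) * energy f l) sums smooth_norm2 \<eta> f"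
  using sums_add[OF parseval[OF sobolev_L2[OF f]] sums_mult[OF norm_\<D>_sums[OF f], of \<eta>]]
  by (simp add: smooth_norm2_def algebra_simps)

lemma truncated_smooth_norm2_le:
  assumes f: "f \<in> sobolev Y p" and \<eta>: "\<eta> \<ge> 0"
  shows "(\<Sum>a\<in>indices L. shrinkage \<eta> a * (inner_S2 f (basis_fun a))\<^sup>2) \<le> smooth_norm2 \<eta> f"
proof -
  have "(\<Sum>a\<in>indices L. shrinkage \<eta> a * (inner_S2 f (basis_fun a))\<^sup>2) = (\<Sum>l<L. (1 + \<eta> * (d l)\<^sup>2) * energy f l)"
    unfolding shrinkage_def
    by (subst sum_indices[where F = "\<lambda>l m. (1 + \<eta> * (d l)\<^sup>2) * (inner_S2 f (Y l m))\<^sup>2"])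
      (simp add: energy_def sum_distrib_left)
  also have "\<dots> \<le> smooth_norm2 \<eta> f"
    using \<eta> energy_ge_0 sums_unique[OF smooth_norm2_sums[OF f, of \<eta>]]
    by (simp add: sum_le_suminf[OF sums_summable[OF smooth_norm2_sums[OF f]]])
  finally show ?thesis .
qed

definition truncation :: "(real^3 \<Rightarrow> real) \<Rightarrow> nat \<Rightarrow> real^3 \<Rightarrow> real" where
  "truncation f L x = (\<Sum>a\<in>indices L. inner_S2 f (basis_fun a) * basis_fun a x)"

lemma truncation_tendsto:
  assumes "f \<in> sobolev Y p" "x \<in> S2"
  shows "(\<lambda>L. truncation f L x) \<longlonglongrightarrow> f x"
  using sobolev_sums[OF assms(1) _ assms(2)] p
  by (simp add: sums_def truncation_def sum_indices[where F = "\<lambda>l m. inner_S2 f (Y l m) * Y l m x" for f x] degree_part_def)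

text \<open>For truncations of \<open>f\<close> this is Cauchy--Schwarz with weights given by the shrinkage factors; the limit
  is taken pointwise at the finitely many points \<open>U k\<close>.\<close>

lemma score_inner_le:
  assumes f: "f \<in> sobolev Y p" and \<eta>: "\<eta> \<ge> 0" and U: "\<And>k. k \<in> I \<Longrightarrow> U k \<in> S2"
    and S: "\<And>L. score_energy \<eta> I w Z U L \<le> S"
  shows "(\<Sum>k\<in>I. w k * Z k * f (U k))\<^sup>2 \<le> S * smooth_norm2 \<eta> f"
proof (rule LIMSEQ_le_const2)
  show "(\<lambda>L. (\<Sum>k\<in>I. w k * Z k * truncation f L (U k))\<^sup>2) \<longlonglongrightarrow> (\<Sum>k\<in>I. w k * Z k * f (U k))\<^sup>2"
    using U by (intro tendsto_intros truncation_tendsto f)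
  show "\<exists>N. \<forall>L\<ge>N. (\<Sum>k\<in>I. w k * Z k * truncation f L (U k))\<^sup>2 \<le> S * smooth_norm2 \<eta> f"
  proof (intro exI allI impI)
    fix L
    have pos: "shrinkage \<eta> a > 0" for a using shrinkage_ge_1[OF \<eta>, of a] by linarith
    have "(\<Sum>k\<in>I. w k * Z k * truncation f L (U k)) = (\<Sum>a\<in>indices L. inner_S2 f (basis_fun a) * score I w Z U a)"
      unfolding truncation_def score_def sum_distrib_left by (subst sum.swap) (simp add: algebra_simps)
    also have "\<dots> = (\<Sum>a\<in>indices L. (score I w Z U a / sqrt (shrinkage \<eta> a)) * (sqrt (shrinkage \<eta> a) * inner_S2 f (basis_fun a)))"
      using pos by (intro sum.cong refl) (simp add: less_imp_neq[symmetric])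
    finally have "(\<Sum>k\<in>I. w k * Z k * truncation f L (U k))\<^sup>2
       \<le> (\<Sum>a\<in>indices L. (score I w Z U a / sqrt (shrinkage \<eta> a))\<^sup>2) * (\<Sum>a\<in>indices L. (sqrt (shrinkage \<eta> a) * inner_S2 f (basis_fun a))\<^sup>2)"
      by (simp only: Cauchy_Schwarz_ineq_sum)
    also have "\<dots> = score_energy \<eta> I w Z U L * (\<Sum>a\<in>indices L. shrinkage \<eta> a * (inner_S2 f (basis_fun a))\<^sup>2)"
      using pos by (simp add: score_energy_def power_divide power_mult_distrib less_imp_le)
    also have "\<dots> \<le> S * smooth_norm2 \<eta> f"
    proof (rule mult_mono[OF S truncated_smooth_norm2_le[OF f \<eta>]])
      have "0 \<le> score_energy \<eta> I w Z U L" unfolding score_energy_def using pos by (intro sum_nonneg divide_nonneg_pos) auto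
      then show "0 \<le> S" using S[of L] by linarith
      show "0 \<le> (\<Sum>a\<in>indices L. shrinkage \<eta> a * (inner_S2 f (basis_fun a))\<^sup>2)"
        using pos by (intro sum_nonneg mult_nonneg_nonneg) (auto intro: less_imp_le)
    qed
    finally show "(\<Sum>k\<in>I. w k * Z k * truncation f L (U k))\<^sup>2 \<le> S * smooth_norm2 \<eta> f" .
  qed
qed

text \<open>For truncations of \<open>f\<close> the difference between the empirical and the exact quadratic form is a double sum
  of coefficients against the Gram errors, to which Cauchy--Schwarz over pairs of indices applies. The
  bound \<open>1 / 16\<close> on the squared Hilbert--Schmidt norm becomes the factor \<open>1 / 4\<close>.\<close>

lemma gram_quadratic_ge:
  assumes f: "f \<in> sobolev Y p" and \<eta>: "\<eta> \<ge> 0" and U: "\<And>k. k \<in> I \<Longrightarrow> U k \<in> S2"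
    and G: "\<And>L. gram_energy \<eta> I w U L \<le> 1 / 16"
  shows "inner_S2 f f - smooth_norm2 \<eta> f / 4 \<le> (\<Sum>k\<in>I. w k * (f (U k))\<^sup>2)"
proof -
  let ?T = "\<lambda>L. (\<Sum>k\<in>I. w k * (truncation f L (U k))\<^sup>2) - (\<Sum>l<L. energy f l)"
  have pos: "shrinkage \<eta> a > 0" for a using shrinkage_ge_1[OF \<eta>, of a] by linarith
  have N0: "0 \<le> smooth_norm2 \<eta> f"
    using \<eta> by (simp add: smooth_norm2_def inner_S2_ge_0)
  have "- (smooth_norm2 \<eta> f / 4) \<le> ?T L" for L
  proof -
    let ?c = "\<lambda>a. inner_S2 f (basis_fun a)" and ?J = "indices L \<times> indices L"
    let ?v = "\<lambda>a. sqrt (shrinkage \<eta> (fst a) * shrinkage \<eta> (snd a))"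
    let ?g = "\<lambda>a. gram_error I w U (fst a) (snd a)"
    let ?K = "\<lambda>k a b. ?c a * ?c b * (w k * basis_fun a (U k) * basis_fun b (U k))"
    have "?T L = (\<Sum>a\<in>indices L. \<Sum>b\<in>indices L. ?c a * ?c b * gram_error I w U a b)"
    proof -
      have 1: "(\<Sum>k\<in>I. w k * (truncation f L (U k))\<^sup>2)
          = (\<Sum>a\<in>indices L. \<Sum>b\<in>indices L. ?c a * ?c b * (\<Sum>k\<in>I. w k * basis_fun a (U k) * basis_fun b (U k)))"
      proof -
        have "(\<Sum>k\<in>I. w k * (truncation f L (U k))\<^sup>2)
          = (\<Sum>k\<in>I. \<Sum>a\<in>indices L. \<Sum>b\<in>indices L. ?K k a b)"
          unfolding truncation_def power2_eq_square sum_product by (simp add: sum_distrib_left algebra_simps)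
        also have "\<dots> = (\<Sum>a\<in>indices L. \<Sum>k\<in>I. \<Sum>b\<in>indices L. ?K k a b)"
          by (rule sum.swap)
        also have "\<dots> = (\<Sum>a\<in>indices L. \<Sum>b\<in>indices L. \<Sum>k\<in>I. ?K k a b)"
          by (intro sum.cong refl sum.swap)
        finally show ?thesis by (simp only: sum_distrib_left)
      qed
      have "(\<Sum>l<L. energy f l) = (\<Sum>a\<in>indices L. (?c a)\<^sup>2)"
        by (subst sum_indices[where F = "\<lambda>l m. (inner_S2 f (Y l m))\<^sup>2"]) (simp add: energy_def)
      also have "\<dots> = (\<Sum>a\<in>indices L. \<Sum>b\<in>indices L. if a = b then ?c a * ?c b else 0)"
        by (intro sum.cong refl) (simp add: finite_indices power2_eq_square)
      also have "\<dots> = (\<Sum>a\<in>indices L. \<Sum>b\<in>indices L. ?c a * ?c b * (if a = b then 1 else 0))"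
        by (intro sum.cong refl) auto
      finally show ?thesis by (simp only: 1 gram_error_def right_diff_distrib sum_subtractf)
    qed
    also have "\<dots> = (\<Sum>a\<in>?J. ?c (fst a) * ?c (snd a) * ?g a)"
      by (simp add: sum.cartesian_product split_def)
    also have "\<dots> = (\<Sum>a\<in>?J. (?v a * (?c (fst a) * ?c (snd a)))
        * (?g a / ?v a))"
      using pos by (intro sum.cong refl) (simp add: less_imp_neq[symmetric])
    finally have "(?T L)\<^sup>2 \<le> (\<Sum>a\<in>?J. (?v a * (?c (fst a) * ?c (snd a)))\<^sup>2)
       * (\<Sum>a\<in>?J. (?g a / ?v a)\<^sup>2)"
      by (simp only: Cauchy_Schwarz_ineq_sum)
    also have "(\<Sum>a\<in>?J. (?v a * (?c (fst a) * ?c (snd a)))\<^sup>2)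
        = (\<Sum>a\<in>indices L. shrinkage \<eta> a * (?c a)\<^sup>2)\<^sup>2"
    proof -
      have "(sqrt (shrinkage \<eta> a * shrinkage \<eta> b) * (?c a * ?c b))\<^sup>2 = (shrinkage \<eta> a * (?c a)\<^sup>2) * (shrinkage \<eta> b * (?c b)\<^sup>2)" for a b
        using pos[of a] pos[of b] by (simp add: power_mult_distrib less_imp_le)
      then show ?thesis
        by (simp only: power2_eq_square[of "sum _ _"] sum_product sum.cartesian_product split_def)
    qed
    also have "(\<Sum>a\<in>?J. (?g a / ?v a)\<^sup>2)
        = gram_energy \<eta> I w U L"
    proof -
      have "(gram_error I w U a b / sqrt (shrinkage \<eta> a * shrinkage \<eta> b))\<^sup>2 = (gram_error I w U a b)\<^sup>2 / (shrinkage \<eta> a * shrinkage \<eta> b)" for a b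
        using pos[of a] pos[of b] by (simp add: power_divide less_imp_le)
      then show ?thesis
        by (simp only: gram_energy_def sum.cartesian_product split_def)
    qed
    also have "(\<Sum>a\<in>indices L. shrinkage \<eta> a * (?c a)\<^sup>2)\<^sup>2 * gram_energy \<eta> I w U L \<le> (smooth_norm2 \<eta> f)\<^sup>2 * (1 / 16)"
    proof (rule mult_mono[OF _ G])
      show "(\<Sum>a\<in>indices L. shrinkage \<eta> a * (?c a)\<^sup>2)\<^sup>2 \<le> (smooth_norm2 \<eta> f)\<^sup>2"
        using pos by (intro power_mono truncated_smooth_norm2_le[OF f \<eta>] sum_nonneg mult_nonneg_nonneg) (auto intro: less_imp_le)
      show "0 \<le> gram_energy \<eta> I w U L"
        unfolding gram_energy_def using pos by (intro sum_nonneg divide_nonneg_pos mult_pos_pos) auto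
    qed simp
    also have "\<dots> = (smooth_norm2 \<eta> f / 4)\<^sup>2" by (simp add: power_divide)
    finally have "\<bar>?T L\<bar> \<le> smooth_norm2 \<eta> f / 4"
      using N0 by (simp add: abs_le_square_iff[symmetric])
    then show ?thesis by linarith
  qed
  moreover have "?T \<longlonglongrightarrow> (\<Sum>k\<in>I. w k * (f (U k))\<^sup>2) - inner_S2 f f"
    using U parseval[OF sobolev_L2[OF f]] by (intro tendsto_intros truncation_tendsto f) (auto simp: sums_def)
  ultimately have "- (smooth_norm2 \<eta> f / 4) \<le> (\<Sum>k\<in>I. w k * (f (U k))\<^sup>2) - inner_S2 f f"
    by (intro LIMSEQ_le_const) auto
  then show ?thesis by linarith
qed

text \<open>With \<open>A = |h|\<^sub>\<eta>\<^sup>2\<close> and \<open>T\<close> the linear term, optimality, \<open>|D h|\<^sup>2 \<le> 2 |D g|\<^sup>2 + 2 |D \<mu>|\<^sup>2\<close> and coercivity give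
  \<open>A / 4 \<le> 2 T + 2 \<eta> |D \<mu>|\<^sup>2\<close>, and \<open>T\<^sup>2 \<le> S A\<close> gives \<open>2 T \<le> A / 8 + 8 S\<close>.\<close>

lemma penalized_fit_error:
  fixes I :: "'k set"
  assumes g: "g \<in> sobolev Y p" and \<mu>: "\<mu> \<in> sobolev Y p" and \<eta>: "\<eta> > 0" and U: "\<And>k. k \<in> I \<Longrightarrow> U k \<in> S2"
    and opt: "(\<Sum>k\<in>I. w k * (W k - g (U k))\<^sup>2) + \<eta> * (norm_S2 (\<D> g))\<^sup>2
       \<le> (\<Sum>k\<in>I. w k * (W k - \<mu> (U k))\<^sup>2) + \<eta> * (norm_S2 (\<D> \<mu>))\<^sup>2"
    and S: "\<And>L. score_energy \<eta> I w (\<lambda>k. W k - \<mu> (U k)) U L \<le> S"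
    and G: "\<And>L. gram_energy \<eta> I w U L \<le> 1 / 16"
  shows "(norm_S2 (\<lambda>x. g x - \<mu> x))\<^sup>2 \<le> 64 * S + 16 * \<eta> * (norm_S2 (\<D> \<mu>))\<^sup>2"
proof -
  define h where "h x = g x - \<mu> x" for x
  have h: "h \<in> sobolev Y p"
    using sobolev_combination[OF g \<mu>, of 1 "-1"] p by (simp add: h_def[abs_def])
  define A where "A = smooth_norm2 \<eta> h"
  define T where "T = (\<Sum>k\<in>I. w k * (W k - \<mu> (U k)) * h (U k))"
  define a where "a = (norm_S2 (\<D> \<mu>))\<^sup>2"
  have "(\<Sum>k\<in>I. w k * (W k - g (U k))\<^sup>2) = (\<Sum>k\<in>I. w k * (W k - \<mu> (U k))\<^sup>2) - 2 * T + (\<Sum>k\<in>I. w k * (h (U k))\<^sup>2)"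
    unfolding T_def sum_distrib_left sum_subtractf[symmetric] sum.distrib[symmetric]
    by (intro sum.cong refl) (simp add: h_def power2_eq_square algebra_simps)
  with opt have basic: "(\<Sum>k\<in>I. w k * (h (U k))\<^sup>2) + \<eta> * (norm_S2 (\<D> g))\<^sup>2 \<le> 2 * T + \<eta> * a"
    by (simp add: a_def)
  have "(norm_S2 (\<D> h))\<^sup>2 \<le> 2 * (norm_S2 (\<D> g))\<^sup>2 + 2 * a"
  proof (rule sums_le[OF _ norm_\<D>_sums[OF h]])
    show "(\<lambda>l. 2 * ((d l)\<^sup>2 * energy g l) + 2 * ((d l)\<^sup>2 * energy \<mu> l)) sums (2 * (norm_S2 (\<D> g))\<^sup>2 + 2 * a)"
      unfolding a_def by (intro sums_add sums_mult norm_\<D>_sums g \<mu>)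
    fix l
    have "energy h l \<le> 2 * energy g l + 2 * energy \<mu> l"
      using energy_combination_le[OF sobolev_L2[OF g] sobolev_L2[OF \<mu>], of 1 "-1" l] by (simp add: h_def[abs_def])
    then have "(d l)\<^sup>2 * energy h l \<le> (d l)\<^sup>2 * (2 * energy g l + 2 * energy \<mu> l)" by (rule mult_left_mono) simp
    then show "(d l)\<^sup>2 * energy h l \<le> 2 * ((d l)\<^sup>2 * energy g l) + 2 * ((d l)\<^sup>2 * energy \<mu> l)"
      by (simp add: algebra_simps)
  qed
  then have "\<eta> * (norm_S2 (\<D> h))\<^sup>2 \<le> \<eta> * (2 * (norm_S2 (\<D> g))\<^sup>2 + 2 * a)" using \<eta> by simp
  then have pen: "\<eta> * (norm_S2 (\<D> h))\<^sup>2 \<le> 2 * (\<eta> * (norm_S2 (\<D> g))\<^sup>2) + 2 * (\<eta> * a)" by (simp add: algebra_simps)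
  have quad: "inner_S2 h h - A / 4 \<le> (\<Sum>k\<in>I. w k * (h (U k))\<^sup>2)"
    unfolding A_def using \<eta> by (intro gram_quadratic_ge h U G) auto
  have A: "A = inner_S2 h h + \<eta> * (norm_S2 (\<D> h))\<^sup>2" by (simp add: A_def smooth_norm2_def)
  have "A / 4 \<le> 2 * T + 2 * (\<eta> * a)"
    using basic pen quad A inner_S2_ge_0[of h] by linarith
  moreover have "2 * T \<le> A / 8 + 8 * S"
  proof -
    have "T\<^sup>2 \<le> S * A" unfolding T_def A_def using \<eta> by (intro score_inner_le h U S) auto
    moreover have "A \<ge> 0" unfolding A using \<eta> by (simp add: inner_S2_ge_0)
    moreover have "S \<ge> 0"
      using S[of 0] by (simp add: score_energy_def indices_def)
    moreover have "4 * (S * A) \<le> (A / 8 + 8 * S)\<^sup>2"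
      using zero_le_power2[of "A / 8 - 8 * S"] by (simp add: power2_eq_square algebra_simps)
    ultimately have "(2 * T)\<^sup>2 \<le> (A / 8 + 8 * S)\<^sup>2" by (simp add: power_mult_distrib)
    then show ?thesis by (rule power2_le_imp_le) (use \<open>A \<ge> 0\<close> \<open>S \<ge> 0\<close> in auto)
  qed
  ultimately have "A \<le> 64 * S + 16 * (\<eta> * a)" by linarith
  moreover have "inner_S2 h h \<le> A" using A \<eta> by simp
  ultimately show ?thesis by (simp add: norm_S2_square h_def[abs_def] a_def)
qed

end

section \<open>Second moments over product measures\<close>

lemma sets_unif_S2 [measurable_cong]: "sets unif_S2 = sets surf"
  by (simp add: unif_S2_def)

lemma space_unif_S2 [simp]: "space unif_S2 = S2"
  by (simp add: unif_S2_def)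

lemma unif_S2_density: "unif_S2 = density surf (\<lambda>_. ennreal (1 / (4 * pi)))"
  unfolding unif_S2_def uniform_measure_def
proof (rule density_cong)
  show "AE x in surf. indicator S2 x / emeasure surf S2 = ennreal (1 / (4 * pi))"
    by (rule AE_I2) (use divide_ennreal[of 1 "4 * pi"] in \<open>simp add: emeasure_surf_S2\<close>)
qed (use sets.top[of surf] in auto)

lemma prob_space_unif_S2: "prob_space unif_S2"
  unfolding unif_S2_def by (rule prob_space_uniform_measure) (simp_all add: emeasure_surf_S2)

lemma integral_unif_S2:
  fixes f :: "real^3 \<Rightarrow> real"
  assumes "f \<in> borel_measurable surf"
  shows "(LINT u|unif_S2. f u) = (LINT u|surf. f u) / (4 * pi)"
  unfolding unif_S2_density using assms by (subst integral_density) auto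

lemma integrable_unif_S2:
  fixes f :: "real^3 \<Rightarrow> real"
  assumes "integrable surf f"
  shows "integrable unif_S2 f"
  unfolding unif_S2_density using assms by (subst integrable_density) auto

text \<open>The second moment of a sum of independent centred variables, by integrating out one coordinate at a
  time. The offset \<open>a\<close> carries the induction and later stands for everything that depends on the
  variables integrated afterwards. Nonnegative integrals avoid integrability over the product.\<close>

lemma nn_integral_PiM_sum_square:
  fixes \<phi> :: "'i \<Rightarrow> 'b \<Rightarrow> real"
  assumes N: "prob_space N" and I: "finite I"
    and meas: "\<And>i. i \<in> I \<Longrightarrow> \<phi> i \<in> borel_measurable N"
    and sq: "\<And>i. i \<in> I \<Longrightarrow> integrable N (\<lambda>x. (\<phi> i x)\<^sup>2)"
    and mean: "\<And>i. i \<in> I \<Longrightarrow> (LINT x|N. \<phi> i x) = 0"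
  shows "(\<integral>\<^sup>+x. ennreal ((a + (\<Sum>i\<in>I. \<phi> i (x i)))\<^sup>2) \<partial>(\<Pi>\<^sub>M i\<in>I. N))
    = ennreal (a\<^sup>2 + (\<Sum>i\<in>I. LINT x|N. (\<phi> i x)\<^sup>2))"
  using I meas sq mean
proof (induction I rule: finite_induct)
  case empty
  interpret product_prob_space "\<lambda>_. N" "{}"
    by (rule product_prob_spaceI) fact
  show ?case by (simp add: P.emeasure_space_1)
next
  case (insert j I)
  interpret N: prob_space N by fact
  interpret product_prob_space "\<lambda>_. N" I
    by (rule product_prob_spaceI) fact
  note [measurable] = insert.prems(1)
  have int: "integrable N (\<phi> j)"
    using insert.prems(1,2)[OF insertI1] by (rule N.square_integrable_imp_integrable)
  define v where "v = (LINT x|N. (\<phi> j x)\<^sup>2)"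
  have v: "v \<ge> 0" by (simp add: v_def)
  have inner: "(\<integral>\<^sup>+y. ennreal ((s + \<phi> j y)\<^sup>2) \<partial>N) = ennreal (s\<^sup>2) + ennreal v" for s
  proof -
    have int2: "integrable N (\<lambda>y. (s + \<phi> j y)\<^sup>2)"
      using insert.prems int by (auto simp: power2_sum intro!: Bochner_Integration.integrable_add)
    then have "(\<integral>\<^sup>+y. ennreal ((s + \<phi> j y)\<^sup>2) \<partial>N) = ennreal (LINT y|N. (s + \<phi> j y)\<^sup>2)"
      by (intro nn_integral_eq_integral) auto
    also have "(LINT y|N. (s + \<phi> j y)\<^sup>2) = (LINT y|N. s\<^sup>2 + (\<phi> j y)\<^sup>2 + 2 * s * \<phi> j y)"
      by (simp add: power2_sum)
    also have "\<dots> = s\<^sup>2 + v"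
      using insert.prems int by (simp add: v_def N.prob_space)
    finally show ?thesis using v by simp
  qed
  have "(\<integral>\<^sup>+x. ennreal ((a + (\<Sum>i\<in>insert j I. \<phi> i (x i)))\<^sup>2) \<partial>(\<Pi>\<^sub>M i\<in>insert j I. N))
    = (\<integral>\<^sup>+x. \<integral>\<^sup>+y. ennreal ((a + (\<Sum>i\<in>insert j I. \<phi> i ((x(j := y)) i)))\<^sup>2) \<partial>N \<partial>(\<Pi>\<^sub>M i\<in>I. N))"
    using insert.hyps by (intro product_nn_integral_insert) (auto)
  also have "\<dots> = (\<integral>\<^sup>+x. \<integral>\<^sup>+y. ennreal (((a + (\<Sum>i\<in>I. \<phi> i (x i))) + \<phi> j y)\<^sup>2) \<partial>N \<partial>(\<Pi>\<^sub>M i\<in>I. N))"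
  proof -
    have "(\<Sum>i\<in>insert j I. \<phi> i ((x(j := y)) i)) = (\<Sum>i\<in>I. \<phi> i (x i)) + \<phi> j y" for x y
      using insert.hyps by (simp add: add.commute) (auto intro!: sum.cong)
    then show ?thesis by (simp only: add.assoc)
  qed
  also have "\<dots> = (\<integral>\<^sup>+x. ennreal ((a + (\<Sum>i\<in>I. \<phi> i (x i)))\<^sup>2) + ennreal v \<partial>(\<Pi>\<^sub>M i\<in>I. N))"
    by (simp only: inner)
  also have "\<dots> = (\<integral>\<^sup>+x. ennreal ((a + (\<Sum>i\<in>I. \<phi> i (x i)))\<^sup>2) \<partial>(\<Pi>\<^sub>M i\<in>I. N)) + ennreal v"
    by (subst nn_integral_add) (auto simp: P.emeasure_space_1)
  also have "\<dots> = ennreal (a\<^sup>2 + (\<Sum>i\<in>I. LINT x|N. (\<phi> i x)\<^sup>2)) + ennreal v"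
    using insert by simp
  also have "\<dots> = ennreal (a\<^sup>2 + (\<Sum>i\<in>insert j I. LINT x|N. (\<phi> i x)\<^sup>2))"
    using insert.hyps v by (subst ennreal_plus[symmetric]) (auto simp: v_def add_ac intro!: add_nonneg_nonneg sum_nonneg)
  finally show ?case .
qed

lemma integral_centered_square_le:
  fixes f :: "'a \<Rightarrow> real"
  assumes N: "prob_space N" and sq: "integrable N (\<lambda>x. (f x)\<^sup>2)" and f: "f \<in> borel_measurable N"
  defines "m \<equiv> LINT x|N. f x"
  shows "integrable N (\<lambda>x. (c * (f x - m))\<^sup>2)" "(LINT x|N. c * (f x - m)) = 0"
    "(LINT x|N. (c * (f x - m))\<^sup>2) \<le> c\<^sup>2 * (LINT x|N. (f x)\<^sup>2)"
proof -
  interpret prob_space N by fact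
  have int: "integrable N f" using f sq by (rule square_integrable_imp_integrable)
  have eq: "(c * (f x - m))\<^sup>2 = c\<^sup>2 * ((f x)\<^sup>2 - 2 * m * f x + m\<^sup>2)" for x
    by (simp add: power2_eq_square algebra_simps)
  show "integrable N (\<lambda>x. (c * (f x - m))\<^sup>2)" unfolding eq using int sq by auto
  show "(LINT x|N. c * (f x - m)) = 0" using int by (simp add: m_def prob_space)
  have "(LINT x|N. (c * (f x - m))\<^sup>2) = c\<^sup>2 * ((LINT x|N. (f x)\<^sup>2) - 2 * m * m + m\<^sup>2)"
    unfolding eq using int sq by (simp add: prob_space m_def[symmetric])
  also have "\<dots> \<le> c\<^sup>2 * (LINT x|N. (f x)\<^sup>2)"
    by (intro mult_left_mono) (auto simp: power2_eq_square)
  finally show "(LINT x|N. (c * (f x - m))\<^sup>2) \<le> c\<^sup>2 * (LINT x|N. (f x)\<^sup>2)" .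
qed

lemma (in harmonic_basis) space_sobolev_borel [simp]: "space (sobolev_borel Y s) = sobolev Y s"
  unfolding sobolev_borel_def by (subst space_measure_of) auto

text \<open>Coefficients are continuous for the Sobolev norm, so their strict sublevel sets belong to the
  generators of the Borel sigma-algebra.\<close>

lemma (in harmonic_basis) coefficient_measurable:
  assumes s: "s > 1" and m: "m \<in> orders l"
  shows "(\<lambda>f. inner_S2 f (Y l m)) \<in> borel_measurable (sobolev_borel Y s)"
proof (subst borel_measurable_iff_less, intro allI)
  fix a
  let ?V = "{f \<in> sobolev Y s. inner_S2 f (Y l m) < a}"
  have "\<exists>e>0. \<forall>g\<in>sobolev Y s. sobolev_norm Y s (\<lambda>x. g x - f x) < e \<longrightarrow> g \<in> ?V" if f: "f \<in> ?V" for f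
  proof (intro exI[of _ "a - inner_S2 f (Y l m)"] conjI ballI impI)
    show "0 < a - inner_S2 f (Y l m)" using f by simp
    fix g assume g: "g \<in> sobolev Y s" "sobolev_norm Y s (\<lambda>x. g x - f x) < a - inner_S2 f (Y l m)"
    have "(\<lambda>x. g x - f x) \<in> sobolev Y s"
      using sobolev_combination[OF g(1) _ s, of f 1 "-1"] f by simp
    from coefficient_le_sobolev_norm[OF this _ m] s
    have "inner_S2 (\<lambda>x. g x - f x) (Y l m) \<le> sobolev_norm Y s (\<lambda>x. g x - f x)" by simp
    moreover have "inner_S2 (\<lambda>x. g x - f x) (Y l m) = inner_S2 g (Y l m) - inner_S2 f (Y l m)"
      using f g m by (intro inner_S2_diff) (auto intro: sobolev_L2 L2_Y)
    ultimately show "g \<in> ?V" using g by simp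
  qed
  then have "?V \<in> sigma_sets (sobolev Y s) {V. V \<subseteq> sobolev Y s \<and>
        (\<forall>f\<in>V. \<exists>e>0. \<forall>g\<in>sobolev Y s. sobolev_norm Y s (\<lambda>x. g x - f x) < e \<longrightarrow> g \<in> V)}"
    by (intro sigma_sets.Basic) blast
  then show "{f \<in> space (sobolev_borel Y s). inner_S2 f (Y l m) < a} \<in> sets (sobolev_borel Y s)"
    unfolding space_sobolev_borel unfolding sobolev_borel_def by (subst sets_measure_of) auto
qed

section \<open>Random curves\<close>

lemma nn_integral_PiM_component:
  assumes N: "prob_space N" and k: "k \<in> I" and g: "g \<in> borel_measurable N"
  shows "(\<integral>\<^sup>+x. g (x k) \<partial>(\<Pi>\<^sub>M i\<in>I. N)) = (\<integral>\<^sup>+x. g x \<partial>N)"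
proof -
  interpret product_prob_space "\<lambda>_. N" I
    by (rule product_prob_spaceI) fact
  have "(\<integral>\<^sup>+x. g x \<partial>N) = (\<integral>\<^sup>+x. g x \<partial>distr (\<Pi>\<^sub>M i\<in>I. N) N (\<lambda>x. x k))"
    using PiM_component[OF k] by simp
  also have "\<dots> = (\<integral>\<^sup>+x. g (x k) \<partial>(\<Pi>\<^sub>M i\<in>I. N))"
    using g k by (intro nn_integral_distr) auto
  finally show ?thesis ..
qed

locale sampling_model = smoothing_operator Y p C1 C2 d \<D>
  for Y :: "nat \<Rightarrow> int \<Rightarrow> real^3 \<Rightarrow> real" and p C1 C2 d \<D> +
  fixes q M K \<sigma> :: real and P :: "(real^3 \<Rightarrow> real) measure" and E :: "real measure"
  assumes q: "q > 1" and P: "P \<in> Pi1 Y M K p q" and M: "M > 0" and K: "K > 0"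
    and E: "prob_space E" and sets_E: "sets E = sets borel"
    and E_square: "integrable E (\<lambda>x. x\<^sup>2)" and E_mean: "(LINT x|E. x) = 0" and E_var: "(LINT x|E. x\<^sup>2) = \<sigma>\<^sup>2"
begin

abbreviation \<mu> :: "real^3 \<Rightarrow> real" where "\<mu> \<equiv> mean_fun P"

lemma prob_P: "prob_space P" and sets_P: "sets P = sets (sobolev_borel Y q)"
  and energy_P: "(\<integral>\<^sup>+ f. ennreal ((sobolev_norm Y q f)\<^sup>2) \<partial>P) \<le> ennreal M"
  and \<mu>_sobolev: "\<mu> \<in> sobolev Y p" and \<mu>_norm: "(sobolev_norm Y p \<mu>)\<^sup>2 \<le> K"
  using P by (auto simp: Pi1_def)

sublocale P: prob_space P by (rule prob_P)

lemma space_P: "space P = sobolev Y q"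
  using sets_eq_imp_space_eq[OF sets_P] by simp

lemma coefficient_measurable_P: "m \<in> orders l \<Longrightarrow> (\<lambda>f. inner_S2 f (Y l m)) \<in> borel_measurable P"
  using coefficient_measurable[OF q] by (simp cong: measurable_cong_sets add: measurable_cong_sets[OF sets_P refl])

lemma Y_measurable: "m \<in> orders l \<Longrightarrow> Y l m \<in> borel_measurable surf"
  by (intro L2_S2_measurable L2_Y)

lemma curve_continuous: "f \<in> space P \<Longrightarrow> continuous_on S2 f"
  using q by (simp add: space_P sobolev_def)

lemma \<mu>_continuous: "continuous_on S2 \<mu>"
  using \<mu>_sobolev p by (simp add: sobolev_def)

lemma \<mu>_measurable: "\<mu> \<in> borel_measurable surf"
  by (intro L2_S2_measurable continuous_L2_S2 \<mu>_continuous)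

text \<open>Joint measurability comes from the expansion: each partial sum is a finite sum of products of a
  measurable coefficient and a continuous function, and the expansion converges pointwise.\<close>

lemma evaluation_measurable: "(\<lambda>z. fst z (snd z)) \<in> borel_measurable (P \<Otimes>\<^sub>M surf)"
proof (rule borel_measurable_LIMSEQ_real)
  show "(\<lambda>L. \<Sum>l<L. degree_part Y (fst z) l (snd z)) \<longlonglongrightarrow> fst z (snd z)" if "z \<in> space (P \<Otimes>\<^sub>M surf)" for z
    using that sobolev_sums[of "fst z" q "snd z"] q by (auto simp: space_pair_measure space_P sums_def)
  show "(\<lambda>z. \<Sum>l<L. degree_part Y (fst z) l (snd z)) \<in> borel_measurable (P \<Otimes>\<^sub>M surf)" for L
    unfolding degree_part_def
    by (intro borel_measurable_sum borel_measurable_times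
        measurable_compose[OF measurable_fst coefficient_measurable_P]
        measurable_compose[OF measurable_snd Y_measurable])
qed

lemma evaluation_measurable_comp:
  assumes "X \<in> N \<rightarrow>\<^sub>M P" "u \<in> N \<rightarrow>\<^sub>M surf"
  shows "(\<lambda>\<omega>. X \<omega> (u \<omega>)) \<in> borel_measurable N"
  using measurable_compose[OF measurable_Pair[OF assms] evaluation_measurable] by simp

definition deviation :: "(real^3 \<Rightarrow> real) \<Rightarrow> real" where
  "deviation f = inner_S2 (\<lambda>u. f u - \<mu> u) (\<lambda>u. f u - \<mu> u)"

lemma deviation_ge_0: "0 \<le> deviation f"
  by (simp add: deviation_def inner_S2_ge_0)

lemma curve_diff_continuous: "f \<in> space P \<Longrightarrow> continuous_on S2 (\<lambda>u. f u - \<mu> u)"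
  by (intro continuous_intros curve_continuous \<mu>_continuous)

lemma deviation_le:
  assumes f: "f \<in> space P"
  shows "deviation f \<le> 2 * (sobolev_norm Y q f)\<^sup>2 + 2 * K"
proof -
  have L2: "f \<in> L2_S2" "\<mu> \<in> L2_S2"
    using curve_continuous[OF f] \<mu>_continuous by (auto intro: continuous_L2_S2)
  have "deviation f = (LINT u|surf. (f u - \<mu> u)\<^sup>2)"
    by (simp add: deviation_def inner_S2_def power2_eq_square)
  also have "\<dots> \<le> (LINT u|surf. 2 * (f u)\<^sup>2 + 2 * (\<mu> u)\<^sup>2)"
  proof (rule integral_mono)
    show "integrable surf (\<lambda>u. (f u - \<mu> u)\<^sup>2)" using L2_S2_diff[OF L2] by (simp add: L2_S2_def)
    show "integrable surf (\<lambda>u. 2 * (f u)\<^sup>2 + 2 * (\<mu> u)\<^sup>2)" using L2 by (auto simp: L2_S2_def)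
    have "(s - t)\<^sup>2 \<le> 2 * s\<^sup>2 + 2 * t\<^sup>2" for s t :: real
      using zero_le_power2[of "s + t"] by (simp add: power2_eq_square algebra_simps)
    then show "(f u - \<mu> u)\<^sup>2 \<le> 2 * (f u)\<^sup>2 + 2 * (\<mu> u)\<^sup>2" for u .
  qed
  also have "\<dots> = 2 * inner_S2 f f + 2 * inner_S2 \<mu> \<mu>"
    using L2 by (simp add: inner_S2_def L2_S2_def power2_eq_square)
  also have "inner_S2 f f \<le> (sobolev_norm Y q f)\<^sup>2" using f q by (intro inner_le_sobolev_norm) (auto simp: space_P)
  also have "inner_S2 \<mu> \<mu> \<le> K" using inner_le_sobolev_norm[OF \<mu>_sobolev] p \<mu>_norm by simp
  finally show ?thesis by simp
qed

lemma sobolev_norm_measurable: "(\<lambda>f. (sobolev_norm Y q f)\<^sup>2) \<in> borel_measurable P"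
proof -
  have "(\<lambda>f. \<Sum>l. sobolev_weight q l * energy f l) \<in> borel_measurable P"
    unfolding energy_def
    by (intro borel_measurable_suminf borel_measurable_times borel_measurable_const borel_measurable_sum
        borel_measurable_power coefficient_measurable_P)
  then show ?thesis
    by (subst measurable_cong[where g = "\<lambda>f. \<Sum>l. sobolev_weight q l * energy f l"])
       (auto simp: space_P sobolev_norm_square)
qed

text \<open>The moment bound for the curves and the norm bound for the mean function contribute equally; the result
  is uniform over the class of laws.\<close>

lemma deviation_nn_integral: "(\<integral>\<^sup>+f. ennreal (deviation f) \<partial>P) \<le> ennreal (2 * M + 2 * K)"
proof -
  note [measurable] = sobolev_norm_measurable
  have "(\<integral>\<^sup>+f. ennreal (deviation f) \<partial>P) \<le> (\<integral>\<^sup>+f. 2 * ennreal ((sobolev_norm Y q f)\<^sup>2) + ennreal (2 * K) \<partial>P)"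
  proof (rule nn_integral_mono)
    fix f assume "f \<in> space P"
    then have "ennreal (deviation f) \<le> ennreal (2 * (sobolev_norm Y q f)\<^sup>2 + 2 * K)"
      by (intro ennreal_leI deviation_le)
    also have "\<dots> = 2 * ennreal ((sobolev_norm Y q f)\<^sup>2) + ennreal (2 * K)"
      using K by (simp add: ennreal_mult')
    finally show "ennreal (deviation f) \<le> 2 * ennreal ((sobolev_norm Y q f)\<^sup>2) + ennreal (2 * K)" .
  qed
  also have "\<dots> = 2 * (\<integral>\<^sup>+f. ennreal ((sobolev_norm Y q f)\<^sup>2) \<partial>P) + ennreal (2 * K)"
    by (subst nn_integral_add) (auto simp: nn_integral_cmult P.emeasure_space_1)
  also have "\<dots> \<le> 2 * ennreal M + ennreal (2 * K)"
    by (intro add_mono mult_left_mono energy_P) auto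
  also have "\<dots> = ennreal (2 * M + 2 * K)" using M K by (simp add: ennreal_mult')
  finally show ?thesis .
qed

text \<open>By Fubini; integrability over the product follows from \<open>\<bar>a b\<bar> \<le> a\<^sup>2 + b\<^sup>2\<close> and the moment bound for
  the curves.\<close>

lemma coefficient_mean:
  assumes m: "m \<in> orders l"
  shows "(LINT f|P. inner_S2 f (Y l m)) = inner_S2 \<mu> (Y l m)"
proof -
  interpret S: pair_sigma_finite P surf by unfold_locales
  have meas: "(\<lambda>z. fst z (snd z) * Y l m (snd z)) \<in> borel_measurable (P \<Otimes>\<^sub>M surf)"
    by (intro borel_measurable_times evaluation_measurable measurable_compose[OF measurable_snd Y_measurable[OF m]])
  have "integrable (P \<Otimes>\<^sub>M surf) (\<lambda>z. fst z (snd z) * Y l m (snd z))"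
  proof (rule integrableI_bounded[OF meas])
    have "(\<integral>\<^sup>+z. ennreal (norm (fst z (snd z) * Y l m (snd z))) \<partial>(P \<Otimes>\<^sub>M surf))
       = (\<integral>\<^sup>+f. \<integral>\<^sup>+u. ennreal (norm (f u * Y l m u)) \<partial>surf \<partial>P)"
      using meas by (subst surf.nn_integral_fst[symmetric]) auto
    also have "\<dots> \<le> (\<integral>\<^sup>+f. ennreal ((sobolev_norm Y q f)\<^sup>2) + 1 \<partial>P)"
    proof (rule nn_integral_mono)
      fix f assume f: "f \<in> space P"
      have L2: "f \<in> L2_S2" "Y l m \<in> L2_S2" using f L2_Y[OF m] by (auto simp: space_P intro: sobolev_L2)
      have "(\<integral>\<^sup>+u. ennreal (norm (f u * Y l m u)) \<partial>surf) \<le> (\<integral>\<^sup>+u. ennreal ((f u)\<^sup>2 + (Y l m u)\<^sup>2) \<partial>surf)"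
        unfolding real_norm_def by (intro nn_integral_mono ennreal_leI abs_mult_le_sum_squares)
      also have "\<dots> = ennreal (LINT u|surf. (f u)\<^sup>2 + (Y l m u)\<^sup>2)"
        using L2 by (intro nn_integral_eq_integral) (auto simp: L2_S2_def)
      also have "(LINT u|surf. (f u)\<^sup>2 + (Y l m u)\<^sup>2) = inner_S2 f f + inner_S2 (Y l m) (Y l m)"
        using L2 by (simp add: L2_S2_def inner_S2_def power2_eq_square)
      also have "ennreal \<dots> \<le> ennreal ((sobolev_norm Y q f)\<^sup>2 + 1)"
        using inner_le_sobolev_norm[of f q] f q m by (intro ennreal_leI) (simp add: space_P inner_Y)
      finally show "(\<integral>\<^sup>+u. ennreal (norm (f u * Y l m u)) \<partial>surf) \<le> ennreal ((sobolev_norm Y q f)\<^sup>2) + 1"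
        by simp
    qed
    also have "\<dots> = (\<integral>\<^sup>+f. ennreal ((sobolev_norm Y q f)\<^sup>2) \<partial>P) + 1"
      using sobolev_norm_measurable by (subst nn_integral_add) (auto simp: P.emeasure_space_1)
    also have "\<dots> \<le> ennreal M + 1" by (intro add_mono energy_P order_refl)
    also have "\<dots> < \<infinity>" by simp
    finally show "(\<integral>\<^sup>+z. ennreal (norm (fst z (snd z) * Y l m (snd z))) \<partial>(P \<Otimes>\<^sub>M surf)) < \<infinity>" .
  qed
  then have "integrable (P \<Otimes>\<^sub>M surf) (case_prod (\<lambda>f u. f u * Y l m u))" by (simp add: split_def)
  from S.Fubini_integral[OF this]
  show ?thesis by (simp add: inner_S2_def mean_fun_def)
qed

lemma centered_coefficient:
  assumes "f \<in> space P" "m \<in> orders l"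
  shows "inner_S2 (\<lambda>u. f u - \<mu> u) (Y l m) = inner_S2 f (Y l m) - inner_S2 \<mu> (Y l m)"
  using assms by (intro inner_S2_diff continuous_L2_S2 curve_continuous \<mu>_continuous continuous_Y)

lemma centered_coefficient_measurable:
  assumes m: "m \<in> orders l"
  shows "(\<lambda>f. inner_S2 (\<lambda>u. f u - \<mu> u) (Y l m)) \<in> borel_measurable P"
  using coefficient_measurable_P[OF m]
  by (subst measurable_cong[OF centered_coefficient[OF _ m]]) auto

lemma centered_coefficient_square:
  assumes m: "m \<in> orders l" and f: "f \<in> space P"
  shows "(inner_S2 (\<lambda>u. f u - \<mu> u) (Y l m))\<^sup>2 \<le> deviation f"
  using inner_S2_square_le[OF continuous_L2_S2[OF curve_diff_continuous[OF f]] L2_Y[OF m]] m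
  by (simp add: deviation_def inner_Y)

lemma centered_coefficient_integrable:
  assumes m: "m \<in> orders l"
  shows "integrable P (\<lambda>f. (inner_S2 (\<lambda>u. f u - \<mu> u) (Y l m))\<^sup>2)"
proof (rule integrableI_bounded)
  have "(\<integral>\<^sup>+f. ennreal (norm ((inner_S2 (\<lambda>u. f u - \<mu> u) (Y l m))\<^sup>2)) \<partial>P) \<le> (\<integral>\<^sup>+f. ennreal (deviation f) \<partial>P)"
    using centered_coefficient_square[OF m] by (intro nn_integral_mono ennreal_leI) simp
  also have "\<dots> < \<infinity>" by (rule order_le_less_trans[OF deviation_nn_integral]) simp
  finally show "(\<integral>\<^sup>+f. ennreal (norm ((inner_S2 (\<lambda>u. f u - \<mu> u) (Y l m))\<^sup>2)) \<partial>P) < \<infinity>" .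
qed (use centered_coefficient_measurable[OF m] in measurable)

lemma centered_coefficient_mean:
  assumes m: "m \<in> orders l"
  shows "(LINT f|P. inner_S2 (\<lambda>u. f u - \<mu> u) (Y l m)) = 0"
proof -
  have int: "integrable P (\<lambda>f. inner_S2 (\<lambda>u. f u - \<mu> u) (Y l m))"
    by (rule P.square_integrable_imp_integrable[OF centered_coefficient_measurable[OF m] centered_coefficient_integrable[OF m]])
  then have "integrable P (\<lambda>f. inner_S2 (\<lambda>u. f u - \<mu> u) (Y l m) + inner_S2 \<mu> (Y l m))" by simp
  then have int': "integrable P (\<lambda>f. inner_S2 f (Y l m))"
    by (rule Bochner_Integration.integrable_cong[THEN iffD1, rotated 2]) (simp_all add: centered_coefficient[OF _ m])
  have "(LINT f|P. inner_S2 (\<lambda>u. f u - \<mu> u) (Y l m)) = (LINT f|P. inner_S2 f (Y l m) - inner_S2 \<mu> (Y l m))"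
    by (intro Bochner_Integration.integral_cong refl centered_coefficient[OF _ m])
  also have "\<dots> = 0" using int' by (simp add: coefficient_mean[OF m] P.prob_space)
  finally show ?thesis .
qed

definition weighted_deviation :: "(real^3 \<Rightarrow> real) \<Rightarrow> (real^3 \<Rightarrow> real) \<Rightarrow> real" where
  "weighted_deviation y f = (LINT u|unif_S2. ((f u - \<mu> u) * y u)\<^sup>2)"

lemma weighted_deviation_ge_0: "0 \<le> weighted_deviation y f"
  by (simp add: weighted_deviation_def)

lemma weighted_deviation_measurable:
  assumes "y \<in> borel_measurable surf"
  shows "weighted_deviation y \<in> borel_measurable P"
proof -
  interpret U: prob_space unif_S2 by (rule prob_space_unif_S2)
  have "(\<lambda>z. ((fst z (snd z) - \<mu> (snd z)) * y (snd z))\<^sup>2) \<in> borel_measurable (P \<Otimes>\<^sub>M surf)"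
    using evaluation_measurable measurable_compose[OF measurable_snd \<mu>_measurable] measurable_compose[OF measurable_snd assms]
    by measurable
  then have "(\<lambda>(f, u). ((f u - \<mu> u) * y u)\<^sup>2) \<in> borel_measurable (P \<Otimes>\<^sub>M unif_S2)"
    by (simp add: split_def cong: measurable_cong_sets)
  from U.borel_measurable_lebesgue_integral[OF this]
  show ?thesis by (simp add: weighted_deviation_def[abs_def])
qed

end

section \<open>Second moments of scores and Gram errors\<close>

locale sampling_design = sampling_model +
  fixes n :: nat and r :: "nat \<Rightarrow> nat"
  assumes n: "n \<ge> 1" and r: "\<And>i. i \<in> {1..n} \<Longrightarrow> r i \<ge> 1"
begin

abbreviation I :: "(nat \<times> nat) set" where "I \<equiv> obs_index n r"
abbreviation w :: "nat \<times> nat \<Rightarrow> real" where "w \<equiv> obs_weight n r"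
abbreviation curves_law where "curves_law \<equiv> \<Pi>\<^sub>M i\<in>{1..n}. P"
abbreviation locations_law where "locations_law \<equiv> \<Pi>\<^sub>M k\<in>I. unif_S2"
abbreviation errors_law where "errors_law \<equiv> \<Pi>\<^sub>M k\<in>I. E"
abbreviation \<Omega> where "\<Omega> \<equiv> sample_law P E n r"

definition site :: "sample \<Rightarrow> nat \<times> nat \<Rightarrow> real^3" where
  "site \<omega> k = location \<omega> (fst k) (snd k)"

definition residual :: "sample \<Rightarrow> nat \<times> nat \<Rightarrow> real" where
  "residual \<omega> k = response \<omega> (fst k) (snd k) - \<mu> (site \<omega> k)"

lemma site_eq: "site (X, U, e) k = U k"
  by (simp add: site_def location_def)

lemma residual_eq: "residual (X, U, e) k = X (fst k) (U k) - \<mu> (U k) + e k"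
  by (simp add: residual_def response_def site_eq)

lemma site_proj: "site \<omega> k = fst (snd \<omega>) k"
  by (cases \<omega>) (simp add: site_eq)

lemma residual_proj: "residual \<omega> k = fst \<omega> (fst k) (site \<omega> k) + snd (snd \<omega>) k - \<mu> (site \<omega> k)"
  by (cases \<omega>) (simp add: residual_eq site_eq)

text \<open>The weights of the observations on one curve sum to \<open>4 pi / n\<close>, whatever their number.\<close>

lemma sum_weight_row: "(\<Sum>k\<in>I. w k * G (fst k)) = 4 * pi / real n * (\<Sum>i=1..n. G i)"
proof -
  have "(\<Sum>k\<in>I. w k * G (fst k)) = 4 * pi / real n * (\<Sum>i=1..n. 1 / real (r i) * (\<Sum>j=1..r i. G i))"
    by (rule sum_obs_index[where F = "\<lambda>i j. G i"])
  also have "(\<Sum>i=1..n. 1 / real (r i) * (\<Sum>j=1..r i. G i)) = (\<Sum>i=1..n. G i)"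
  proof (rule sum.cong[OF refl])
    fix i assume "i \<in> {1..n}"
    from r[OF this] show "1 / real (r i) * (\<Sum>j=1..r i. G i) = G i" by simp
  qed
  finally show ?thesis .
qed

lemma sum_weight: "(\<Sum>k\<in>I. w k) = 4 * pi"
  using sum_weight_row[of "\<lambda>_. 1"] n by simp

definition weight_energy :: real where
  "weight_energy = (\<Sum>k\<in>I. (w k)\<^sup>2)"

lemma weight_energy_ge_0: "0 \<le> weight_energy"
  by (simp add: weight_energy_def sum_nonneg)

lemma weight_energy_eq: "weight_energy = 16 * pi\<^sup>2 / (real n * harmonic_mean n r)"
proof -
  have "weight_energy = (\<Sum>k\<in>I. w k * (4 * pi / (real n * real (r (fst k)))))"
    unfolding weight_energy_def power2_eq_square by (intro sum.cong refl) (simp add: obs_weight_def)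
  also have "\<dots> = 4 * pi / real n * (\<Sum>i=1..n. 4 * pi / (real n * real (r i)))"
    by (rule sum_weight_row[where G = "\<lambda>i. 4 * pi / (real n * real (r i))"])
  also have "(\<Sum>i=1..n. 4 * pi / (real n * real (r i))) = 4 * pi / real n * (\<Sum>i=1..n. 1 / real (r i))"
    by (simp add: sum_distrib_left)
  finally have "weight_energy = 16 * pi\<^sup>2 / (real n)\<^sup>2 * (\<Sum>i=1..n. 1 / real (r i))"
    by (simp add: power2_eq_square)
  then show ?thesis
    using n by (simp add: harmonic_mean_def power2_eq_square field_simps inverse_eq_divide)
qed

lemma index_curve: "k \<in> I \<Longrightarrow> fst k \<in> {1..n}"
  by (auto simp: obs_index_def)

lemma prob_curves: "prob_space curves_law" and prob_locations: "prob_space locations_law"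
  and prob_errors: "prob_space errors_law"
  by (auto intro!: prob_space_PiM prob_P prob_space_unif_S2 E)

sublocale curves: prob_space curves_law by (rule prob_curves)
sublocale locations: prob_space locations_law by (rule prob_locations)
sublocale errors: prob_space errors_law by (rule prob_errors)
sublocale UE: pair_prob_space locations_law errors_law ..

lemma nn_integral_sample_law:
  assumes f: "f \<in> borel_measurable \<Omega>"
  shows "(\<integral>\<^sup>+\<omega>. f \<omega> \<partial>\<Omega>) = (\<integral>\<^sup>+X. \<integral>\<^sup>+U. \<integral>\<^sup>+e. f (X, U, e) \<partial>errors_law \<partial>locations_law \<partial>curves_law)"
proof -
  have "(\<integral>\<^sup>+\<omega>. f \<omega> \<partial>\<Omega>) = (\<integral>\<^sup>+X. \<integral>\<^sup>+z. f (X, z) \<partial>(locations_law \<Otimes>\<^sub>M errors_law) \<partial>curves_law)"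
    using f unfolding sample_law_def by (rule UE.nn_integral_fst[symmetric])
  also have "\<dots> = (\<integral>\<^sup>+X. \<integral>\<^sup>+U. \<integral>\<^sup>+e. f (X, U, e) \<partial>errors_law \<partial>locations_law \<partial>curves_law)"
  proof (rule nn_integral_cong)
    fix X assume X: "X \<in> space curves_law"
    have "(\<lambda>z. f (X, z)) \<in> borel_measurable (locations_law \<Otimes>\<^sub>M errors_law)"
      using f X unfolding sample_law_def by (rule measurable_Pair2)
    from errors.nn_integral_fst[OF this]
    show "(\<integral>\<^sup>+z. f (X, z) \<partial>(locations_law \<Otimes>\<^sub>M errors_law)) = (\<integral>\<^sup>+U. \<integral>\<^sup>+e. f (X, U, e) \<partial>errors_law \<partial>locations_law)"
      by simp
  qed
  finally show ?thesis .
qed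

lemma site_measurable:
  assumes k: "k \<in> I"
  shows "(\<lambda>\<omega>. site \<omega> k) \<in> \<Omega> \<rightarrow>\<^sub>M surf"
proof -
  have "(\<lambda>\<omega>. fst (snd \<omega>) k) \<in> \<Omega> \<rightarrow>\<^sub>M unif_S2"
    unfolding sample_law_def using k by measurable
  then show ?thesis
    unfolding site_proj by (simp only: measurable_cong_sets[OF refl sets_unif_S2])
qed

lemma residual_measurable:
  assumes k: "k \<in> I"
  shows "(\<lambda>\<omega>. residual \<omega> k) \<in> borel_measurable \<Omega>"
proof -
  have X: "(\<lambda>\<omega>. fst \<omega> (fst k)) \<in> \<Omega> \<rightarrow>\<^sub>M P"
    unfolding sample_law_def using index_curve[OF k] by measurable
  have "(\<lambda>\<omega>. snd (snd \<omega>) k) \<in> \<Omega> \<rightarrow>\<^sub>M E"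
    unfolding sample_law_def using k by measurable
  then have e: "(\<lambda>\<omega>. snd (snd \<omega>) k) \<in> borel_measurable \<Omega>"
    by (simp only: measurable_cong_sets[OF refl sets_E])
  have "(\<lambda>\<omega>. fst \<omega> (fst k) (site \<omega> k) + snd (snd \<omega>) k - \<mu> (site \<omega> k)) \<in> borel_measurable \<Omega>"
    by (intro borel_measurable_add borel_measurable_diff e evaluation_measurable_comp[OF X site_measurable[OF k]]
        measurable_compose[OF site_measurable[OF k] \<mu>_measurable])
  then show ?thesis unfolding residual_proj .
qed

lemma score_measurable:
  assumes "a \<in> indices L"
  shows "(\<lambda>\<omega>. score I w (residual \<omega>) (site \<omega>) a) \<in> borel_measurable \<Omega>"
  unfolding score_def using assms
  by (intro borel_measurable_sum borel_measurable_times borel_measurable_const residual_measurable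
      measurable_compose[OF site_measurable] Y_measurable) (auto simp: indices_def)

lemma gram_error_measurable:
  assumes "a \<in> indices L" "b \<in> indices L"
  shows "(\<lambda>\<omega>. gram_error I w (site \<omega>) a b) \<in> borel_measurable \<Omega>"
  unfolding gram_error_def using assms
  by (intro borel_measurable_sum borel_measurable_times borel_measurable_const borel_measurable_diff
      measurable_compose[OF site_measurable] Y_measurable) (auto simp: indices_def)

lemma continuous_unif_S2:
  fixes f :: "real^3 \<Rightarrow> real"
  assumes "continuous_on S2 f"
  shows "f \<in> borel_measurable unif_S2" "integrable unif_S2 f" "integrable unif_S2 (\<lambda>u. (f u)\<^sup>2)"
proof -
  show *: "f \<in> borel_measurable unif_S2"
    using L2_S2_measurable[OF continuous_L2_S2[OF assms]] by (simp only: measurable_cong_sets[OF sets_unif_S2 refl])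
  show sq: "integrable unif_S2 (\<lambda>u. (f u)\<^sup>2)"
    using continuous_L2_S2[OF assms] by (intro integrable_unif_S2) (simp add: L2_S2_def)
  interpret prob_space unif_S2 by (rule prob_space_unif_S2)
  show "integrable unif_S2 f" using * sq by (rule square_integrable_imp_integrable)
qed

lemma continuous_at_site_measurable:
  fixes f :: "real^3 \<Rightarrow> real"
  assumes k: "k \<in> I" and f: "continuous_on S2 f"
  shows "(\<lambda>U. f (U k)) \<in> borel_measurable locations_law"
  by (rule measurable_compose[OF measurable_component_singleton[OF k, of "\<lambda>_. unif_S2"] continuous_unif_S2(1)[OF f]])

lemma curve_functional_measurable:
  fixes f :: "(real^3 \<Rightarrow> real) \<Rightarrow> real"
  assumes i: "i \<in> {1..n}" and f: "f \<in> borel_measurable P"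
  shows "(\<lambda>X. f (X i)) \<in> borel_measurable curves_law"
  by (rule measurable_compose[OF measurable_component_singleton[OF i, of "\<lambda>_. P"] f])

text \<open>Integrating out the errors leaves the variance of the noise and the square of \<open>A\<close>, the score of the
  noise-free residuals. Integrating out the locations replaces \<open>A\<close> by its conditional mean \<open>C\<close>, an average of
  centred coefficients over the curves, at the cost of the conditional variance. Integrating out the
  curves then gives \<open>1/n\<close> times the variance of a coefficient.\<close>

lemma score_moment:
  assumes m: "m \<in> orders l"
  shows "(\<integral>\<^sup>+\<omega>. ennreal ((score I w (residual \<omega>) (site \<omega>) (l, m))\<^sup>2) \<partial>\<Omega>)
    \<le> (\<integral>\<^sup>+f. ennreal (weight_energy * (weighted_deviation (Y l m) f + \<sigma>\<^sup>2 / (4 * pi))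
          + (inner_S2 (\<lambda>u. f u - \<mu> u) (Y l m))\<^sup>2 / real n) \<partial>P)"
proof -
  let ?e = "\<lambda>k u. ennreal ((w k)\<^sup>2 * \<sigma>\<^sup>2 * u\<^sup>2)"
  let ?s = "\<lambda>\<omega>. ennreal ((score I w (residual \<omega>) (site \<omega>) (l, m))\<^sup>2)"
  let ?N = "ennreal (weight_energy * (\<sigma>\<^sup>2 / (4 * pi)))"
  define y where "y = Y l m"
  let ?d = "\<lambda>k f. ennreal ((w k)\<^sup>2 * weighted_deviation y f)"
  have y: "continuous_on S2 y" unfolding y_def by (rule continuous_Y[OF m])
  have y_meas: "y \<in> borel_measurable surf" unfolding y_def by (rule Y_measurable[OF m])
  define c where "c f = inner_S2 (\<lambda>u. f u - \<mu> u) y" for f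
  define A where "A X U = (\<Sum>k\<in>I. w k * ((X (fst k) (U k) - \<mu> (U k)) * y (U k)))" for X :: "nat \<Rightarrow> real^3 \<Rightarrow> real" and U
  define noise where "noise U = (\<Sum>k\<in>I. (w k)\<^sup>2 * \<sigma>\<^sup>2 * (y (U k))\<^sup>2)" for U
  define WD where "WD X = (\<Sum>k\<in>I. (w k)\<^sup>2 * weighted_deviation y (X (fst k)))" for X
  define C where "C X = (\<Sum>i=1..n. c (X i) / real n)" for X
  have lm: "(l, m) \<in> indices (Suc l)" using m by (simp add: indices_def)
  have errors: "(\<integral>\<^sup>+e. ?s (X, U, e) \<partial>errors_law)
      = ennreal ((A X U)\<^sup>2) + ennreal (noise U)" for X U
  proof -
    have "score I w (residual (X, U, e)) (site (X, U, e)) (l, m) = A X U + (\<Sum>k\<in>I. w k * y (U k) * e k)" for e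
      unfolding score_def A_def site_eq residual_eq sum.distrib[symmetric]
      by (intro sum.cong refl) (simp add: y_def algebra_simps)
    then have "(\<integral>\<^sup>+e. ?s (X, U, e) \<partial>errors_law)
      = (\<integral>\<^sup>+e. ennreal ((A X U + (\<Sum>k\<in>I. w k * y (U k) * e k))\<^sup>2) \<partial>errors_law)" by simp
    also have "\<dots> = ennreal ((A X U)\<^sup>2 + (\<Sum>k\<in>I. LINT x|E. (w k * y (U k) * x)\<^sup>2))"
      using E_square E_mean sets_E
      by (intro nn_integral_PiM_sum_square[OF E finite_obs_index]) (auto simp: power_mult_distrib measurable_cong_sets[OF sets_E refl])
    also have "(\<Sum>k\<in>I. LINT x|E. (w k * y (U k) * x)\<^sup>2) = noise U"
      by (simp add: noise_def power_mult_distrib E_var) (simp add: mult.assoc mult.commute[of "\<sigma>\<^sup>2"])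
    finally show ?thesis by (simp add: noise_def sum_nonneg)
  qed
  have y_square: "(LINT u|unif_S2. (y u)\<^sup>2) = 1 / (4 * pi)"
  proof -
    have "(LINT u|unif_S2. (y u)\<^sup>2) = inner_S2 y y / (4 * pi)"
      using y_meas by (subst integral_unif_S2) (auto simp: inner_S2_def power2_eq_square)
    then show ?thesis using m by (simp add: y_def inner_Y)
  qed
  have noise_int: "(\<integral>\<^sup>+U. ennreal (noise U) \<partial>locations_law) = ?N"
  proof -
    have "(\<integral>\<^sup>+U. ennreal (noise U) \<partial>locations_law) = (\<integral>\<^sup>+U. (\<Sum>k\<in>I. ?e k (y (U k))) \<partial>locations_law)"
      unfolding noise_def by (subst sum_ennreal) auto
    also have "\<dots> = (\<Sum>k\<in>I. \<integral>\<^sup>+U. ?e k (y (U k)) \<partial>locations_law)"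
    proof (rule nn_integral_sum)
      fix k assume "k \<in> I"
      then have "(\<lambda>U. y (U k)) \<in> borel_measurable locations_law"
        by (intro continuous_at_site_measurable y)
      then show "(\<lambda>U. ?e k (y (U k))) \<in> borel_measurable locations_law" by measurable
    qed
    also have "\<dots> = (\<Sum>k\<in>I. ennreal ((w k)\<^sup>2 * \<sigma>\<^sup>2 * (1 / (4 * pi))))"
    proof (rule sum.cong[OF refl])
      fix k assume k: "k \<in> I"
      have "(\<lambda>u. ?e k (y u)) \<in> borel_measurable unif_S2"
        using continuous_unif_S2(1)[OF y] by measurable
      then have "(\<integral>\<^sup>+U. ?e k (y (U k)) \<partial>locations_law) = (\<integral>\<^sup>+u. ?e k (y u) \<partial>unif_S2)"
        by (rule nn_integral_PiM_component[OF prob_space_unif_S2 k])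
      also have "\<dots> = ennreal (LINT u|unif_S2. (w k)\<^sup>2 * \<sigma>\<^sup>2 * (y u)\<^sup>2)"
        using continuous_unif_S2(3)[OF y] by (intro nn_integral_eq_integral) auto
      finally show "(\<integral>\<^sup>+U. ?e k (y (U k)) \<partial>locations_law) = ennreal ((w k)\<^sup>2 * \<sigma>\<^sup>2 * (1 / (4 * pi)))"
        by (simp add: y_square)
    qed
    also have "\<dots> = ennreal (\<Sum>k\<in>I. (w k)\<^sup>2 * \<sigma>\<^sup>2 * (1 / (4 * pi)))" by (rule sum_ennreal) auto
    also have "(\<Sum>k\<in>I. (w k)\<^sup>2 * \<sigma>\<^sup>2 * (1 / (4 * pi))) = weight_energy * (\<sigma>\<^sup>2 / (4 * pi))"
      by (simp add: weight_energy_def sum_distrib_right sum_divide_distrib)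
    finally show ?thesis .
  qed
  have sites: "(\<integral>\<^sup>+U. ennreal ((A X U)\<^sup>2) \<partial>locations_law) \<le> ennreal ((C X)\<^sup>2 + WD X)" if X: "X \<in> space curves_law" for X
  proof -
    have Xk: "X (fst k) \<in> space P" if "k \<in> I" for k
      using X index_curve[OF that] by (auto simp: space_PiM)
    define g where "g k u = (X (fst k) u - \<mu> u) * y u" for k :: "nat \<times> nat" and u
    have g: "continuous_on S2 (g k)" if "k \<in> I" for k
      unfolding g_def[abs_def] by (intro continuous_intros curve_diff_continuous[OF Xk[OF that]] y)
    define mg where "mg k = (LINT u|unif_S2. g k u)" for k
    have mg: "mg k = c (X (fst k)) / (4 * pi)" if k: "k \<in> I" for k
      unfolding mg_def using L2_S2_measurable[OF continuous_L2_S2[OF g[OF k]]]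
      by (subst integral_unif_S2) (auto simp: c_def inner_S2_def g_def[abs_def])
    have CX: "(\<Sum>k\<in>I. w k * mg k) = C X"
    proof -
      have "(\<Sum>k\<in>I. w k * mg k) = (\<Sum>k\<in>I. w k * (c (X (fst k)) / (4 * pi)))" by (simp add: mg)
      also have "\<dots> = 4 * pi / real n * (\<Sum>i=1..n. c (X i) / (4 * pi))"
        by (rule sum_weight_row[where G = "\<lambda>i. c (X i) / (4 * pi)"])
      finally show ?thesis by (simp add: C_def sum_distrib_left)
    qed
    note cent = integral_centered_square_le[OF prob_space_unif_S2 continuous_unif_S2(3)[OF g] continuous_unif_S2(1)[OF g]]
    have "A X U = C X + (\<Sum>k\<in>I. w k * (g k (U k) - mg k))" for U
      unfolding A_def CX[symmetric] sum.distrib[symmetric]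
      by (intro sum.cong refl) (simp add: g_def algebra_simps)
    then have "(\<integral>\<^sup>+U. ennreal ((A X U)\<^sup>2) \<partial>locations_law)
       = (\<integral>\<^sup>+U. ennreal ((C X + (\<Sum>k\<in>I. w k * (g k (U k) - mg k)))\<^sup>2) \<partial>locations_law)" by simp
    also have "\<dots> = ennreal ((C X)\<^sup>2 + (\<Sum>k\<in>I. LINT u|unif_S2. (w k * (g k u - mg k))\<^sup>2))"
      using cent(1,2) continuous_unif_S2(1)[OF g] unfolding mg_def
      by (intro nn_integral_PiM_sum_square[OF prob_space_unif_S2 finite_obs_index]) (auto simp del: power_mult_distrib)
    also have "\<dots> \<le> ennreal ((C X)\<^sup>2 + WD X)"
      using cent(3) unfolding WD_def mg_def weighted_deviation_def g_def
      by (intro ennreal_leI add_mono order_refl sum_mono) auto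
    finally show ?thesis .
  qed
  have meas_c: "c \<in> borel_measurable P"
    unfolding c_def[abs_def] y_def by (rule centered_coefficient_measurable[OF m])
  have int_c: "integrable P (\<lambda>f. (c f)\<^sup>2)" and mean_c: "(LINT f|P. c f) = 0"
    unfolding c_def y_def using centered_coefficient_integrable[OF m] centered_coefficient_mean[OF m] by auto
  have meas_wd: "weighted_deviation y \<in> borel_measurable P" by (rule weighted_deviation_measurable[OF y_meas])
  have meas_A: "(\<lambda>U. ennreal ((A X U)\<^sup>2)) \<in> borel_measurable locations_law" if X: "X \<in> space curves_law" for X
  proof -
    have "(\<lambda>U. (X (fst k) (U k) - \<mu> (U k)) * y (U k)) \<in> borel_measurable locations_law" if k: "k \<in> I" for k
    proof -
      have "X (fst k) \<in> space P" using X index_curve[OF k] by (auto simp: space_PiM)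
      then have "continuous_on S2 (\<lambda>u. (X (fst k) u - \<mu> u) * y u)"
        by (intro continuous_intros curve_diff_continuous y)
      from continuous_at_site_measurable[OF k this] show ?thesis .
    qed
    then have "(\<lambda>U. A X U) \<in> borel_measurable locations_law" unfolding A_def by measurable
    then show ?thesis by measurable
  qed
  have meas_noise: "(\<lambda>U. ennreal (noise U)) \<in> borel_measurable locations_law"
  proof -
    have "(\<lambda>U. y (U k)) \<in> borel_measurable locations_law" if "k \<in> I" for k
      using that by (intro continuous_at_site_measurable y)
    then have "noise \<in> borel_measurable locations_law" unfolding noise_def[abs_def] by measurable
    then show ?thesis by measurable
  qed
  have meas_C: "C \<in> borel_measurable curves_law"
    unfolding C_def[abs_def]
    by (intro borel_measurable_sum borel_measurable_divide borel_measurable_const curve_functional_measurable meas_c)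
  have meas_wdk: "(\<lambda>X. weighted_deviation y (X (fst k))) \<in> borel_measurable curves_law" if "k \<in> I" for k
    by (intro curve_functional_measurable index_curve[OF that] meas_wd)
  have "(\<integral>\<^sup>+\<omega>. ?s \<omega> \<partial>\<Omega>)
    = (\<integral>\<^sup>+X. \<integral>\<^sup>+U. ennreal ((A X U)\<^sup>2) + ennreal (noise U) \<partial>locations_law \<partial>curves_law)"
    using score_measurable[OF lm] by (subst nn_integral_sample_law) (auto simp: errors)
  also have "\<dots> \<le> (\<integral>\<^sup>+X. ennreal ((C X)\<^sup>2) + (\<Sum>k\<in>I. ?d k (X (fst k)))
       + ?N \<partial>curves_law)"
  proof (rule nn_integral_mono)
    fix X assume X: "X \<in> space curves_law"
    have "(\<integral>\<^sup>+U. ennreal ((A X U)\<^sup>2) + ennreal (noise U) \<partial>locations_law)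
       = (\<integral>\<^sup>+U. ennreal ((A X U)\<^sup>2) \<partial>locations_law) + ?N"
      using meas_A[OF X] meas_noise by (subst nn_integral_add) (auto simp: noise_int)
    also have "\<dots> \<le> ennreal ((C X)\<^sup>2 + WD X) + ?N"
      by (intro add_mono sites[OF X] order_refl)
    also have "ennreal ((C X)\<^sup>2 + WD X) = ennreal ((C X)\<^sup>2) + (\<Sum>k\<in>I. ?d k (X (fst k)))"
      unfolding WD_def by (subst sum_ennreal) (auto intro!: ennreal_plus sum_nonneg simp: weighted_deviation_ge_0)
    finally show "(\<integral>\<^sup>+U. ennreal ((A X U)\<^sup>2) + ennreal (noise U) \<partial>locations_law)
       \<le> ennreal ((C X)\<^sup>2) + (\<Sum>k\<in>I. ?d k (X (fst k))) + ?N" .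
  qed
  also have "\<dots> = (\<integral>\<^sup>+X. ennreal ((C X)\<^sup>2) \<partial>curves_law)
      + (\<Sum>k\<in>I. \<integral>\<^sup>+X. ?d k (X (fst k)) \<partial>curves_law) + ?N"
  proof -
    have 1: "(\<lambda>X. ?d k (X (fst k))) \<in> borel_measurable curves_law" if "k \<in> I" for k
      using meas_wdk[OF that] by measurable
    have 2: "(\<lambda>X. ennreal ((C X)\<^sup>2)) \<in> borel_measurable curves_law" using meas_C by measurable
    show ?thesis using 1 2
      by (simp add: nn_integral_add nn_integral_sum curves.emeasure_space_1 borel_measurable_sum del: One_nat_def)
  qed
  also have "(\<integral>\<^sup>+X. ennreal ((C X)\<^sup>2) \<partial>curves_law) = (\<integral>\<^sup>+f. ennreal ((c f)\<^sup>2 / real n) \<partial>P)"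
  proof -
    have "(\<integral>\<^sup>+X. ennreal ((C X)\<^sup>2) \<partial>curves_law) = (\<integral>\<^sup>+X. ennreal ((0 + (\<Sum>i=1..n. c (X i) / real n))\<^sup>2) \<partial>curves_law)"
      by (simp add: C_def)
    also have "\<dots> = ennreal (0\<^sup>2 + (\<Sum>i=1..n. LINT f|P. (c f / real n)\<^sup>2))"
      using meas_c int_c mean_c by (intro nn_integral_PiM_sum_square[OF prob_P]) (auto simp: power_divide)
    also have "(\<Sum>i=1..n. LINT f|P. (c f / real n)\<^sup>2) = (LINT f|P. (c f)\<^sup>2 / real n)"
      using n by (simp add: power_divide power2_eq_square)
    also have "ennreal (0\<^sup>2 + (LINT f|P. (c f)\<^sup>2 / real n)) = (\<integral>\<^sup>+f. ennreal ((c f)\<^sup>2 / real n) \<partial>P)"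
      using int_c by (subst nn_integral_eq_integral) auto
    finally show ?thesis .
  qed
  also have "(\<Sum>k\<in>I. \<integral>\<^sup>+X. ?d k (X (fst k)) \<partial>curves_law)
      = (\<integral>\<^sup>+f. ennreal (weight_energy * weighted_deviation y f) \<partial>P)"
  proof -
    have meas: "(\<lambda>f. ?d k f) \<in> borel_measurable P" for k
      using meas_wd by measurable
    have "(\<Sum>k\<in>I. \<integral>\<^sup>+X. ?d k (X (fst k)) \<partial>curves_law)
       = (\<Sum>k\<in>I. \<integral>\<^sup>+f. ?d k f \<partial>P)"
      by (intro sum.cong refl nn_integral_PiM_component[OF prob_P index_curve meas])
    also have "\<dots> = (\<integral>\<^sup>+f. (\<Sum>k\<in>I. ?d k f) \<partial>P)"
      using meas by (subst nn_integral_sum) auto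
    also have "\<dots> = (\<integral>\<^sup>+f. ennreal (weight_energy * weighted_deviation y f) \<partial>P)"
      by (intro nn_integral_cong) (simp add: weight_energy_def sum_distrib_right weighted_deviation_ge_0)
    finally show ?thesis .
  qed
  also have "(\<integral>\<^sup>+f. ennreal ((c f)\<^sup>2 / real n) \<partial>P) + (\<integral>\<^sup>+f. ennreal (weight_energy * weighted_deviation y f) \<partial>P)
      + ?N
    = (\<integral>\<^sup>+f. ennreal ((c f)\<^sup>2 / real n) + ennreal (weight_energy * weighted_deviation y f) + ?N \<partial>P)"
    using meas_c meas_wd by (simp add: nn_integral_add P.emeasure_space_1)
  also have "\<dots> = (\<integral>\<^sup>+f. ennreal (weight_energy * (weighted_deviation y f + \<sigma>\<^sup>2 / (4 * pi)) + (c f)\<^sup>2 / real n) \<partial>P)"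
  proof (rule nn_integral_cong)
    fix f
    have "0 \<le> weight_energy * weighted_deviation y f" "0 \<le> weight_energy * (\<sigma>\<^sup>2 / (4 * pi))" "0 \<le> (c f)\<^sup>2 / real n"
      using weight_energy_ge_0 weighted_deviation_ge_0 by auto
    then show "ennreal ((c f)\<^sup>2 / real n) + ennreal (weight_energy * weighted_deviation y f) + ?N
      = ennreal (weight_energy * (weighted_deviation y f + \<sigma>\<^sup>2 / (4 * pi)) + (c f)\<^sup>2 / real n)"
      by (simp only: ennreal_plus[symmetric] add_nonneg_nonneg distrib_left) (simp add: add_ac)
  qed
  finally show ?thesis unfolding c_def y_def .
qed

text \<open>The weights sum to \<open>4 pi\<close>, so the Gram error is a weighted sum of centred independent terms, one for each
  location.\<close>

lemma gram_error_moment: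
  assumes a: "a \<in> indices L" and b: "b \<in> indices L"
  shows "(\<integral>\<^sup>+\<omega>. ennreal ((gram_error I w (site \<omega>) a b)\<^sup>2) \<partial>\<Omega>)
    \<le> ennreal (weight_energy * (LINT u|unif_S2. (basis_fun a u)\<^sup>2 * (basis_fun b u)\<^sup>2))"
proof -
  define g where "g u = basis_fun a u * basis_fun b u" for u
  have orders: "snd a \<in> orders (fst a)" "snd b \<in> orders (fst b)" using a b by (auto simp: indices_def)
  have g: "continuous_on S2 g" unfolding g_def[abs_def] by (intro continuous_intros continuous_Y orders)
  define mg where "mg = (LINT u|unif_S2. g u)"
  have "mg = inner_S2 (basis_fun a) (basis_fun b) / (4 * pi)"
    unfolding mg_def using L2_S2_measurable[OF continuous_L2_S2[OF g]]
    by (subst integral_unif_S2) (auto simp: inner_S2_def g_def[abs_def])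
  then have mg: "4 * pi * mg = (if a = b then 1 else 0)"
    using orders by (simp add: inner_Y prod_eq_iff)
  note cent = integral_centered_square_le[OF prob_space_unif_S2 continuous_unif_S2(3)[OF g] continuous_unif_S2(1)[OF g], folded mg_def]
  have eq: "gram_error I w U a b = 0 + (\<Sum>k\<in>I. w k * (g (U k) - mg))" for U
    unfolding gram_error_def mg[symmetric] sum_weight[symmetric] sum_distrib_right
    by (simp add: g_def algebra_simps sum_subtractf)
  have "(\<integral>\<^sup>+\<omega>. ennreal ((gram_error I w (site \<omega>) a b)\<^sup>2) \<partial>\<Omega>)
     = (\<integral>\<^sup>+X. \<integral>\<^sup>+U. \<integral>\<^sup>+e. ennreal ((gram_error I w U a b)\<^sup>2) \<partial>errors_law \<partial>locations_law \<partial>curves_law)"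
    using gram_error_measurable[OF a b] by (subst nn_integral_sample_law) (auto simp: site_eq[abs_def])
  also have "\<dots> = (\<integral>\<^sup>+U. ennreal ((0 + (\<Sum>k\<in>I. w k * (g (U k) - mg)))\<^sup>2) \<partial>locations_law)"
    by (simp add: errors.emeasure_space_1 curves.emeasure_space_1 eq del: One_nat_def)
  also have "\<dots> = ennreal (0\<^sup>2 + (\<Sum>k\<in>I. LINT u|unif_S2. (w k * (g u - mg))\<^sup>2))"
    using cent(1,2) continuous_unif_S2(1)[OF g]
    by (intro nn_integral_PiM_sum_square[OF prob_space_unif_S2 finite_obs_index]) (auto simp del: power_mult_distrib)
  also have "\<dots> \<le> ennreal (\<Sum>k\<in>I. (w k)\<^sup>2 * (LINT u|unif_S2. (g u)\<^sup>2))"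
    using cent(3) by (intro ennreal_leI) (auto intro!: sum_mono)
  also have "(\<Sum>k\<in>I. (w k)\<^sup>2 * (LINT u|unif_S2. (g u)\<^sup>2)) = weight_energy * (LINT u|unif_S2. (basis_fun a u)\<^sup>2 * (basis_fun b u)\<^sup>2)"
    by (simp add: weight_energy_def sum_distrib_right g_def power_mult_distrib)
  finally show ?thesis .
qed

end

section \<open>Tail bound\<close>

text \<open>Markov's inequality for an increasing limit, by monotone convergence. It turns moment bounds that are
  uniform in the truncation level into bounds for all levels simultaneously.\<close>

lemma Markov_SUP:
  fixes f :: "nat \<Rightarrow> 'a \<Rightarrow> ennreal"
  assumes f: "\<And>L. f L \<in> borel_measurable N" and inc: "\<And>x. incseq (\<lambda>L. f L x)"
    and B: "\<And>L. (\<integral>\<^sup>+x. f L x \<partial>N) \<le> B"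
  shows "{x \<in> space N. 1 \<le> c * (SUP L. f L x)} \<in> sets N"
    and "emeasure N {x \<in> space N. 1 \<le> c * (SUP L. f L x)} \<le> c * B"
proof -
  have meas: "(\<lambda>x. SUP L. f L x) \<in> borel_measurable N" using f by (intro borel_measurable_SUP) auto
  then show "{x \<in> space N. 1 \<le> c * (SUP L. f L x)} \<in> sets N" by measurable
  have "emeasure N {x \<in> space N. 1 \<le> c * (SUP L. f L x)}
      \<le> c * (\<integral>\<^sup>+x. (SUP L. f L x) * indicator (space N) x \<partial>N)"
    by (rule nn_integral_Markov_inequality) (use meas in auto)
  also have "(\<integral>\<^sup>+x. (SUP L. f L x) * indicator (space N) x \<partial>N) = (\<integral>\<^sup>+x. (SUP L. f L x) \<partial>N)"
    by (intro nn_integral_cong) simp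
  also have "\<dots> = (SUP L. \<integral>\<^sup>+x. f L x \<partial>N)"
    using inc by (intro nn_integral_monotone_convergence_SUP f) (auto simp: incseq_def le_fun_def)
  also have "c * \<dots> \<le> c * B" by (intro mult_left_mono SUP_least B) auto
  finally show "emeasure N {x \<in> space N. 1 \<le> c * (SUP L. f L x)} \<le> c * B" .
qed

context sampling_design begin

text \<open>The value of \<open>\<Sum> Y\<^sub>a(u)\<^sup>2 / \<lambda>\<^sub>a\<close> over the indices below \<open>L\<close>, which is the same for all points \<open>u\<close> by the
  addition theorem.\<close>

definition kernel_diagonal :: "real \<Rightarrow> nat \<Rightarrow> real" where
  "kernel_diagonal \<eta> L = (\<Sum>l<L. (2 * real l + 1) / (1 + \<eta> * (d l)\<^sup>2)) / (4 * pi)"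

lemma shrinkage_pos: "\<eta> > 0 \<Longrightarrow> 0 < shrinkage \<eta> a"
  using shrinkage_ge_1[of \<eta> a] by linarith

lemma sum_kernel_diagonal:
  assumes "u \<in> S2"
  shows "(\<Sum>a\<in>indices L. (basis_fun a u)\<^sup>2 / shrinkage \<eta> a) = kernel_diagonal \<eta> L"
proof -
  have "(\<Sum>a\<in>indices L. (basis_fun a u)\<^sup>2 / shrinkage \<eta> a)
      = (\<Sum>l<L. \<Sum>m\<in>orders l. (Y l m u)\<^sup>2 / (1 + \<eta> * (d l)\<^sup>2))"
    unfolding shrinkage_def by (rule sum_indices[where F = "\<lambda>l m. (Y l m u)\<^sup>2 / (1 + \<eta> * (d l)\<^sup>2)"])
  also have "\<dots> = kernel_diagonal \<eta> L"
    unfolding kernel_diagonal_def sum_divide_distrib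
    by (intro sum.cong refl) (simp add: sum_divide_distrib[symmetric] addition_theorem[OF assms])
  finally show ?thesis .
qed

lemma sum_inverse_shrinkage: "(\<Sum>a\<in>indices L. 1 / shrinkage \<eta> a) = 4 * pi * kernel_diagonal \<eta> L"
proof -
  have "(\<Sum>a\<in>indices L. 1 / shrinkage \<eta> a) = (\<Sum>l<L. \<Sum>m\<in>orders l. 1 / (1 + \<eta> * (d l)\<^sup>2))"
    unfolding shrinkage_def by (rule sum_indices[where F = "\<lambda>l m. 1 / (1 + \<eta> * (d l)\<^sup>2)"])
  then show ?thesis by (simp add: kernel_diagonal_def)
qed

lemma kernel_diagonal_ge_0: "\<eta> > 0 \<Longrightarrow> 0 \<le> kernel_diagonal \<eta> L"
  unfolding kernel_diagonal_def by (intro divide_nonneg_pos sum_nonneg) (auto intro!: add_pos_nonneg)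

text \<open>Since the kernel diagonal is constant, summing the weighted deviations over the basis gives a multiple of
  the plain deviation. In the term with factor \<open>1/n\<close> the shrinkage is dropped and Bessel's inequality used.\<close>

lemma curve_risk_le:
  assumes f: "f \<in> space P" and \<eta>: "\<eta> > 0"
  shows "(\<Sum>a\<in>indices L. (weight_energy * (weighted_deviation (basis_fun a) f + \<sigma>\<^sup>2 / (4 * pi))
            + (inner_S2 (\<lambda>u. f u - \<mu> u) (basis_fun a))\<^sup>2 / real n) / shrinkage \<eta> a)
    \<le> weight_energy * kernel_diagonal \<eta> L * \<sigma>\<^sup>2
        + (weight_energy * kernel_diagonal \<eta> L / (4 * pi) + 1 / real n) * deviation f"
proof -
  let ?k = "kernel_diagonal \<eta> L" and ?g = "\<lambda>u. f u - \<mu> u"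
  have lam: "shrinkage \<eta> a \<ge> 1" "shrinkage \<eta> a > 0" for a using shrinkage_ge_1[of \<eta> a] \<eta> by auto
  have g: "continuous_on S2 ?g" by (rule curve_diff_continuous[OF f])
  have int: "integrable unif_S2 (\<lambda>u. (?g u * basis_fun a u)\<^sup>2)" if "a \<in> indices L" for a
    using that by (intro continuous_unif_S2(3) continuous_intros g continuous_Y) (auto simp: indices_def)
  have 1: "(\<Sum>a\<in>indices L. weighted_deviation (basis_fun a) f / shrinkage \<eta> a) = ?k * (deviation f / (4 * pi))"
  proof -
    have "(\<Sum>a\<in>indices L. weighted_deviation (basis_fun a) f / shrinkage \<eta> a)
        = (LINT u|unif_S2. (\<Sum>a\<in>indices L. (?g u * basis_fun a u)\<^sup>2 / shrinkage \<eta> a))"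
      unfolding weighted_deviation_def using int by (subst Bochner_Integration.integral_sum) auto
    also have "\<dots> = (LINT u|unif_S2. (?g u)\<^sup>2 * ?k)"
    proof (rule Bochner_Integration.integral_cong[OF refl])
      fix u assume "u \<in> space unif_S2"
      then have u: "u \<in> S2" by simp
      show "(\<Sum>a\<in>indices L. (?g u * basis_fun a u)\<^sup>2 / shrinkage \<eta> a) = (?g u)\<^sup>2 * ?k"
        unfolding sum_kernel_diagonal[OF u, symmetric] sum_distrib_left
        by (intro sum.cong refl) (simp add: power_mult_distrib)
    qed
    also have "\<dots> = (LINT u|surf. (?g u)\<^sup>2) / (4 * pi) * ?k"
      using L2_S2_measurable[OF continuous_L2_S2[OF g]]
      by (simp add: integral_unif_S2)
    finally show ?thesis by (simp add: deviation_def inner_S2_def power2_eq_square)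
  qed
  have 2: "(\<Sum>a\<in>indices L. (inner_S2 ?g (basis_fun a))\<^sup>2 / shrinkage \<eta> a) \<le> deviation f"
  proof -
    have "(\<Sum>a\<in>indices L. (inner_S2 ?g (basis_fun a))\<^sup>2 / shrinkage \<eta> a) \<le> (\<Sum>a\<in>indices L. (inner_S2 ?g (basis_fun a))\<^sup>2)"
    proof (rule sum_mono)
      fix a
      show "(inner_S2 ?g (basis_fun a))\<^sup>2 / shrinkage \<eta> a \<le> (inner_S2 ?g (basis_fun a))\<^sup>2"
        using mult_left_mono[OF lam(1)[of a], of "(inner_S2 ?g (basis_fun a))\<^sup>2"] lam(2)[of a]
        by (simp add: divide_le_eq)
    qed
    also have "\<dots> = (\<Sum>l<L. energy ?g l)"
      unfolding energy_def by (rule sum_indices[where F = "\<lambda>l m. (inner_S2 ?g (Y l m))\<^sup>2"])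
    also have "\<dots> \<le> deviation f"
      unfolding deviation_def sums_unique[OF parseval[OF continuous_L2_S2[OF g]]]
      using energy_ge_0 by (intro sum_le_suminf sums_summable[OF parseval[OF continuous_L2_S2[OF g]]]) auto
    finally show ?thesis .
  qed
  have "(\<Sum>a\<in>indices L. (weight_energy * (weighted_deviation (basis_fun a) f + \<sigma>\<^sup>2 / (4 * pi))
            + (inner_S2 ?g (basis_fun a))\<^sup>2 / real n) / shrinkage \<eta> a)
     = (\<Sum>a\<in>indices L. weight_energy * (weighted_deviation (basis_fun a) f / shrinkage \<eta> a)
          + weight_energy * (\<sigma>\<^sup>2 / (4 * pi)) * (1 / shrinkage \<eta> a)
          + ((inner_S2 ?g (basis_fun a))\<^sup>2 / shrinkage \<eta> a) / real n)"
    by (intro sum.cong refl) (simp add: add_divide_distrib distrib_left)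
  also have "\<dots> = weight_energy * (?k * (deviation f / (4 * pi))) + weight_energy * (\<sigma>\<^sup>2 / (4 * pi)) * (4 * pi * ?k)
          + (\<Sum>a\<in>indices L. (inner_S2 ?g (basis_fun a))\<^sup>2 / shrinkage \<eta> a) / real n"
    by (simp only: sum.distrib sum_distrib_left[symmetric] sum_divide_distrib[symmetric] 1 sum_inverse_shrinkage)
  also have "\<dots> \<le> weight_energy * (?k * (deviation f / (4 * pi))) + weight_energy * (\<sigma>\<^sup>2 / (4 * pi)) * (4 * pi * ?k)
          + deviation f / real n"
    by (intro add_mono order_refl divide_right_mono 2) auto
  also have "\<dots> = weight_energy * ?k * \<sigma>\<^sup>2 + (weight_energy * ?k / (4 * pi) + 1 / real n) * deviation f"
    by (simp add: distrib_right)
  finally show ?thesis .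
qed

lemma deviation_measurable: "deviation \<in> borel_measurable P"
proof -
  have "(\<lambda>f. \<Sum>l. \<Sum>m\<in>orders l. (inner_S2 (\<lambda>u. f u - \<mu> u) (Y l m))\<^sup>2) \<in> borel_measurable P"
    by (intro borel_measurable_suminf borel_measurable_sum borel_measurable_power centered_coefficient_measurable)
  moreover have "deviation f = (\<Sum>l. \<Sum>m\<in>orders l. (inner_S2 (\<lambda>u. f u - \<mu> u) (Y l m))\<^sup>2)" if "f \<in> space P" for f
    using sums_unique[OF parseval[OF continuous_L2_S2[OF curve_diff_continuous[OF that]]]]
    by (simp add: deviation_def energy_def[abs_def])
  ultimately show ?thesis by (subst measurable_cong) auto
qed

lemma score_energy_moment:
  assumes \<eta>: "\<eta> > 0"
  shows "(\<integral>\<^sup>+\<omega>. ennreal (score_energy \<eta> I w (residual \<omega>) (site \<omega>) L) \<partial>\<Omega>)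
    \<le> ennreal (weight_energy * kernel_diagonal \<eta> L * \<sigma>\<^sup>2
        + (weight_energy * kernel_diagonal \<eta> L / (4 * pi) + 1 / real n) * (2 * M + 2 * K))"
proof -
  let ?s = "\<lambda>a \<omega>. ennreal ((score I w (residual \<omega>) (site \<omega>) a)\<^sup>2)"
  let ?E = "\<lambda>\<omega>. ennreal (score_energy \<eta> I w (residual \<omega>) (site \<omega>) L)"
  let ?l = "\<lambda>a. ennreal (1 / shrinkage \<eta> a)"
  let ?k = "kernel_diagonal \<eta> L"
  let ?Q = "\<lambda>a f. weight_energy * (weighted_deviation (basis_fun a) f + \<sigma>\<^sup>2 / (4 * pi))
            + (inner_S2 (\<lambda>u. f u - \<mu> u) (basis_fun a))\<^sup>2 / real n"
  let ?A = "weight_energy * ?k * \<sigma>\<^sup>2" and ?B = "weight_energy * ?k / (4 * pi) + 1 / real n"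
  have lam: "shrinkage \<eta> a > 0" for a using shrinkage_pos[OF \<eta>] .
  have Q0: "0 \<le> ?Q a f" for a f using weight_energy_ge_0 weighted_deviation_ge_0[of "basis_fun a" f] by auto
  have measQ: "(\<lambda>f. ennreal (?Q a f)) \<in> borel_measurable P" if "a \<in> indices L" for a
  proof -
    have m: "snd a \<in> orders (fst a)" using that by (auto simp: indices_def)
    show ?thesis
      using weighted_deviation_measurable[OF Y_measurable[OF m]] centered_coefficient_measurable[OF m] by measurable
  qed
  have "(\<integral>\<^sup>+\<omega>. ?E \<omega> \<partial>\<Omega>)
     = (\<integral>\<^sup>+\<omega>. (\<Sum>a\<in>indices L. ?l a * ?s a \<omega>) \<partial>\<Omega>)"
  proof (rule nn_integral_cong)
    fix \<omega>
    show "?E \<omega>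
       = (\<Sum>a\<in>indices L. ?l a * ?s a \<omega>)"
      unfolding score_energy_def using lam
      by (subst sum_ennreal[symmetric]) (auto simp: ennreal_mult'[symmetric] less_imp_le)
  qed
  also have "\<dots> = (\<Sum>a\<in>indices L. ?l a * (\<integral>\<^sup>+\<omega>. ?s a \<omega> \<partial>\<Omega>))"
  proof (subst nn_integral_sum)
    show "(\<lambda>\<omega>. ?l a * ?s a \<omega>) \<in> borel_measurable \<Omega>"
      if "a \<in> indices L" for a using score_measurable[OF that] by measurable
    show "(\<Sum>a\<in>indices L. \<integral>\<^sup>+\<omega>. ?l a * ?s a \<omega> \<partial>\<Omega>)
      = (\<Sum>a\<in>indices L. ?l a * (\<integral>\<^sup>+\<omega>. ?s a \<omega> \<partial>\<Omega>))"
    proof (intro sum.cong refl nn_integral_cmult)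
      show "(\<lambda>\<omega>. ?s a \<omega>) \<in> borel_measurable \<Omega>" if "a \<in> indices L" for a
        using score_measurable[OF that] by measurable
    qed
  qed
  also have "\<dots> \<le> (\<Sum>a\<in>indices L. ?l a * (\<integral>\<^sup>+f. ennreal (?Q a f) \<partial>P))"
  proof (intro sum_mono mult_left_mono)
    fix a assume "a \<in> indices L"
    then have "snd a \<in> orders (fst a)" by (auto simp: indices_def)
    from score_moment[OF this]
    show "(\<integral>\<^sup>+\<omega>. ?s a \<omega> \<partial>\<Omega>) \<le> (\<integral>\<^sup>+f. ennreal (?Q a f) \<partial>P)" by simp
  qed auto
  also have "\<dots> = (\<Sum>a\<in>indices L. \<integral>\<^sup>+f. ?l a * ennreal (?Q a f) \<partial>P)"
    by (intro sum.cong refl nn_integral_cmult[symmetric] measQ)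
  also have "\<dots> = (\<integral>\<^sup>+f. (\<Sum>a\<in>indices L. ?l a * ennreal (?Q a f)) \<partial>P)"
    by (subst nn_integral_sum) (auto intro!: borel_measurable_times_ennreal measQ)
  also have "\<dots> = (\<integral>\<^sup>+f. ennreal (\<Sum>a\<in>indices L. ?Q a f / shrinkage \<eta> a) \<partial>P)"
  proof (rule nn_integral_cong)
    fix f
    show "(\<Sum>a\<in>indices L. ?l a * ennreal (?Q a f)) = ennreal (\<Sum>a\<in>indices L. ?Q a f / shrinkage \<eta> a)"
      using lam Q0[of _ f] by (subst sum_ennreal[symmetric]) (auto simp: ennreal_mult'[symmetric] less_imp_le intro!: divide_nonneg_pos)
  qed
  also have "\<dots> \<le> (\<integral>\<^sup>+f. ennreal (?A)
        + ennreal (?B) * ennreal (deviation f) \<partial>P)"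
  proof (rule nn_integral_mono)
    fix f assume f: "f \<in> space P"
    have "ennreal (\<Sum>a\<in>indices L. ?Q a f / shrinkage \<eta> a)
      \<le> ennreal (?A + (?B) * deviation f)"
      by (rule ennreal_leI[OF curve_risk_le[OF f \<eta>]])
    also have "\<dots> = ennreal (?A) + ennreal (?B) * ennreal (deviation f)"
      using weight_energy_ge_0 kernel_diagonal_ge_0[OF \<eta>] deviation_ge_0
      by (subst ennreal_mult[symmetric]) (auto intro!: ennreal_plus mult_nonneg_nonneg)
    finally show "ennreal (\<Sum>a\<in>indices L. ?Q a f / shrinkage \<eta> a)
      \<le> ennreal (?A) + ennreal (?B) * ennreal (deviation f)" .
  qed
  also have "\<dots> = ennreal (?A)
        + ennreal (?B) * (\<integral>\<^sup>+f. ennreal (deviation f) \<partial>P)"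
    using deviation_measurable by (simp add: nn_integral_add nn_integral_cmult P.emeasure_space_1)
  also have "\<dots> \<le> ennreal (?A)
        + ennreal (?B) * ennreal (2 * M + 2 * K)"
    by (intro add_mono mult_left_mono deviation_nn_integral) auto
  also have "\<dots> = ennreal (?A + (?B) * (2 * M + 2 * K))"
    using weight_energy_ge_0 kernel_diagonal_ge_0[OF \<eta>] M K
    by (subst ennreal_mult[symmetric]) (auto intro!: ennreal_plus[symmetric] mult_nonneg_nonneg)
  finally show ?thesis .
qed

lemma gram_energy_moment:
  assumes \<eta>: "\<eta> > 0"
  shows "(\<integral>\<^sup>+\<omega>. ennreal (gram_energy \<eta> I w (site \<omega>) L) \<partial>\<Omega>) \<le> ennreal (weight_energy * (kernel_diagonal \<eta> L)\<^sup>2)"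
proof -
  let ?g = "\<lambda>\<omega> a. (gram_error I w (site \<omega>) (fst a) (snd a))\<^sup>2"
  let ?b = "\<lambda>a u. (basis_fun (fst a) u)\<^sup>2 * (basis_fun (snd a) u)\<^sup>2"
  let ?J = "indices L \<times> indices L"
  let ?c = "\<lambda>a. 1 / (shrinkage \<eta> (fst a) * shrinkage \<eta> (snd a))"
  have lam: "shrinkage \<eta> a > 0" for a using shrinkage_pos[OF \<eta>] .
  have c: "?c a \<ge> 0" for a using lam[of "fst a"] lam[of "snd a"] by simp
  interpret U: prob_space unif_S2 by (rule prob_space_unif_S2)
  have "(\<integral>\<^sup>+\<omega>. ennreal (gram_energy \<eta> I w (site \<omega>) L) \<partial>\<Omega>)
     = (\<integral>\<^sup>+\<omega>. (\<Sum>a\<in>?J. ennreal (?c a) * ennreal (?g \<omega> a)) \<partial>\<Omega>)"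
  proof (rule nn_integral_cong)
    fix \<omega>
    have "gram_energy \<eta> I w (site \<omega>) L = (\<Sum>a\<in>?J. ?c a * ?g \<omega> a)"
      by (simp add: gram_energy_def sum.cartesian_product split_def)
    then show "ennreal (gram_energy \<eta> I w (site \<omega>) L)
       = (\<Sum>a\<in>?J. ennreal (?c a) * ennreal (?g \<omega> a))"
      using c by (simp add: ennreal_mult'[symmetric] sum_ennreal del: times_divide_eq_left)
  qed
  also have "\<dots> = (\<Sum>a\<in>?J. ennreal (?c a) * (\<integral>\<^sup>+\<omega>. ennreal (?g \<omega> a) \<partial>\<Omega>))"
  proof -
    have meas: "(\<lambda>\<omega>. ennreal (?g \<omega> a)) \<in> borel_measurable \<Omega>" if "a \<in> ?J" for a
      using gram_error_measurable[of "fst a" L "snd a"] that by (auto simp: mem_Times_iff)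
    then show ?thesis
      by (subst nn_integral_sum) (auto intro!: sum.cong nn_integral_cmult borel_measurable_times_ennreal)
  qed
  also have "\<dots> \<le> (\<Sum>a\<in>?J. ennreal (?c a) * ennreal (weight_energy * (LINT u|unif_S2. ?b a u)))"
    by (intro sum_mono mult_left_mono gram_error_moment[where L = L]) auto
  also have "\<dots> = ennreal (\<Sum>a\<in>?J. ?c a * (weight_energy * (LINT u|unif_S2. ?b a u)))"
  proof -
    have "0 \<le> weight_energy * (LINT u|unif_S2. ?b a u)" for a
      using weight_energy_ge_0 by (intro mult_nonneg_nonneg) auto
    then show ?thesis using c by (simp add: ennreal_mult[symmetric] sum_ennreal del: times_divide_eq_left)
  qed
  also have "(\<Sum>a\<in>?J. ?c a * (weight_energy * (LINT u|unif_S2. ?b a u)))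
     = weight_energy * (\<Sum>a\<in>?J. LINT u|unif_S2. ?c a * ?b a u)"
    by (simp add: sum_distrib_left)
  also have "(\<Sum>a\<in>?J. LINT u|unif_S2. ?c a * ?b a u)
     = (LINT u|unif_S2. (\<Sum>a\<in>?J. ?c a * ?b a u))"
  proof (rule Bochner_Integration.integral_sum[symmetric])
    fix a assume "a \<in> ?J"
    then have "continuous_on S2 (\<lambda>u. ?c a * ?b a u)"
      by (intro continuous_intros continuous_Y) (auto simp: indices_def)
    then show "integrable unif_S2 (\<lambda>u. ?c a * ?b a u)"
      by (rule continuous_unif_S2(2))
  qed
  also have "\<dots> = (LINT u|unif_S2. (kernel_diagonal \<eta> L)\<^sup>2)"
  proof (rule Bochner_Integration.integral_cong[OF refl])
    fix u assume "u \<in> space unif_S2"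
    then have u: "u \<in> S2" by simp
    show "(\<Sum>a\<in>?J. ?c a * ?b a u) = (kernel_diagonal \<eta> L)\<^sup>2"
      unfolding sum_kernel_diagonal[OF u, symmetric] power2_eq_square[of "sum _ _"] sum_product sum.cartesian_product
      by (intro sum.cong refl) (auto simp: split_def)
  qed
  also have "\<dots> = (kernel_diagonal \<eta> L)\<^sup>2" using U.prob_space by simp
  finally show ?thesis .
qed

lemma incseq_score_energy:
  assumes \<eta>: "\<eta> > 0"
  shows "incseq (\<lambda>L. ennreal (score_energy \<eta> I w Z U L))"
  unfolding score_energy_def using shrinkage_pos[OF \<eta>]
  by (intro monoI ennreal_leI sum_mono2 finite_indices) (auto simp: indices_def less_imp_le)

lemma incseq_gram_energy:
  assumes \<eta>: "\<eta> > 0"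
  shows "incseq (\<lambda>L. ennreal (gram_energy \<eta> I w U L))"
proof -
  have "gram_energy \<eta> I w U L = (\<Sum>a\<in>indices L \<times> indices L. (gram_error I w U (fst a) (snd a))\<^sup>2 / (shrinkage \<eta> (fst a) * shrinkage \<eta> (snd a)))" for L
    by (simp add: gram_energy_def sum.cartesian_product split_def)
  moreover have "0 < shrinkage \<eta> a * shrinkage \<eta> b" for a b using shrinkage_pos[OF \<eta>] by simp
  ultimately show ?thesis
    by (auto intro!: monoI ennreal_leI sum_mono2 finite_cartesian_product finite_indices simp: indices_def less_imp_le)
qed

text \<open>Outside the union of two measurable events, on which one of the two energies is large, the deterministic
  bound applies to the estimator; monotonicity of the measure then bounds the event in question.\<close>

lemma estimation_tail_bound:
  assumes \<eta>: "\<eta> > 0" and \<kappa>: "\<And>L. kernel_diagonal \<eta> L \<le> \<kappa>" and s: "s > 0"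
    and T: "64 * s + 16 * \<eta> * (C2\<^sup>2 * 2 powr p * K) \<le> T"
  shows "emeasure \<Omega> {\<omega> \<in> space \<Omega>. (norm_S2 (\<lambda>u. mean_estimator Y p \<D> n r \<eta> \<omega> u - \<mu> u))\<^sup>2 > T}
    \<le> ennreal (16 * (weight_energy * \<kappa>\<^sup>2)
        + (1 / s) * (weight_energy * \<kappa> * \<sigma>\<^sup>2 + (weight_energy * \<kappa> / (4 * pi) + 1 / real n) * (2 * M + 2 * K)))"
proof -
  let ?g = "\<lambda>L \<omega>. gram_energy \<eta> I w (site \<omega>) L" and ?s = "\<lambda>L \<omega>. score_energy \<eta> I w (residual \<omega>) (site \<omega>) L"
  let ?bad = "{\<omega> \<in> space \<Omega>. (norm_S2 (\<lambda>u. mean_estimator Y p \<D> n r \<eta> \<omega> u - \<mu> u))\<^sup>2 > T}"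
  define G where "G \<omega> = (SUP L. ennreal (?g L \<omega>))" for \<omega>
  define S where "S \<omega> = (SUP L. ennreal (?s L \<omega>))" for \<omega>
  define V where "V = weight_energy * \<kappa> * \<sigma>\<^sup>2 + (weight_energy * \<kappa> / (4 * pi) + 1 / real n) * (2 * M + 2 * K)"
  have \<kappa>0: "0 \<le> \<kappa>" using \<kappa>[of 0] kernel_diagonal_ge_0[OF \<eta>, of 0] by linarith
  have V0: "0 \<le> V"
    unfolding V_def using \<kappa>0 weight_energy_ge_0 M K by (intro add_nonneg_nonneg mult_nonneg_nonneg) auto
  have measG: "(\<lambda>\<omega>. ennreal (?g L \<omega>)) \<in> borel_measurable \<Omega>" for L
    unfolding gram_energy_def
    by (intro measurable_compose[OF _ measurable_ennreal] borel_measurable_sum borel_measurable_divide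
        borel_measurable_power gram_error_measurable borel_measurable_const)
  have measS: "(\<lambda>\<omega>. ennreal (?s L \<omega>)) \<in> borel_measurable \<Omega>" for L
    unfolding score_energy_def
    by (intro measurable_compose[OF _ measurable_ennreal] borel_measurable_sum borel_measurable_divide
        borel_measurable_power score_measurable borel_measurable_const)
  have intG: "(\<integral>\<^sup>+\<omega>. ennreal (?g L \<omega>) \<partial>\<Omega>) \<le> ennreal (weight_energy * \<kappa>\<^sup>2)" for L
  proof -
    have "ennreal (weight_energy * (kernel_diagonal \<eta> L)\<^sup>2) \<le> ennreal (weight_energy * \<kappa>\<^sup>2)"
      by (intro ennreal_leI mult_left_mono power_mono \<kappa> kernel_diagonal_ge_0[OF \<eta>] weight_energy_ge_0)
    with gram_energy_moment[OF \<eta>] show ?thesis by (rule order_trans)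
  qed
  have intS: "(\<integral>\<^sup>+\<omega>. ennreal (?s L \<omega>) \<partial>\<Omega>) \<le> ennreal V" for L
  proof -
    have "ennreal (weight_energy * kernel_diagonal \<eta> L * \<sigma>\<^sup>2
        + (weight_energy * kernel_diagonal \<eta> L / (4 * pi) + 1 / real n) * (2 * M + 2 * K)) \<le> ennreal V"
      unfolding V_def using M K weight_energy_ge_0 \<kappa>[of L]
      by (intro ennreal_leI add_mono mult_right_mono mult_left_mono divide_right_mono order_refl) auto
    with score_energy_moment[OF \<eta>] show ?thesis by (rule order_trans)
  qed
  \<comment> \<open>The factors normalise the thresholds \<open>1 / 16\<close> for the Gram energy and \<open>s\<close> for the score energy.\<close>
  let ?BG = "{\<omega> \<in> space \<Omega>. 1 \<le> 16 * G \<omega>}" and ?BS = "{\<omega> \<in> space \<Omega>. 1 \<le> ennreal (1 / s) * S \<omega>}"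
  note BG = Markov_SUP[OF measG incseq_gram_energy[OF \<eta>] intG, of 16, folded G_def]
  note BS = Markov_SUP[OF measS incseq_score_energy[OF \<eta>] intS, of "ennreal (1 / s)", folded S_def]
  have "?bad \<subseteq> ?BG \<union> ?BS"
  proof
    fix \<omega> assume \<omega>: "\<omega> \<in> ?bad"
    show "\<omega> \<in> ?BG \<union> ?BS"
    proof (rule ccontr)
      assume "\<omega> \<notin> ?BG \<union> ?BS"
      with \<omega> have good: "16 * G \<omega> < 1" "ennreal (1 / s) * S \<omega> < 1" by (auto simp: not_le)
      have sites: "site \<omega> k \<in> S2" if "k \<in> I" for k
        using \<omega> measurable_space[OF site_measurable[OF that], of \<omega>] by simp
      have gram: "?g L \<omega> \<le> 1 / 16" for L
      proof (rule ccontr)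
        assume "\<not> ?g L \<omega> \<le> 1 / 16"
        then have "ennreal 1 \<le> ennreal (16 * ?g L \<omega>)" by (intro ennreal_leI) simp
        also have "\<dots> = 16 * ennreal (?g L \<omega>)" by (simp add: ennreal_mult')
        also have "\<dots> \<le> 16 * G \<omega>" unfolding G_def by (intro mult_left_mono SUP_upper) auto
        finally show False using good(1) by simp
      qed
      have score: "score_energy \<eta> I w (\<lambda>k. response \<omega> (fst k) (snd k) - \<mu> (site \<omega> k)) (site \<omega>) L \<le> s" for L
      proof (rule ccontr)
        assume "\<not> score_energy \<eta> I w (\<lambda>k. response \<omega> (fst k) (snd k) - \<mu> (site \<omega> k)) (site \<omega>) L \<le> s"
        then have "s < ?s L \<omega>" by (simp add: residual_def[abs_def])
        then have "ennreal 1 \<le> ennreal (1 / s * ?s L \<omega>)"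
          using s by (intro ennreal_leI) (simp add: field_simps)
        also have "\<dots> = ennreal (1 / s) * ennreal (?s L \<omega>)" using s by (intro ennreal_mult') auto
        also have "\<dots> \<le> ennreal (1 / s) * S \<omega>" unfolding S_def by (intro mult_left_mono SUP_upper) auto
        finally show False using good(2) by simp
      qed
      let ?g = "mean_estimator Y p \<D> n r \<eta> \<omega>"
      have min: "is_arg_min (mean_objective \<D> n r \<eta> (response \<omega>) (location \<omega>)) (\<lambda>g. g \<in> sobolev Y p) ?g"
        unfolding mean_estimator_def using sites
        by (intro mean_objective_minimizer[OF \<eta>]) (auto simp: site_def)
      then have g: "?g \<in> sobolev Y p" by (simp add: is_arg_min_def)
      have "mean_objective \<D> n r \<eta> (response \<omega>) (location \<omega>) ?g \<le> mean_objective \<D> n r \<eta> (response \<omega>) (location \<omega>) \<mu>"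
        using min \<mu>_sobolev by (auto simp: is_arg_min_def not_less)
      then have "(\<Sum>k\<in>I. w k * (response \<omega> (fst k) (snd k) - ?g (site \<omega> k))\<^sup>2) + \<eta> * (norm_S2 (\<D> ?g))\<^sup>2
        \<le> (\<Sum>k\<in>I. w k * (response \<omega> (fst k) (snd k) - \<mu> (site \<omega> k))\<^sup>2) + \<eta> * (norm_S2 (\<D> \<mu>))\<^sup>2"
        by (simp only: mean_objective_obs site_def)
      from penalized_fit_error[OF g \<mu>_sobolev \<eta> sites this score gram]
      have "(norm_S2 (\<lambda>u. ?g u - \<mu> u))\<^sup>2 \<le> 64 * s + 16 * \<eta> * (norm_S2 (\<D> \<mu>))\<^sup>2" by simp
      also have "(norm_S2 (\<D> \<mu>))\<^sup>2 \<le> C2\<^sup>2 * 2 powr p * K"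
        using norm_\<D>_le[OF \<mu>_sobolev] mult_left_mono[OF \<mu>_norm, of "C2\<^sup>2 * 2 powr p"] by simp
      then have "64 * s + 16 * \<eta> * (norm_S2 (\<D> \<mu>))\<^sup>2 \<le> 64 * s + 16 * \<eta> * (C2\<^sup>2 * 2 powr p * K)"
        using \<eta> by (intro add_left_mono mult_left_mono) auto
      also note T
      finally show False using \<omega> by simp
    qed
  qed
  then have "emeasure \<Omega> ?bad \<le> emeasure \<Omega> (?BG \<union> ?BS)"
    using BG(1) BS(1) by (intro emeasure_mono) auto
  also have "\<dots> \<le> emeasure \<Omega> ?BG + emeasure \<Omega> ?BS" by (rule emeasure_subadditive[OF BG(1) BS(1)])
  also have "\<dots> \<le> 16 * ennreal (weight_energy * \<kappa>\<^sup>2) + ennreal (1 / s) * ennreal V"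
    by (intro add_mono BG(2) BS(2))
  also have "\<dots> = ennreal (16 * (weight_energy * \<kappa>\<^sup>2) + (1 / s) * V)"
    using V0 s weight_energy_ge_0 by (simp add: ennreal_mult'[symmetric] ennreal_plus[symmetric] ennreal_numeral[symmetric] del: ennreal_plus ennreal_numeral)
  finally show ?thesis unfolding V_def .
qed

text \<open>The harmonic mean of positive integers is at least one.\<close>

lemma n_le_sample_size: "real n \<le> real n * harmonic_mean n r"
proof -
  define h where "h = 1 / real n * (\<Sum>i=1..n. 1 / real (r i))"
  have "(\<Sum>i=1..n. 1 / real (r i)) \<le> (\<Sum>i=1..n. 1)"
  proof (rule sum_mono)
    fix i assume "i \<in> {1..n}"
    from r[OF this] show "1 / real (r i) \<le> 1" by simp
  qed
  then have "h \<le> 1" using n by (simp add: h_def)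
  moreover have "h > 0"
  proof -
    have "(\<Sum>i=1..n. 1 / real (r i)) > 0"
    proof (rule sum_pos)
      fix i assume "i \<in> {1..n}"
      from r[OF this] show "1 / real (r i) > 0" by simp
    qed (use n in auto)
    then show ?thesis using n by (simp add: h_def)
  qed
  ultimately have "1 \<le> harmonic_mean n r"
    unfolding harmonic_mean_def h_def[symmetric] by (simp add: one_le_inverse_iff)
  then show ?thesis using n by (simp add: mult_le_cancel_left1)
qed

text \<open>For the prescribed size of \<open>\<eta>\<close> the kernel diagonal is at most \<open>H * a powr (1 / (p + 1))\<close>, where
  \<open>a = nr\<close>. Divided by \<open>a\<close> this is of the order of the rate \<open>a powr (- p / (p + 1))\<close>; its square divided by
  \<open>a\<close> still has a negative exponent, and \<open>a \<ge> n\<close> turns it into a null sequence in \<open>n\<close>.\<close>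

lemma rate_bound:
  assumes c: "c > 0" and c': "c' > 0"
  defines "a \<equiv> real n * harmonic_mean n r"
  defines "H \<equiv> 4 / min 1 (C1\<^sup>2) / (4 * pi) * c powr (- 1 / p)"
  assumes \<eta>l: "c * a powr (- p / (p + 1)) \<le> \<eta>" and \<eta>u: "\<eta> \<le> c' * a powr (- p / (p + 1))"
    and D: "D > 0" "32 * c' * (C2\<^sup>2 * 2 powr p * K) \<le> D"
  shows "emeasure \<Omega> {\<omega> \<in> space \<Omega>. (norm_S2 (\<lambda>u. mean_estimator Y p \<D> n r \<eta> \<omega> u - \<mu> u))\<^sup>2
            > D * (a powr (- p / (p + 1)) + 1 / real n)}
    \<le> ennreal (256 * pi\<^sup>2 * H\<^sup>2 * real n powr (2 / (p + 1) - 1)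
        + 128 / D * (16 * pi\<^sup>2 * H * (\<sigma>\<^sup>2 + (2 * M + 2 * K) / (4 * pi)) + (2 * M + 2 * K)))"
proof -
  let ?q = "a powr (- p / (p + 1))" and ?h = "H * a powr (1 / (p + 1))"
  let ?\<tau> = "?q + 1 / real n" and ?B = "2 * M + 2 * K"
  have n0: "real n > 0" using n by simp
  have a: "a \<ge> real n" unfolding a_def by (rule n_le_sample_size)
  then have a0: "a > 0" using n0 by linarith
  have \<tau>: "?\<tau> > 0" using a0 n0 by (simp add: add_pos_nonneg)
  have H: "H \<ge> 0" unfolding H_def using C1 by simp
  have \<eta>: "\<eta> > 0" using \<eta>l c a0 by (smt (verit) mult_pos_pos powr_gt_zero)
  have \<kappa>: "kernel_diagonal \<eta> L \<le> ?h" for L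
  proof -
    have "\<eta> powr (- 1 / p) \<le> (c * ?q) powr (- 1 / p)"
      using \<eta>l c a0 p by (intro powr_mono2') (auto intro!: mult_pos_pos)
    also have "\<dots> = c powr (- 1 / p) * a powr (1 / (p + 1))"
      using p by (subst powr_mult) (simp add: powr_powr)
    finally have "4 / min 1 (C1\<^sup>2) * \<eta> powr (- 1 / p) \<le> 4 / min 1 (C1\<^sup>2) * (c powr (- 1 / p) * a powr (1 / (p + 1)))"
      using C1 by (intro mult_left_mono) auto
    with effective_dimension_bound[OF _ \<eta> C1 d_lower, of L] p
    have "(\<Sum>l<L. (2 * real l + 1) / (1 + \<eta> * (d l)\<^sup>2)) \<le> 4 / min 1 (C1\<^sup>2) * (c powr (- 1 / p) * a powr (1 / (p + 1)))" by simp
    then have "kernel_diagonal \<eta> L \<le> 4 / min 1 (C1\<^sup>2) * (c powr (- 1 / p) * a powr (1 / (p + 1))) / (4 * pi)"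
      unfolding kernel_diagonal_def by (rule divide_right_mono) simp
    then show ?thesis by (simp add: H_def)
  qed
  \<comment> \<open>The level \<open>D ?\<tau>\<close> is split evenly between \<open>64 s\<close> and the penalty of the mean function.\<close>
  define s where "s = D * ?\<tau> / 128"
  have s: "s > 0" using D \<tau> by (simp add: s_def)
  have pen: "16 * \<eta> * (C2\<^sup>2 * 2 powr p * K) \<le> D * ?\<tau> / 2"
  proof -
    have "\<eta> \<le> c' * ?\<tau>"
      using c' n0 by (intro order_trans[OF \<eta>u mult_left_mono]) auto
    then have "16 * \<eta> * (C2\<^sup>2 * 2 powr p * K) \<le> 16 * (c' * ?\<tau>) * (C2\<^sup>2 * 2 powr p * K)"
      using K by (intro mult_right_mono mult_left_mono) auto
    also have "\<dots> = (32 * c' * (C2\<^sup>2 * 2 powr p * K)) * ?\<tau> / 2" by simp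
    also have "\<dots> \<le> D * ?\<tau> / 2" using D \<tau> by (intro divide_right_mono mult_right_mono) auto
    finally show ?thesis .
  qed
  have W: "weight_energy = 16 * pi\<^sup>2 / a" by (simp add: weight_energy_eq a_def)
  have W1: "weight_energy * ?h = 16 * pi\<^sup>2 * H * ?q"
  proof -
    have "- p / (p + 1) = 1 / (p + 1) - 1" using p by (simp add: field_simps)
    then have "?q = a powr (1 / (p + 1)) / a" using a0 by (simp add: powr_diff)
    then show ?thesis by (simp add: W)
  qed
  have W2: "weight_energy * ?h\<^sup>2 \<le> 16 * pi\<^sup>2 * H\<^sup>2 * real n powr (2 / (p + 1) - 1)"
  proof -
    have "(a powr (1 / (p + 1)))\<^sup>2 = a powr (2 / (p + 1))"
      by (simp add: power2_eq_square powr_add[symmetric])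
    then have "weight_energy * ?h\<^sup>2 = 16 * pi\<^sup>2 * H\<^sup>2 * a powr (2 / (p + 1) - 1)"
      using a0 by (simp add: W power_mult_distrib powr_diff)
    also have "a powr (2 / (p + 1) - 1) \<le> real n powr (2 / (p + 1) - 1)"
      using a n0 p by (intro powr_mono2') (auto simp: field_simps)
    then have "16 * pi\<^sup>2 * H\<^sup>2 * a powr (2 / (p + 1) - 1) \<le> 16 * pi\<^sup>2 * H\<^sup>2 * real n powr (2 / (p + 1) - 1)"
      by (intro mult_left_mono) auto
    finally show ?thesis .
  qed
  have "64 * s = D * ?\<tau> / 2" by (simp add: s_def)
  moreover have "x + y \<le> t" if "x = t / 2" "y \<le> t / 2" for x y t :: real using that by simp
  ultimately have "64 * s + 16 * \<eta> * (C2\<^sup>2 * 2 powr p * K) \<le> D * ?\<tau>" using pen by blast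
  from estimation_tail_bound[OF \<eta> \<kappa> s this]
  have "emeasure \<Omega> {\<omega> \<in> space \<Omega>. (norm_S2 (\<lambda>u. mean_estimator Y p \<D> n r \<eta> \<omega> u - \<mu> u))\<^sup>2 > D * ?\<tau>}
    \<le> ennreal (16 * (weight_energy * ?h\<^sup>2)
        + (1 / s) * (weight_energy * ?h * \<sigma>\<^sup>2
           + (weight_energy * ?h / (4 * pi) + 1 / real n) * ?B))" .
  also have "\<dots> \<le> ennreal (256 * pi\<^sup>2 * H\<^sup>2 * real n powr (2 / (p + 1) - 1)
        + 128 / D * (16 * pi\<^sup>2 * H * (\<sigma>\<^sup>2 + ?B / (4 * pi)) + ?B))"
  proof (intro ennreal_leI add_mono)
    show "16 * (weight_energy * ?h\<^sup>2) \<le> 256 * pi\<^sup>2 * H\<^sup>2 * real n powr (2 / (p + 1) - 1)"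
      by (rule order_trans[OF mult_left_mono[OF W2]]) simp_all
    let ?v = "16 * pi\<^sup>2 * H"
    have "weight_energy * ?h * \<sigma>\<^sup>2 + (weight_energy * ?h / (4 * pi) + 1 / real n) * ?B
      = ?q * (?v * (\<sigma>\<^sup>2 + ?B / (4 * pi))) + (1 / real n) * ?B"
      unfolding W1 by (simp add: algebra_simps add_divide_distrib)
    also have "\<dots> \<le> ?\<tau> * (?v * (\<sigma>\<^sup>2 + ?B / (4 * pi))) + ?\<tau> * ?B"
      using H M K n0 by (intro add_mono mult_right_mono mult_nonneg_nonneg add_nonneg_nonneg) auto
    also have "\<dots> = ?\<tau> * (?v * (\<sigma>\<^sup>2 + ?B / (4 * pi)) + ?B)" by (simp only: distrib_left)
    finally have "(1 / s) * (weight_energy * ?h * \<sigma>\<^sup>2 + (weight_energy * ?h / (4 * pi) + 1 / real n) * ?B)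
      \<le> (1 / s) * (?\<tau> * (?v * (\<sigma>\<^sup>2 + ?B / (4 * pi)) + ?B))"
      using s by (intro mult_left_mono) auto
    also have "\<dots> = 128 / D * (?v * (\<sigma>\<^sup>2 + ?B / (4 * pi)) + ?B)"
    proof -
      have "(1 / (x * t / 128)) * t = 128 / x" if "t > 0" "x > 0" for t x :: real using that by simp
      then have "(1 / s) * ?\<tau> = 128 / D" using \<tau> D(1) unfolding s_def by blast
      then show ?thesis by (simp only: mult.assoc[symmetric])
    qed
    finally show "(1 / s) * (weight_energy * ?h * \<sigma>\<^sup>2
           + (weight_energy * ?h / (4 * pi) + 1 / real n) * ?B)
      \<le> 128 / D * (?v * (\<sigma>\<^sup>2 + ?B / (4 * pi)) + ?B)" .
  qed
  finally show ?thesis .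
qed

end

section \<open>The rate of convergence of the mean estimator\<close>

theorem theorem16:
  fixes Y :: "nat \<Rightarrow> int \<Rightarrow> real^3 \<Rightarrow> real"
    and p q M K \<sigma> :: real
    and \<D> :: "(real^3 \<Rightarrow> real) \<Rightarrow> (real^3 \<Rightarrow> real)"
    and E :: "real measure"
    and r :: "nat \<Rightarrow> nat \<Rightarrow> nat"
    and \<eta> :: "nat \<Rightarrow> real"
  defines "nr \<equiv> \<lambda>n. real n * harmonic_mean n (r n)"
  assumes "spherical_harmonic_basis Y"
    and "p > 2" and "1 < q" and "q \<le> p"
    and "admissible_operator Y p \<D>"
    and "M > 0" and "K > 0"
    and "prob_space E" and "sets E = sets borel"
    and "integrable E (\<lambda>x. x\<^sup>2)" and "(LINT x|E. x) = 0" and "(LINT x|E. x\<^sup>2) = \<sigma>\<^sup>2" and "\<sigma>\<^sup>2 > 0"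
    and "\<And>n i. i \<in> {1..n} \<Longrightarrow> r n i \<ge> 1"
    and "\<exists>c c'. 0 < c \<and> c \<le> c' \<and>
           (\<forall>n\<ge>1. c * nr n powr (- p / (p + 1)) \<le> \<eta> n \<and> \<eta> n \<le> c' * nr n powr (- p / (p + 1)))"
  shows "((\<lambda>D::real. limsup (\<lambda>n. SUP P\<in>Pi1 Y M K p q.
            emeasure (sample_law P E n (r n))
              {\<omega> \<in> space (sample_law P E n (r n)).
                 (norm_S2 (\<lambda>u. mean_estimator Y p \<D> n (r n) (\<eta> n) \<omega> u - mean_fun P u))\<^sup>2
                   > D * (nr n powr (- p / (p + 1)) + 1 / real n)}))
          \<longlongrightarrow> 0) at_top"
proof -
  obtain d C1 C2 where op: "C1 > 0" "C2 > 0"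
      "\<And>l. C1 * (1 + real l) powr p \<le> \<bar>d l\<bar>" "\<And>l. \<bar>d l\<bar> \<le> C2 * (1 + real l) powr p"
      "\<And>f. f \<in> sobolev Y p \<Longrightarrow> \<D> f \<in> L2_S2"
      "\<And>f. f \<in> sobolev Y p \<Longrightarrow> (\<lambda>N. norm_S2 (\<lambda>x. \<D> f x - (\<Sum>l<N. d l * degree_part Y f l x))) \<longlonglongrightarrow> 0"
    using \<open>admissible_operator Y p \<D>\<close> unfolding admissible_operator_def by blast
  obtain c c' where c: "0 < c" "c \<le> c'"
      "\<And>n. n \<ge> 1 \<Longrightarrow> c * nr n powr (- p / (p + 1)) \<le> \<eta> n"
      "\<And>n. n \<ge> 1 \<Longrightarrow> \<eta> n \<le> c' * nr n powr (- p / (p + 1))"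
    using assms(16) by blast
  have smoothing: "smoothing_operator Y p C1 C2 d \<D>"
    by unfold_locales ((rule assms(2,3) op(1-4)) | (erule op(5,6)))+
  define H where "H = 4 / min 1 (C1\<^sup>2) / (4 * pi) * c powr (- 1 / p)"
  define V where "V = 16 * pi\<^sup>2 * H * (\<sigma>\<^sup>2 + (2 * M + 2 * K) / (4 * pi)) + (2 * M + 2 * K)"
  define F where "F D = limsup (\<lambda>n. SUP P\<in>Pi1 Y M K p q.
            emeasure (sample_law P E n (r n))
              {\<omega> \<in> space (sample_law P E n (r n)).
                 (norm_S2 (\<lambda>u. mean_estimator Y p \<D> n (r n) (\<eta> n) \<omega> u - mean_fun P u))\<^sup>2
                   > D * (nr n powr (- p / (p + 1)) + 1 / real n)})" for D
  have bound: "F D \<le> ennreal (128 / D * V)" if D: "D > 0" "32 * c' * (C2\<^sup>2 * 2 powr p * K) \<le> D" for D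
  proof -
    let ?b = "\<lambda>n. 256 * pi\<^sup>2 * H\<^sup>2 * real n powr (2 / (p + 1) - 1) + 128 / D * V"
    have "F D \<le> limsup (\<lambda>n. ennreal (?b n))"
      unfolding F_def
    proof (rule Limsup_mono)
      show "\<forall>\<^sub>F n in sequentially. (SUP P\<in>Pi1 Y M K p q.
            emeasure (sample_law P E n (r n))
              {\<omega> \<in> space (sample_law P E n (r n)).
                 (norm_S2 (\<lambda>u. mean_estimator Y p \<D> n (r n) (\<eta> n) \<omega> u - mean_fun P u))\<^sup>2
                   > D * (nr n powr (- p / (p + 1)) + 1 / real n)}) \<le> ennreal (?b n)"
        using eventually_ge_at_top[of 1]
      proof eventually_elim
        case (elim n)
        show ?case
        proof (rule SUP_least)
          fix P assume P: "P \<in> Pi1 Y M K p q"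
          interpret sampling_design Y p C1 C2 d \<D> q M K \<sigma> P E n "r n"
            by (intro sampling_design.intro sampling_model.intro sampling_model_axioms.intro
                sampling_design_axioms.intro smoothing P elim assms(4,7-13,15))
          show "emeasure (sample_law P E n (r n))
              {\<omega> \<in> space (sample_law P E n (r n)).
                 (norm_S2 (\<lambda>u. mean_estimator Y p \<D> n (r n) (\<eta> n) \<omega> u - mean_fun P u))\<^sup>2
                   > D * (nr n powr (- p / (p + 1)) + 1 / real n)} \<le> ennreal (?b n)"
            unfolding H_def V_def nr_def using c(1,2)
            by (intro rate_bound[OF c(1) _ c(3,4)[OF elim, unfolded nr_def] D]) simp
        qed
      qed
    qed
    also have "\<dots> = ennreal (128 / D * V)"
    proof (rule lim_imp_Limsup)
      have "(\<lambda>n. real n powr (2 / (p + 1) - 1)) \<longlonglongrightarrow> 0"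
        using \<open>p > 2\<close> by (intro tendsto_neg_powr filterlim_real_sequentially) (simp add: field_simps)
      then have "?b \<longlonglongrightarrow> 256 * pi\<^sup>2 * H\<^sup>2 * 0 + 128 / D * V" by (intro tendsto_intros)
      then show "(\<lambda>n. ennreal (?b n)) \<longlonglongrightarrow> ennreal (128 / D * V)" by (intro tendsto_ennrealI) simp
    qed simp
    finally show ?thesis .
  qed
  have "((\<lambda>D. ennreal (128 / D * V)) \<longlongrightarrow> ennreal 0) at_top"
  proof (rule tendsto_ennrealI)
    have "((\<lambda>D. 128 * V / D) \<longlongrightarrow> 0) at_top"
      by (rule tendsto_divide_0[OF tendsto_const]) (rule filterlim_at_top_imp_at_infinity[OF filterlim_ident])
    then show "((\<lambda>D. 128 / D * V) \<longlongrightarrow> 0) at_top" by simp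
  qed
  moreover have "\<forall>\<^sub>F D in at_top. F D \<le> ennreal (128 / D * V)"
    using eventually_gt_at_top[of 0] eventually_ge_at_top[of "32 * c' * (C2\<^sup>2 * 2 powr p * K)"]
    by eventually_elim (rule bound)
  ultimately have "(F \<longlongrightarrow> 0) at_top"
    by (intro tendsto_sandwich[OF _ _ tendsto_const, of "0 :: ennreal" F at_top]) auto
  then show ?thesis unfolding F_def .
qed

end
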